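(* Let $f\colon M\to N$ be a smooth map between manifolds, where $M$ is a Banach manifold. If, for some $m\in M$, the differential $T_mf\colon T_mM\to T_{f(m)}N$ is a regular operator, then $f$ can be brought into a normal form at $m$. In particular, every smooth map $f\colon M\to N$ with $M$ finite-dimensional can be brought into a normal form at every point.
   Context: Manifolds are smooth manifolds without boundary, modeled on (possibly infinite-dimensional) locally convex spaces, with smoothness in the Michal–Bastiani sense; a Banach manifold is one modeled on Banach spaces. A chart at a point sends that point to $0$. Regular operator: a continuous linear map $T\colon X\to Y$ between locally convex spaces is regular if it is relatively open (open as a map onto $\operatorname{Im}T$ with the relative topology) and $\operatorname{Ker}T\subseteq X$, $\operatorname{Im}T\subseteq Y$ are closed, topologically complemented subspaces. Abstract normal form: a tuple $(X,Y,\hat f,f_{\mathrm{sing}})$ where (i) $X,Y$ are locally convex spaces with topological direct sum decompositions $X=\mathrm{Ker}\oplus\mathrm{Coim}$, $Y=\mathrm{Coker}\oplus\mathrm{Im}$ (the names denote abstract closed subspaces); (ii) $\hat f\colon\mathrm{Coim}\to\mathrm{Im}$ is a linear topological isomorphism; (iii) $f_{\mathrm{sing}}\colon U\to\mathrm{Coker}$ is a smooth map on an open neighborhood $U$ of $0$ in $X$ with $f_{\mathrm{sing}}(0,x_2)=0$ for all $x_2\in U\cap\mathrm{Coim}$ and derivative $T_{(0,0)}f_{\mathrm{sing}}=0$. Put $f_{\mathrm{NF}}(x_1,x_2)=\hat f(x_2)+f_{\mathrm{sing}}(x_1,x_2)$ for $(x_1,x_2)\in U$, with $x_1\in\mathrm{Ker}$,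 $x_2\in\mathrm{Coim}$. A smooth map $f\colon M\to N$ can be brought into a normal form at $m\in M$ if there are an abstract normal form $(X,Y,\hat f,f_{\mathrm{sing}})$ and charts $\kappa\colon M\supseteq U'\to U\subseteq X$ at $m$ and $\rho\colon N\supseteq V'\to V\subseteq Y$ at $f(m)$ with $f(U')\subseteq V'$ and $\rho\circ f|_{U'}=f_{\mathrm{NF}}\circ\kappa$. *)

theory Defs
  imports "HOL-Analysis.Analysis" "HOL-Library.Function_Algebras"
begin

section \<open>Locally convex spaces\<close>

text \<open>
  Hausdorff locally convex spaces (the last conjunct of the second axiom is
  \<open>convex C\<close>, unfolded). Throughout, the individual spaces are linear subspaces of
  such a type, with the subspace topology. Every set-indexed family of locally convex spaces
  embeds in this way (into its product), so a manifold may use several model spaces.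
\<close>

class locally_convex = real_vector + t2_space + topological_ab_group_add +
  assumes tendsto_scaleR_Pair:
    "LIM x (nhds a \<times>\<^sub>F nhds b). fst x *\<^sub>R snd x :> nhds (a *\<^sub>R b)"
  assumes locally_convex_0:
    "open U \<Longrightarrow> 0 \<in> U \<Longrightarrow> \<exists>C. open C \<and> 0 \<in> C \<and> C \<subseteq> U \<and>
       (\<forall>x\<in>C. \<forall>y\<in>C. \<forall>u\<ge>0. \<forall>v\<ge>0. u + v = 1 \<longrightarrow> u *\<^sub>R x + v *\<^sub>R y \<in> C)"

lemma tendsto_scaleR_locally_convex:
  fixes g :: "'i \<Rightarrow> 'a::locally_convex"
  assumes "(f \<longlongrightarrow> a) F" "(g \<longlongrightarrow> b) F"
  shows "((\<lambda>x. f x *\<^sub>R g x) \<longlongrightarrow> a *\<^sub>R b) F"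
  using filterlim_compose[OF tendsto_scaleR_Pair, of "\<lambda>x. (f x, g x)" a b F] assms
  by (simp add: nhds_prod[symmetric] tendsto_Pair)

lemma locally_convexD:
  fixes U :: "'a::locally_convex set"
  assumes "open U" "0 \<in> U"
  shows "\<exists>C. open C \<and> convex C \<and> 0 \<in> C \<and> C \<subseteq> U"
  using locally_convex_0[OF assms] unfolding convex_def by blast

lemma locally_convex_0I:
  fixes U :: "'a::{real_vector, topological_space} set"
  assumes "\<exists>C. open C \<and> convex C \<and> 0 \<in> C \<and> C \<subseteq> U"
  shows "\<exists>C. open C \<and> 0 \<in> C \<and> C \<subseteq> U \<and>
       (\<forall>x\<in>C. \<forall>y\<in>C. \<forall>u\<ge>0. \<forall>v\<ge>0. u + v = 1 \<longrightarrow> u *\<^sub>R x + v *\<^sub>R y \<in> C)"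
  using assms unfolding convex_def by blast

instance real_normed_vector \<subseteq> locally_convex
proof
  fix a :: real and b :: 'a
  show "LIM x (nhds a \<times>\<^sub>F nhds b). fst x *\<^sub>R snd x :> nhds (a *\<^sub>R b)"
    by (intro tendsto_scaleR filterlim_fst filterlim_snd)
next
  fix U :: "'a set"
  assume "open U" "0 \<in> U"
  then obtain e where "e > 0" "ball 0 e \<subseteq> U"
    using openE by blast
  then show "\<exists>C. open C \<and> 0 \<in> C \<and> C \<subseteq> U \<and>
       (\<forall>x\<in>C. \<forall>y\<in>C. \<forall>u\<ge>0. \<forall>v\<ge>0. u + v = 1 \<longrightarrow> u *\<^sub>R x + v *\<^sub>R y \<in> C)"
    by (intro locally_convex_0I exI[of _ "ball 0 e"]) auto
qed

instantiation "fun" :: (type, real_vector) real_vector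
begin

definition scaleR_fun_def: "c *\<^sub>R f = (\<lambda>x. c *\<^sub>R f x)"

instance
  by standard (auto simp: scaleR_fun_def fun_eq_iff algebra_simps)

end

lemma tendsto_fun_iff:
  fixes f :: "'i \<Rightarrow> 'a \<Rightarrow> 'b::topological_space"
  shows "(f \<longlongrightarrow> l) F \<longleftrightarrow> (\<forall>x. ((\<lambda>i. f i x) \<longlongrightarrow> l x) F)"
  using limitin_componentwise[of "\<lambda>_. euclidean" UNIV f l F]
  by (simp add: euclidean_product_topology)

lemma open_vimage_eval:
  "open W \<Longrightarrow> open ((\<lambda>h. h x) -` W)" for W :: "'b::topological_space set"
  by (intro open_vimage) auto

instance "fun" :: (type, t0_space) t0_space
proof
  fix f g :: "'a \<Rightarrow> 'b"
  assume "f \<noteq> g"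
  then obtain x where x: "f x \<noteq> g x" by (meson ext)
  from t0_space_class.t0_space[OF x] obtain U where "open U" "\<not> (f x \<in> U \<longleftrightarrow> g x \<in> U)"
    by blast
  then show "\<exists>U. open U \<and> \<not> (f \<in> U \<longleftrightarrow> g \<in> U)"
    using open_vimage_eval[of U x] by (intro exI[of _ "(\<lambda>h. h x) -` U"]) auto
qed

instance "fun" :: (type, t1_space) t1_space
proof
  fix f g :: "'a \<Rightarrow> 'b"
  assume "f \<noteq> g"
  then obtain x where x: "f x \<noteq> g x" by (meson ext)
  from t1_space_class.t1_space[OF x] obtain U where "open U" "f x \<in> U" "g x \<notin> U"
    by blast
  then show "\<exists>U. open U \<and> f \<in> U \<and> g \<notin> U"
    using open_vimage_eval[of U x] by (intro exI[of _ "(\<lambda>h. h x) -` U"]) auto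
qed

instance "fun" :: (type, t2_space) t2_space
proof
  fix f g :: "'a \<Rightarrow> 'b"
  assume "f \<noteq> g"
  then obtain x where x: "f x \<noteq> g x" by (meson ext)
  from hausdorff[OF x] obtain U V
    where UV: "open U" "open V" "f x \<in> U" "g x \<in> V" "U \<inter> V = {}"
    by blast
  show "\<exists>U V. open U \<and> open V \<and> f \<in> U \<and> g \<in> V \<and> U \<inter> V = {}"
    using UV by (intro exI[of _ "(\<lambda>h. h x) -` U"] exI[of _ "(\<lambda>h. h x) -` V"] conjI open_vimage_eval) auto
qed

instance "fun" :: (type, locally_convex) locally_convex
proof
  fix f g :: "'a \<Rightarrow> 'b"
  have c: "((\<lambda>h. h x) \<longlongrightarrow> f x) (nhds f)" for x and f :: "'a \<Rightarrow> 'b"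
    using tendsto_fun_iff[of "\<lambda>h. h" f "nhds f"] by (simp add: filterlim_ident)
  have c1: "((\<lambda>p. fst p x) \<longlongrightarrow> f x) (nhds f \<times>\<^sub>F nhds g)" for x
    by (rule filterlim_compose[OF c filterlim_fst])
  have c2: "((\<lambda>p. snd p x) \<longlongrightarrow> g x) (nhds a \<times>\<^sub>F nhds g)" for x and a :: "'c::topological_space"
    by (rule filterlim_compose[OF c filterlim_snd])
  show "LIM p (nhds f \<times>\<^sub>F nhds g). fst p + snd p :> nhds (f + g)"
    unfolding tendsto_fun_iff plus_fun_def by (intro allI tendsto_add c1 c2)
  show "(uminus \<longlongrightarrow> - f) (nhds f)"
    unfolding tendsto_fun_iff fun_Compl_def by (intro allI tendsto_minus c)
  fix r :: real
  show "LIM p (nhds r \<times>\<^sub>F nhds g). fst p *\<^sub>R snd p :> nhds (r *\<^sub>R g)"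
    unfolding tendsto_fun_iff scaleR_fun_def
    by (intro allI tendsto_scaleR_locally_convex filterlim_fst c2)
next
  fix U :: "('a \<Rightarrow> 'b) set"
  assume U: "open U" "0 \<in> U"
  then obtain X where X: "0 \<in> Pi\<^sub>E UNIV X" "\<And>i. open (X i)" "finite {i. X i \<noteq> UNIV}"
    "Pi\<^sub>E UNIV X \<subseteq> U"
    using product_topology_open_contains_basis[of "\<lambda>_. euclidean" UNIV U 0]
    by (auto simp: open_fun_def)
  have "\<exists>C. open C \<and> convex C \<and> 0 \<in> C \<and> C \<subseteq> X i \<and> (X i = UNIV \<longrightarrow> C = UNIV)" for i
  proof (cases "X i = UNIV")
    case False
    have "0 \<in> X i" using X(1) by (auto simp: PiE_iff)
    then show ?thesis using locally_convexD[OF X(2)] False by blast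
  qed auto
  then obtain C where C: "\<And>i. open (C i) \<and> convex (C i) \<and> 0 \<in> C i \<and> C i \<subseteq> X i \<and>
      (X i = UNIV \<longrightarrow> C i = UNIV)"
    by metis
  have "finite {i. C i \<noteq> UNIV}"
    using X(3) by (rule rev_finite_subset) (use C in auto)
  then have "open (Pi\<^sub>E UNIV C)"
    using C by (intro open_PiE) auto
  moreover have "convex (Pi\<^sub>E UNIV C)"
    using C by (auto simp: convex_def scaleR_fun_def PiE_iff)
  moreover have "Pi\<^sub>E UNIV C \<subseteq> U"
    by (rule order_trans[OF PiE_mono X(4)]) (use C in blast)
  moreover have "0 \<in> Pi\<^sub>E UNIV C"
    using C by (auto simp: PiE_iff)
  ultimately show "\<exists>C. open C \<and> 0 \<in> C \<and> C \<subseteq> U \<and>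
       (\<forall>x\<in>C. \<forall>y\<in>C. \<forall>u\<ge>0. \<forall>v\<ge>0. u + v = 1 \<longrightarrow> u *\<^sub>R x + v *\<^sub>R y \<in> C)"
    by (intro locally_convex_0I) blast
qed

definition linear_on :: "'a::real_vector set \<Rightarrow> ('a \<Rightarrow> 'b::real_vector) \<Rightarrow> bool" where
  "linear_on X T \<longleftrightarrow>
     (\<forall>x\<in>X. \<forall>y\<in>X. T (x + y) = T x + T y) \<and> (\<forall>c. \<forall>x\<in>X. T (c *\<^sub>R x) = c *\<^sub>R T x)"

definition topological_direct_sum :: "'a::locally_convex set \<Rightarrow> 'a set \<Rightarrow> 'a set \<Rightarrow> bool" where
  "topological_direct_sum X A B \<longleftrightarrow>
     subspace X \<and> subspace A \<and> subspace B \<and>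
     closedin (top_of_set X) A \<and> closedin (top_of_set X) B \<and>
     homeomorphic_map (top_of_set (A \<times> B)) (top_of_set X) (\<lambda>(a, b). a + b)"

definition complemented_in :: "'a::locally_convex set \<Rightarrow> 'a set \<Rightarrow> bool" where
  "complemented_in X A \<longleftrightarrow> (\<exists>B. topological_direct_sum X A B)"

definition regular_operator ::
    "'a::locally_convex set \<Rightarrow> 'b::locally_convex set \<Rightarrow> ('a \<Rightarrow> 'b) \<Rightarrow> bool" where
  "regular_operator X Y T \<longleftrightarrow>
     linear_on X T \<and> T ` X \<subseteq> Y \<and> continuous_on X T \<and>
     open_map (top_of_set X) (top_of_set (T ` X)) T \<and>
     closedin (top_of_set X) {x\<in>X. T x = 0} \<and> complemented_in X {x\<in>X. T x = 0} \<and>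
     closedin (top_of_set Y) (T ` X) \<and> complemented_in Y (T ` X)"

definition banach_space_on :: "'a::locally_convex set \<Rightarrow> bool" where
  "banach_space_on X \<longleftrightarrow> subspace X \<and>
     (\<exists>n :: 'a \<Rightarrow> real.
        (\<forall>c. \<forall>x\<in>X. n (c *\<^sub>R x) = \<bar>c\<bar> * n x) \<and>
        Metric_space X (\<lambda>x y. n (x - y)) \<and>
        Metric_space.mtopology X (\<lambda>x y. n (x - y)) = top_of_set X \<and>
        Metric_space.mcomplete X (\<lambda>x y. n (x - y)))"

definition finite_dimensional_space_on :: "'a::locally_convex set \<Rightarrow> bool" where
  "finite_dimensional_space_on X \<longleftrightarrow> (\<exists>B. finite B \<and> span B = X)"


section \<open>Michal--Bastiani smoothness\<close>

definition has_directional_derivative ::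
    "('a::locally_convex \<Rightarrow> 'b::locally_convex) \<Rightarrow> 'b \<Rightarrow> 'a \<Rightarrow> 'a \<Rightarrow> bool" where
  "has_directional_derivative f l x v \<longleftrightarrow>
     ((\<lambda>t. (f (x + t *\<^sub>R v) - f x) /\<^sub>R t) \<longlongrightarrow> l) (at 0)"

definition directional_derivative ::
    "('a::locally_convex \<Rightarrow> 'b::locally_convex) \<Rightarrow> 'a \<Rightarrow> 'a \<Rightarrow> 'b" where
  "directional_derivative f x v = Lim (at 0) (\<lambda>t. (f (x + t *\<^sub>R v) - f x) /\<^sub>R t)"

text \<open>The iterated derivative in the directions \<open>v 0\<close>, \dots, \<open>v (k - 1)\<close>.\<close>

primrec iterated_derivative ::
    "nat \<Rightarrow> ('a::locally_convex \<Rightarrow> 'b::locally_convex) \<Rightarrow> 'a \<Rightarrow> (nat \<Rightarrow> 'a) \<Rightarrow> 'b" where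
  "iterated_derivative 0 f x v = f x"
| "iterated_derivative (Suc k) f x v =
     directional_derivative (\<lambda>y. iterated_derivative k f y v) x (v k)"

text \<open>
  \<open>f\<close> is smooth as a map from the open subset \<open>U\<close> of \<open>X\<close> to \<open>Y\<close>: all iterated directional
  derivatives exist in \<open>Y\<close> and are jointly continuous on \<open>U \<times> X\<^sup>k\<close>. The values of \<open>f\<close>
  outside \<open>U\<close> are irrelevant.
\<close>

definition smooth_on ::
    "'a::locally_convex set \<Rightarrow> 'a set \<Rightarrow> 'b::locally_convex set \<Rightarrow> ('a \<Rightarrow> 'b) \<Rightarrow> bool" where
  "smooth_on X U Y f \<longleftrightarrow>
     openin (top_of_set X) U \<and> f ` U \<subseteq> Y \<and>
     (\<forall>k. \<forall>x\<in>U. \<forall>v \<in> {..<Suc k} \<rightarrow>\<^sub>E X.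
        \<exists>l\<in>Y. has_directional_derivative (\<lambda>y. iterated_derivative k f y v) l x (v k)) \<and>
     (\<forall>k. continuous_on (U \<times> ({..<k} \<rightarrow>\<^sub>E X)) (\<lambda>(x, v). iterated_derivative k f x v))"


section \<open>Manifolds\<close>

record ('m, 'e) chart =
  chart_dom :: "'m set"
  chart_map :: "'m \<Rightarrow> 'e"
  chart_model :: "'e set"

abbreviation chart_img :: "('m, 'e) chart \<Rightarrow> 'e set" where
  "chart_img c \<equiv> chart_map c ` chart_dom c"

definition chart_inv :: "('m, 'e) chart \<Rightarrow> 'e \<Rightarrow> 'm" where
  "chart_inv c = inv_into (chart_dom c) (chart_map c)"

definition is_chart :: "'m topology \<Rightarrow> ('m, 'e::locally_convex) chart \<Rightarrow> bool" where
  "is_chart T c \<longleftrightarrow>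
     openin T (chart_dom c) \<and> subspace (chart_model c) \<and>
     openin (top_of_set (chart_model c)) (chart_img c) \<and>
     homeomorphic_map (subtopology T (chart_dom c)) (top_of_set (chart_img c)) (chart_map c)"

definition smooth_transition ::
    "('m, 'e::locally_convex) chart \<Rightarrow> ('m, 'e) chart \<Rightarrow> bool" where
  "smooth_transition c d \<longleftrightarrow>
     smooth_on (chart_model c) (chart_map c ` (chart_dom c \<inter> chart_dom d)) (chart_model d)
       (chart_map d \<circ> chart_inv c)"

record ('m, 'e) manifold =
  mtop :: "'m topology"
  charts :: "('m, 'e) chart set"

abbreviation points :: "('m, 'e) manifold \<Rightarrow> 'm set" where
  "points M \<equiv> topspace (mtop M)"

text \<open>
  The set of charts is a maximal atlas. It contains charts with empty domain and an arbitrary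
  model space, so properties of the model spaces are expressed by charts around each point.
\<close>

definition smooth_manifold :: "('m, 'e::locally_convex) manifold \<Rightarrow> bool" where
  "smooth_manifold M \<longleftrightarrow>
     Hausdorff_space (mtop M) \<and>
     (\<forall>c\<in>charts M. is_chart (mtop M) c) \<and>
     (\<Union>c\<in>charts M. chart_dom c) = points M \<and>
     (\<forall>c\<in>charts M. \<forall>d\<in>charts M. smooth_transition c d) \<and>
     (\<forall>c. is_chart (mtop M) c \<and>
          (\<forall>d\<in>charts M. smooth_transition c d \<and> smooth_transition d c) \<longrightarrow> c \<in> charts M)"

definition charts_around :: "('m, 'e) manifold \<Rightarrow> 'm \<Rightarrow> ('m, 'e) chart set" where
  "charts_around M m = {c \<in> charts M. m \<in> chart_dom c}"

definition banach_manifold :: "('m, 'e::locally_convex) manifold \<Rightarrow> bool" where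
  "banach_manifold M \<longleftrightarrow> smooth_manifold M \<and>
     (\<forall>m\<in>points M. \<exists>c\<in>charts_around M m. banach_space_on (chart_model c))"

definition finite_dimensional_manifold :: "('m, 'e::locally_convex) manifold \<Rightarrow> bool" where
  "finite_dimensional_manifold M \<longleftrightarrow> smooth_manifold M \<and>
     (\<forall>m\<in>points M. \<exists>c\<in>charts_around M m. finite_dimensional_space_on (chart_model c))"

definition local_rep ::
    "('m, 'e) chart \<Rightarrow> ('n, 'f) chart \<Rightarrow> ('m \<Rightarrow> 'n) \<Rightarrow> 'e \<Rightarrow> 'f" where
  "local_rep c d f = chart_map d \<circ> f \<circ> chart_inv c"

definition smooth_map ::
    "('m, 'e::locally_convex) manifold \<Rightarrow> ('n, 'f::locally_convex) manifold \<Rightarrow> ('m \<Rightarrow> 'n) \<Rightarrow> bool"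
  where
  "smooth_map M N f \<longleftrightarrow>
     continuous_map (mtop M) (mtop N) f \<and>
     (\<forall>c\<in>charts M. \<forall>d\<in>charts N.
        smooth_on (chart_model c) (chart_map c ` (chart_dom c \<inter> f -` chart_dom d)) (chart_model d)
          (local_rep c d f))"

text \<open>
  A tangent vector at \<open>m\<close> is the family of its coordinate vectors in all charts around \<open>m\<close>
  (extended by \<open>0\<close>), related by the derivatives of the chart transitions. The tangent space is
  a linear subspace of \<open>('m, 'e) chart \<Rightarrow> 'e\<close>, with the topology of pointwise convergence;
  evaluation at any one chart around \<open>m\<close> is a linear homeomorphism onto the model space.
\<close>

definition tangent_space ::
    "('m, 'e::locally_convex) manifold \<Rightarrow> 'm \<Rightarrow> (('m, 'e) chart \<Rightarrow> 'e) set" where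
  "tangent_space M m =
     {v. (\<forall>c\<in>charts_around M m. v c \<in> chart_model c) \<and>
         (\<forall>c. c \<notin> charts_around M m \<longrightarrow> v c = 0) \<and>
         (\<forall>c\<in>charts_around M m. \<forall>d\<in>charts_around M m.
            v d = directional_derivative (chart_map d \<circ> chart_inv c) (chart_map c m) (v c))}"

text \<open>For smooth \<open>f\<close>, the value does not depend on the choice of \<open>c\<close> by the chain rule.\<close>

definition tangent_map ::
    "('m, 'e::locally_convex) manifold \<Rightarrow> ('n, 'f::locally_convex) manifold \<Rightarrow> ('m \<Rightarrow> 'n) \<Rightarrow> 'm \<Rightarrow>
     (('m, 'e) chart \<Rightarrow> 'e) \<Rightarrow> (('n, 'f) chart \<Rightarrow> 'f)" where
  "tangent_map M N f m v =
     (let c = (SOME c. c \<in> charts_around M m) in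
      (\<lambda>d. if d \<in> charts_around N (f m)
           then directional_derivative (local_rep c d f) (chart_map c m) (v c) else 0))"


section \<open>Normal forms\<close>

text \<open>Here \<open>K\<close>, \<open>C\<close>, \<open>Q\<close>, \<open>I\<close> are the abstract kernel, coimage, cokernel and image.\<close>

definition abstract_normal_form ::
    "'a::locally_convex set \<Rightarrow> 'a set \<Rightarrow> 'a set \<Rightarrow> 'b::locally_convex set \<Rightarrow> 'b set \<Rightarrow> 'b set \<Rightarrow>
     ('a \<Rightarrow> 'b) \<Rightarrow> 'a set \<Rightarrow> ('a \<Rightarrow> 'b) \<Rightarrow> bool" where
  "abstract_normal_form X K C Y Q I fhat U fsing \<longleftrightarrow>
     topological_direct_sum X K C \<and> topological_direct_sum Y Q I \<and>
     linear_on C fhat \<and> homeomorphic_map (top_of_set C) (top_of_set I) fhat \<and>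
     openin (top_of_set X) U \<and> 0 \<in> U \<and> smooth_on X U Q fsing \<and>
     (\<forall>x\<in>U \<inter> C. fsing x = 0) \<and>
     (\<forall>v\<in>X. directional_derivative fsing 0 v = 0)"

definition second_component :: "'a::ab_group_add set \<Rightarrow> 'a set \<Rightarrow> 'a \<Rightarrow> 'a" where
  "second_component A B x = (THE b. b \<in> B \<and> (\<exists>a\<in>A. x = a + b))"

definition normal_form_map ::
    "'a::locally_convex set \<Rightarrow> 'a set \<Rightarrow> ('a \<Rightarrow> 'b::locally_convex) \<Rightarrow> ('a \<Rightarrow> 'b) \<Rightarrow> 'a \<Rightarrow> 'b" where
  "normal_form_map K C fhat fsing x = fhat (second_component K C x) + fsing x"

definition chart_at ::
    "('m, 'e::locally_convex) manifold \<Rightarrow> 'm \<Rightarrow> ('m, 'e) chart \<Rightarrow> bool" where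
  "chart_at M m c \<longleftrightarrow> c \<in> charts_around M m \<and> chart_map c m = 0"

definition has_normal_form_at ::
    "('m, 'e::locally_convex) manifold \<Rightarrow> ('n, 'f::locally_convex) manifold \<Rightarrow> ('m \<Rightarrow> 'n) \<Rightarrow> 'm \<Rightarrow> bool"
  where
  "has_normal_form_at M N f m \<longleftrightarrow>
     (\<exists>X K C Y Q I fhat U fsing \<kappa> \<rho>.
        abstract_normal_form X K C Y Q I fhat U fsing \<and>
        chart_at M m \<kappa> \<and> chart_model \<kappa> = X \<and> chart_img \<kappa> = U \<and>
        chart_at N (f m) \<rho> \<and> chart_model \<rho> = Y \<and>
        f ` chart_dom \<kappa> \<subseteq> chart_dom \<rho> \<and>
        (\<forall>p\<in>chart_dom \<kappa>. chart_map \<rho> (f p) = normal_form_map K C fhat fsing (chart_map \<kappa> p)))"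

end

theory Submission
  imports Defs
begin

text \<open>
  In charts centred at \<open>m\<close> and \<open>f m\<close>, let \<open>F\<close> be the local representative, with regular derivative
  \<open>T\<close> at \<open>0\<close>, and split \<open>X = K \<oplus> C\<close> with \<open>K = ker T\<close> and \<open>Y = Q \<oplus> I\<close> with \<open>I = T X\<close>. The map
  \<open>\<Phi> x = p\<^sub>K x + T\<^sup>-\<^sup>1 (p\<^sub>I (F x))\<close> has derivative \<open>id\<close> at \<open>0\<close>, so it is a chart by the inverse
  function theorem, and \<open>F \<circ> \<Phi>\<^sup>-\<^sup>1\<close> has the form \<open>z \<mapsto> T (p\<^sub>C z) + g z\<close> with \<open>g\<close> valued in \<open>Q\<close>. The
  shear \<open>y \<mapsto> y - g (T\<^sup>-\<^sup>1 (p\<^sub>I y))\<close> of \<open>Y\<close> replaces \<open>g\<close> by \<open>f\<^sub>s\<^sub>i\<^sub>n\<^sub>g z = g z - g (p\<^sub>C z)\<close>.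

  Only \<open>X\<close> is normed, so smoothness is handled throughout in the Michal--Bastiani sense: a map is
  smooth as soon as it belongs to a set of jointly continuous functions of a point \<open>x\<close> and a
  sequence of directions \<open>v\<close> that is closed under differentiation along each \<open>v k\<close>. The chain rule
  and the inverse function theorem exhibit such sets. If \<open>M\<close> is finite-dimensional, continuous
  linear functionals (Hahn--Banach) provide the complements.
\<close>

section \<open>Derivatives of curves and the mean value theorem\<close>

text \<open>A Michal-Bastiani derivative is jointly continuous in point and direction, but nothing
  controls it uniformly over directions, and the target need have neither a norm nor completeness.
  Three devices make up for this. Mean value estimates are membership statements in convex open
  sets; they control difference quotients whose base point and direction both move, whence linearity
  of derivatives and the chain rule. In the inverse function theorem, the bound on the difference of
  derivative and identity that is uniform in the direction is extracted from the second derivative,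
  where bilinearity turns continuity at the origin into a norm bound. The inverse of the derivative
  is a function of point and vector, not an operator-valued map, and is differentiated through its
  defining equation. Since \<open>Y\<close> is arbitrary, the inverse function theorem is applied in
  \<open>X\<close> only; the shear of \<open>Y\<close> has an inverse that can be written
  down.\<close>

definition curve_derivative :: "(real \<Rightarrow> 'b::locally_convex) \<Rightarrow> 'b \<Rightarrow> bool" where
  "curve_derivative c l \<longleftrightarrow> ((\<lambda>t. (c t - c 0) /\<^sub>R t) \<longlongrightarrow> l) (at 0)"

text \<open>Puts directional derivatives into the calculus of curves, which also covers non-affine
  curves such as images of lines under smooth maps.\<close>

lemma has_directional_derivative_iff_curve:
  "has_directional_derivative f l x v \<longleftrightarrow> curve_derivative (\<lambda>t. f (x + t *\<^sub>R v)) l"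
  by (simp add: has_directional_derivative_def curve_derivative_def)

lemma curve_derivative_unique:
  assumes "curve_derivative c l" "curve_derivative c l'" shows "l = l'"
  using assms unfolding curve_derivative_def by (meson tendsto_unique trivial_limit_at)

lemma directional_derivative_eq:
  assumes "has_directional_derivative f l x v"
  shows "directional_derivative f x v = l"
  using assms unfolding has_directional_derivative_def directional_derivative_def
  by (simp add: tendsto_Lim)

lemma curve_derivative_add:
  assumes "curve_derivative c l" "curve_derivative d k"
  shows "curve_derivative (\<lambda>t. c t + d t) (l + k)"
proof -
  have "((\<lambda>t. (c t - c 0) /\<^sub>R t + (d t - d 0) /\<^sub>R t) \<longlongrightarrow> l + k) (at 0)"
    using assms unfolding curve_derivative_def by (intro tendsto_add)
  then show ?thesis
    unfolding curve_derivative_def by (simp add: scaleR_diff_right scaleR_add_right algebra_simps)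
qed

lemma curve_derivative_const: "curve_derivative (\<lambda>t. a) 0"
  by (simp add: curve_derivative_def)

lemma curve_derivative_line: "curve_derivative (\<lambda>t. a + t *\<^sub>R b) b"
proof -
  have "\<forall>\<^sub>F t in at 0. b = (a + t *\<^sub>R b - (a + 0 *\<^sub>R b)) /\<^sub>R t"
    by (auto simp: eventually_at_filter)
  then show ?thesis unfolding curve_derivative_def by (rule tendsto_eventually[OF eventually_mono]) auto
qed

lemma curve_derivative_cong:
  assumes "\<forall>\<^sub>F t in at 0. c t = d t" "c 0 = d 0" "curve_derivative c l"
  shows "curve_derivative d l"
  using assms(3) unfolding curve_derivative_def
  by (rule Lim_transform_eventually) (use assms in \<open>auto elim: eventually_mono\<close>)

lemma curve_derivative_tendsto:
  assumes "curve_derivative c l" shows "(c \<longlongrightarrow> c 0) (at 0)"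
proof -
  have "((\<lambda>t. c 0 + t *\<^sub>R ((c t - c 0) /\<^sub>R t)) \<longlongrightarrow> c 0 + 0 *\<^sub>R l) (at 0)"
    using assms unfolding curve_derivative_def
    by (intro tendsto_add tendsto_const tendsto_scaleR_locally_convex) auto
  then have "((\<lambda>t. c 0 + t *\<^sub>R ((c t - c 0) /\<^sub>R t)) \<longlongrightarrow> c 0) (at 0)" by simp
  then show ?thesis
    by (rule Lim_transform_eventually) (auto simp: eventually_at_filter)
qed

text \<open>Domains are open only relative to a subspace \<open>X\<close>, so that nearby points lie
  in \<open>X\<close> has to be supplied separately.\<close>

lemma tendsto_eventually_in_openin:
  assumes "openin (top_of_set X) U" "(f \<longlongrightarrow> x) F" "x \<in> U" "\<forall>\<^sub>F t in F. f t \<in> X"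
  shows "\<forall>\<^sub>F t in F. f t \<in> U"
proof -
  obtain O' where O': "open O'" "U = X \<inter> O'" using assms(1) by (auto simp: openin_open)
  then have "\<forall>\<^sub>F t in F. f t \<in> O'" using assms by (auto intro: topological_tendstoD)
  with assms(4) show ?thesis by eventually_elim (use O' in auto)
qed

lemma line_tendsto: "((\<lambda>t. x + t *\<^sub>R v) \<longlongrightarrow> x) (at 0)" for x v :: "'a::locally_convex"
  using curve_derivative_tendsto[OF curve_derivative_line[of x v]] by simp

lemma line_eventually_in:
  fixes x v :: "'a::locally_convex"
  assumes "subspace X" "openin (top_of_set X) U" "x \<in> U" "v \<in> X"
  shows "\<forall>\<^sub>F t in at 0. x + t *\<^sub>R v \<in> U"
proof (rule tendsto_eventually_in_openin[OF assms(2) line_tendsto assms(3)])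
  have "x \<in> X" using assms by (auto dest: openin_imp_subset)
  then show "\<forall>\<^sub>F t in at 0. x + t *\<^sub>R v \<in> X"
    using assms by (auto intro!: always_eventually subspace_add subspace_scale)
qed

text \<open>Slopes in \<open>W\<close> over adjacent intervals average to a slope in
  \<open>W\<close> by convexity, and slopes between a point and its neighbours are close to the
  derivative, hence in \<open>W\<close> by openness. Bisection then passes from short intervals to
  the whole one.\<close>

lemma mean_value_convex:
  fixes \<gamma> :: "real \<Rightarrow> 'b::locally_convex"
  assumes X: "subspace X" and W: "openin (top_of_set X) W" "convex W"
    and der: "\<And>s. 0 \<le> s \<Longrightarrow> s \<le> 1 \<Longrightarrow> curve_derivative (\<lambda>t. \<gamma> (s + t)) (\<gamma>' s)"
    and inW: "\<And>s. 0 \<le> s \<Longrightarrow> s \<le> 1 \<Longrightarrow> \<gamma>' s \<in> W"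
    and inX: "\<And>s. 0 \<le> s \<Longrightarrow> s \<le> 1 \<Longrightarrow> \<gamma> s \<in> X"
  shows "\<gamma> 1 - \<gamma> 0 \<in> W"
proof -
  \<comment> \<open>\<open>Bolzano\<close> quantifies over all short intervals around a point,
    including those that leave [0,1], where nothing is known about \<open>\<gamma>\<close>; the
    range conditions inside \<open>P\<close> dispose of them.\<close>
  define P where "P a b \<longleftrightarrow> (0 \<le> a \<longrightarrow> a \<le> b \<longrightarrow> b \<le> 1 \<longrightarrow> (\<exists>k\<in>W. \<gamma> b - \<gamma> a = (b - a) *\<^sub>R k))" for a b
  have "(0::real) \<le> 1" by simp
  then have "P 0 1"
  proof (induction rule: Bolzano)
    case (trans a b c)
    show ?case unfolding P_def
    proof (intro impI)
      assume h: "0 \<le> a" "a \<le> c" "c \<le> 1"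
      from trans h obtain k l where k: "k \<in> W" "\<gamma> b - \<gamma> a = (b - a) *\<^sub>R k"
        and l: "l \<in> W" "\<gamma> c - \<gamma> b = (c - b) *\<^sub>R l" unfolding P_def by force
      show "\<exists>k\<in>W. \<gamma> c - \<gamma> a = (c - a) *\<^sub>R k"
      proof (cases "a = c")
        case True
        with k(1) show ?thesis by auto
      next
        case False
        with trans have ac: "c - a > 0" by auto
        \<comment> \<open>The slope over the union is the mean of the two slopes, weighted by the
          lengths of the intervals.\<close>
        define m where "m = ((b - a) / (c - a)) *\<^sub>R k + ((c - b) / (c - a)) *\<^sub>R l"
        have "m \<in> W" unfolding m_def
          using ac trans by (intro convexD[OF W(2)] k l) (auto simp: add_divide_distrib[symmetric])
        moreover have "\<gamma> c - \<gamma> a = (\<gamma> b - \<gamma> a) + (\<gamma> c - \<gamma> b)" by simp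
        then have "\<gamma> c - \<gamma> a = (c - a) *\<^sub>R m"
          using ac k l by (simp add: m_def scaleR_add_right)
        ultimately show ?thesis by blast
      qed
    qed
  next
    case (local x)
    let ?q = "\<lambda>t. (\<gamma> (x + t) - \<gamma> x) /\<^sub>R t"
    obtain O' where O': "open O'" "W = X \<inter> O'" using W(1) by (auto simp: openin_open)
    have "(?q \<longlongrightarrow> \<gamma>' x) (at 0)"
      using der[OF local] by (simp add: curve_derivative_def)
    then have "\<forall>\<^sub>F t in at 0. ?q t \<in> O'"
      using O' inW[OF local] by (auto intro: topological_tendstoD)
    then obtain d where d: "d > 0" "\<And>t. t \<noteq> 0 \<Longrightarrow> \<bar>t\<bar> < d \<Longrightarrow> ?q t \<in> O'"
      by (auto simp: eventually_at dist_real_def)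
    have q: "?q t \<in> W" if "t \<noteq> 0" "\<bar>t\<bar> < d" "0 \<le> x + t" "x + t \<le> 1" for t
      using d(2)[OF that(1,2)] that inX local X O'
      by (auto intro!: subspace_scale subspace_diff)
    have inc: "\<exists>k\<in>W. \<gamma> (x + t) - \<gamma> x = t *\<^sub>R k" if "\<bar>t\<bar> < d" "0 \<le> x + t" "x + t \<le> 1" for t
    proof (cases "t = 0")
      case True
      then show ?thesis using inW[OF local] by auto
    next
      case False
      then show ?thesis using q[OF False that] by (intro bexI[of _ "?q t"]) auto
    qed
    show ?case
    proof (intro exI[of _ d] conjI allI impI d)
      fix a b assume h: "a \<le> x \<and> x \<le> b \<and> b - a < d"
      show "P a b" unfolding P_def
      proof (intro impI)
        assume g: "0 \<le> a" "a \<le> b" "b \<le> 1"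
        obtain k where k: "k \<in> W" "\<gamma> a - \<gamma> x = (a - x) *\<^sub>R k"
          using inc[of "a - x"] h g local by auto
        obtain l where l: "l \<in> W" "\<gamma> b - \<gamma> x = (b - x) *\<^sub>R l"
          using inc[of "b - x"] h g local by auto
        show "\<exists>k\<in>W. \<gamma> b - \<gamma> a = (b - a) *\<^sub>R k"
        proof (cases "a = b")
          case True
          with k(1) show ?thesis by auto
        next
          case False
          with g have ab: "b - a > 0" by auto
          define m where "m = ((x - a) / (b - a)) *\<^sub>R k + ((b - x) / (b - a)) *\<^sub>R l"
          have "m \<in> W" unfolding m_def
            using ab h by (intro convexD[OF W(2)] k l) (auto simp: add_divide_distrib[symmetric])
          moreover have "\<gamma> b - \<gamma> a = (b - a) *\<^sub>R m"
          proof -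
            have "\<gamma> b - \<gamma> a = (\<gamma> b - \<gamma> x) - (\<gamma> a - \<gamma> x)" by simp
            moreover have "(b - a) *\<^sub>R m = (x - a) *\<^sub>R k + (b - x) *\<^sub>R l"
              using ab by (simp add: m_def scaleR_add_right)
            ultimately show ?thesis
              using k l by (simp add: scaleR_diff_left)
          qed
          ultimately show ?thesis by blast
        qed
      qed
    qed
  qed
  then show ?thesis by (auto simp: P_def)
qed

lemma convex_nbhd:
  fixes x :: "'a::locally_convex"
  assumes "open A" "x \<in> A"
  shows "\<exists>D. open D \<and> convex D \<and> x \<in> D \<and> D \<subseteq> A"
proof -
  have cont: "continuous_on UNIV (\<lambda>z::'a. z - x)" "continuous_on UNIV (\<lambda>z::'a. z + x)"
    unfolding continuous_on_def
    by (auto intro!: tendsto_intros)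
  have "open ((\<lambda>z. z + x) -` A)" "0 \<in> (\<lambda>z. z + x) -` A"
    using assms cont by (auto intro!: open_vimage)
  then obtain C where C: "open C" "convex C" "0 \<in> C" "C \<subseteq> (\<lambda>z. z + x) -` A"
    using locally_convexD by blast
  have eq: "(\<lambda>z. z - x) -` C = (\<lambda>z. x + z) ` C" 
    by (auto simp: image_iff intro!: bexI[of _ "_ - x"])
  have "open ((\<lambda>z. z - x) -` C)" using C cont by (auto intro!: open_vimage)
  moreover have "convex ((\<lambda>z. z - x) -` C)" unfolding eq using C(2) by (rule convex_translation)
  ultimately show ?thesis using C by (intro exI[of _ "(\<lambda>z. z - x) -` C"]) force
qed

text \<open>The difference quotient is the increment of a curve whose velocities are values of
  \<open>f'\<close> at points near \<open>x0\<close> and directions near \<open>w0\<close>. Joint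
  continuity puts these into a given convex neighbourhood of the limit, and the mean value theorem
  puts the quotient there too.\<close>

lemma strict_directional_derivative:
  fixes f :: "'a::locally_convex \<Rightarrow> 'b::locally_convex"
  assumes X: "subspace X" and U: "openin (top_of_set X) U"
    and der: "\<And>x v. x \<in> U \<Longrightarrow> v \<in> X \<Longrightarrow> has_directional_derivative f (f' x v) x v"
    and cont: "continuous_on (U \<times> X) (\<lambda>(x, v). f' x v)"
    and x: "(x \<longlongrightarrow> x0) (at 0)" "\<forall>\<^sub>F t in at (0::real). x t \<in> X" "x0 \<in> U"
    and w: "(w \<longlongrightarrow> w0) (at 0)" "\<forall>\<^sub>F t in at (0::real). w t \<in> X" "w0 \<in> X"
  shows "((\<lambda>t. (f (x t + t *\<^sub>R w t) - f (x t)) /\<^sub>R t) \<longlongrightarrow> f' x0 w0) (at 0)"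
proof (rule topological_tendstoI)
  fix S assume "open S" "f' x0 w0 \<in> S"
  then obtain W where W: "open W" "convex W" "f' x0 w0 \<in> W" "W \<subseteq> S" using convex_nbhd by blast
  have "openin (top_of_set (U \<times> X)) ((U \<times> X) \<inter> (\<lambda>(x, v). f' x v) -` W)"
    using cont W(1) by (rule continuous_openin_preimage_gen)
  then obtain P where P: "open P" "(U \<times> X) \<inter> (\<lambda>(x, v). f' x v) -` W = (U \<times> X) \<inter> P"
    by (auto simp: openin_open)
  have "(x0, w0) \<in> (U \<times> X) \<inter> (\<lambda>(x, v). f' x v) -` W" using x w W by auto
  then have "(x0, w0) \<in> P" using P(2) by auto
  then obtain A B where AB: "open A" "open B" "x0 \<in> A" "w0 \<in> B" "A \<times> B \<subseteq> P"
    using P(1) by (metis mem_Sigma_iff open_prod_elim)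
  obtain U0 where U0: "open U0" "U = X \<inter> U0" using U by (auto simp: openin_open)
  obtain D where D: "open D" "convex D" "x0 \<in> D" "D \<subseteq> A \<inter> U0"
    using convex_nbhd[of "A \<inter> U0" x0] AB U0 x by auto
  have "((\<lambda>t. x t + t *\<^sub>R w t) \<longlongrightarrow> x0 + 0 *\<^sub>R w0) (at 0)"
    by (intro tendsto_add tendsto_scaleR_locally_convex x w tendsto_ident_at)
  then have "\<forall>\<^sub>F t in at 0. x t + t *\<^sub>R w t \<in> D" using D by (auto intro: topological_tendstoD)
  moreover have "\<forall>\<^sub>F t in at 0. x t \<in> D" using D x by (auto intro: topological_tendstoD)
  moreover have "\<forall>\<^sub>F t in at 0. w t \<in> B" using AB w by (auto intro: topological_tendstoD)
  moreover have "\<forall>\<^sub>F t in at (0::real). t \<noteq> 0" by (simp add: eventually_at_filter)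
  ultimately show "\<forall>\<^sub>F t in at 0. (f (x t + t *\<^sub>R w t) - f (x t)) /\<^sub>R t \<in> S"
    using x(2) w(2)
  proof eventually_elim
    fix t :: real
    assume h: "x t + t *\<^sub>R w t \<in> D" "x t \<in> D" "w t \<in> B" "t \<noteq> 0" "x t \<in> X" "w t \<in> X"
    \<comment> \<open>Dividing by \<open>t\<close> makes the velocity of \<open>\<gamma>\<close> a
      value of \<open>f'\<close> in direction \<open>w t\<close> and its increment over [0,1] the
      difference quotient.\<close>
    define \<gamma> where "\<gamma> s = f (x t + (s * t) *\<^sub>R w t) /\<^sub>R t" for s
    have seg: "x t + (s * t) *\<^sub>R w t \<in> D" "x t + (s * t) *\<^sub>R w t \<in> X" if "0 \<le> s" "s \<le> 1" for s
    proof -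
      have "(1 - s) *\<^sub>R x t + s *\<^sub>R (x t + t *\<^sub>R w t) \<in> D"
        using that by (intro convexD[OF D(2)] h) auto
      then show "x t + (s * t) *\<^sub>R w t \<in> D" by (simp add: algebra_simps)
      show "x t + (s * t) *\<^sub>R w t \<in> X" using X h by (auto intro: subspace_add subspace_scale)
    qed
    have "\<gamma> 1 - \<gamma> 0 \<in> W"
    proof (rule mean_value_convex[of UNIV W \<gamma> "\<lambda>s. f' (x t + (s * t) *\<^sub>R w t) (w t)"])
      fix s :: real assume s: "0 \<le> s" "s \<le> 1"
      let ?z = "x t + (s * t) *\<^sub>R w t"
      have zU: "?z \<in> U" using seg[OF s] D U0 by auto
      have "(\<lambda>h. (f (?z + h *\<^sub>R w t) - f ?z) /\<^sub>R h) \<midarrow>0\<rightarrow> f' ?z (w t)"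
        using der[OF zU h(6)] by (simp add: has_directional_derivative_def)
      moreover have "filterlim (\<lambda>h. h * t) (at 0) (at 0)"
        using h(4) by (auto simp: filterlim_at eventually_at_filter intro!: tendsto_eq_intros)
      ultimately have "((\<lambda>h. (f (?z + (h * t) *\<^sub>R w t) - f ?z) /\<^sub>R (h * t)) \<longlongrightarrow> f' ?z (w t)) (at 0)"
        by (rule filterlim_compose)
      then show "curve_derivative (\<lambda>h. \<gamma> (s + h)) (f' ?z (w t))"
        unfolding curve_derivative_def \<gamma>_def
        by (simp add: algebra_simps)
      have "(?z, w t) \<in> (U \<times> X) \<inter> P" using AB(5) D(4) seg[OF s] zU h by auto
      then show "f' ?z (w t) \<in> W" using P(2) by auto
    qed (use W in auto)
    then show "(f (x t + t *\<^sub>R w t) - f (x t)) /\<^sub>R t \<in> S"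
      using W by (auto simp: \<gamma>_def algebra_simps)
  qed
qed

section \<open>Smooth families\<close>

text \<open>Total direction sequences in \<open>X\<close>, in place of the finite ones in
  \<open>smooth_on\<close>, give all orders \<open>k\<close> the same domain, which updates and
  reindexings of directions do not leave.\<close>

definition smooth_family ::
    "'a::locally_convex set \<Rightarrow> 'a set \<Rightarrow> 'b::locally_convex set \<Rightarrow>
     (nat \<Rightarrow> 'a \<Rightarrow> (nat \<Rightarrow> 'a) \<Rightarrow> 'b) \<Rightarrow> bool" where
  "smooth_family X U Y h \<longleftrightarrow>
     (\<forall>k. \<forall>x\<in>U. \<forall>v\<in>UNIV \<rightarrow> X. h k x v \<in> Y) \<and>
     (\<forall>k. \<forall>x\<in>U. \<forall>v\<in>UNIV \<rightarrow> X. has_directional_derivative (\<lambda>y. h k y v) (h (Suc k) x v) x (v k)) \<and>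
     (\<forall>k. continuous_on (U \<times> (UNIV \<rightarrow> X)) (\<lambda>(x, v). h k x v))"

lemma smooth_familyD:
  assumes "smooth_family X U Y h"
  shows smooth_family_in: "x \<in> U \<Longrightarrow> v \<in> UNIV \<rightarrow> X \<Longrightarrow> h k x v \<in> Y"
    and smooth_family_derivative: "x \<in> U \<Longrightarrow> v \<in> UNIV \<rightarrow> X \<Longrightarrow>
      has_directional_derivative (\<lambda>y. h k y v) (h (Suc k) x v) x (v k)"
    and smooth_family_continuous: "continuous_on (U \<times> (UNIV \<rightarrow> X)) (\<lambda>(x, v). h k x v)"
  using assms unfolding smooth_family_def by blast+

lemma continuous_on_snd_apply: "continuous_on S (\<lambda>p. snd p i)"
  using continuous_on_product_then_coordinatewise[OF continuous_on_snd[OF continuous_on_id[of S]], of i]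
  by simp

lemma iterated_derivative_dirs_cong:
  assumes "\<And>i. i < k \<Longrightarrow> v i = w i"
  shows "iterated_derivative k f x v = iterated_derivative k f x w"
  using assms
proof (induction k arbitrary: x)
  case (Suc k)
  have "(\<lambda>y. iterated_derivative k f y v) = (\<lambda>y. iterated_derivative k f y w)"
    using Suc by (intro ext) simp
  then show ?case using Suc.prems[of k] by simp
qed simp

lemma has_directional_derivative_cong:
  assumes X: "subspace X" "openin (top_of_set X) U" and x: "x \<in> U" "v \<in> X"
    and eq: "\<And>y. y \<in> U \<Longrightarrow> f y = g y"
    and der: "has_directional_derivative f l x v"
  shows "has_directional_derivative g l x v"
  using der unfolding has_directional_derivative_iff_curve
proof (rule curve_derivative_cong[rotated 2])
  show "\<forall>\<^sub>F t in at 0. f (x + t *\<^sub>R v) = g (x + t *\<^sub>R v)"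
    using line_eventually_in[OF X x] by eventually_elim (rule eq)
qed (use x eq in simp)

lemma smooth_on_iterated_derivative:
  assumes X: "subspace X" and f: "smooth_on X U Y f"
  shows "smooth_family X U Y (\<lambda>k. iterated_derivative k f)"
proof -
  let ?D = "\<lambda>k. iterated_derivative k f"
  have restr: "?D k x v = ?D k x (restrict v {..<k})" for k x v
    by (rule iterated_derivative_dirs_cong) auto
  have f0: "\<exists>l\<in>Y. has_directional_derivative (\<lambda>y. ?D k y v) l x (v k)"
    if "x \<in> U" "v \<in> {..<Suc k} \<rightarrow>\<^sub>E X" for k x v
    using f that by (simp add: smooth_on_def)
  have der: "\<exists>l\<in>Y. has_directional_derivative (\<lambda>y. ?D k y v) l x (v k)"
    if "x \<in> U" "v \<in> UNIV \<rightarrow> X" for k x v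
  proof -
    have "restrict v {..<Suc k} \<in> {..<Suc k} \<rightarrow>\<^sub>E X" using that by auto
    from f0[OF that(1) this] obtain l where "l \<in> Y"
      "has_directional_derivative (\<lambda>y. ?D k y (restrict v {..<Suc k})) l x (restrict v {..<Suc k} k)"
      by (rule bexE)
    moreover have "?D k y (restrict v {..<Suc k}) = ?D k y v" for y
      by (rule iterated_derivative_dirs_cong) auto
    ultimately show ?thesis by auto
  qed
  have der': "has_directional_derivative (\<lambda>y. ?D k y v) (?D (Suc k) x v) x (v k)"
      "?D (Suc k) x v \<in> Y"
    if "x \<in> U" "v \<in> UNIV \<rightarrow> X" for k x v
    using der[OF that, of k] by (auto simp: directional_derivative_eq)
  have "?D k x v \<in> Y" if "x \<in> U" "v \<in> UNIV \<rightarrow> X" for k x v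
  proof (cases k)
    case 0
    then show ?thesis using f that by (auto simp: smooth_on_def)
  qed (use der' that in auto)
  moreover have "continuous_on (U \<times> (UNIV \<rightarrow> X)) (\<lambda>(x, v). ?D k x v)" for k
  proof -
    have "continuous_on (U \<times> ({..<k} \<rightarrow>\<^sub>E X)) (\<lambda>(x, v). ?D k x v)"
      using f by (auto simp: smooth_on_def)
    \<comment> \<open>Restriction is continuous for the product topology: each coordinate is an
      evaluation or the constant \<open>undefined\<close>.\<close>
    moreover have "continuous_on (U \<times> (UNIV \<rightarrow> X)) (\<lambda>(x, v). (x, restrict v {..<k}))"
      unfolding case_prod_unfold restrict_def
    proof (intro continuous_on_Pair continuous_on_coordinatewise_then_product)
      fix i :: nat
      have "continuous_on (U \<times> (UNIV \<rightarrow> X)) (\<lambda>p. snd p i)"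
        by (rule continuous_on_snd_apply)
      then show "continuous_on (U \<times> (UNIV \<rightarrow> X)) (\<lambda>p. if i \<in> {..<k} then snd p i else undefined)"
        by (cases "i < k") auto
    qed (intro continuous_on_fst continuous_on_id)
    moreover have "(\<lambda>(x, v). (x, restrict v {..<k})) ` (U \<times> (UNIV \<rightarrow> X)) \<subseteq> U \<times> ({..<k} \<rightarrow>\<^sub>E X)"
      by (auto split: if_splits)
    ultimately have "continuous_on (U \<times> (UNIV \<rightarrow> X))
        (\<lambda>p. (\<lambda>(x, v). ?D k x v) ((\<lambda>(x, v). (x, restrict v {..<k})) p))"
      by (rule continuous_on_compose2)
    then show ?thesis
      by (rule continuous_on_eq) (auto simp: restr[symmetric])
  qed
  ultimately show ?thesis using der'(1) by (simp add: smooth_family_def)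
qed

lemma smooth_family_iterated_derivative:
  assumes X: "subspace X" and U: "openin (top_of_set X) U"
    and h: "smooth_family X U Y h" and f: "\<And>x v. x \<in> U \<Longrightarrow> v \<in> UNIV \<rightarrow> X \<Longrightarrow> h 0 x v = f x"
    and x: "x \<in> U" "v \<in> UNIV \<rightarrow> X"
  shows "iterated_derivative k f x v = h k x v"
  using x
proof (induction k arbitrary: x)
  case 0
  then show ?case using f by simp
next
  case (Suc k)
  have "has_directional_derivative (\<lambda>y. h k y v) (h (Suc k) x v) x (v k)"
    using h Suc.prems by (rule smooth_family_derivative)
  then have "has_directional_derivative (\<lambda>y. iterated_derivative k f y v) (h (Suc k) x v) x (v k)"
    by (rule has_directional_derivative_cong[OF X U, rotated 3]) (use Suc x in auto)
  then show ?case by (simp add: directional_derivative_eq)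
qed

lemma smooth_onI_family:
  assumes X: "subspace X" and U: "openin (top_of_set X) U"
    and h: "smooth_family X U Y h" and f: "\<And>x v. x \<in> U \<Longrightarrow> v \<in> UNIV \<rightarrow> X \<Longrightarrow> h 0 x v = f x"
  shows "smooth_on X U Y f"
proof -
  have D: "iterated_derivative k f x v = h k x v" if "x \<in> U" "v \<in> UNIV \<rightarrow> X" for k x v
    proof (rule smooth_family_iterated_derivative[where X = X and U = U and Y = Y])
    show "h 0 y w = f y" if "y \<in> U" "w \<in> UNIV \<rightarrow> X" for y w using that by (rule f)
  qed (use X U h that in auto)
  \<comment> \<open>Finite sequences take the value \<open>undefined\<close> from \<open>k\<close>
    on, which may lie outside \<open>X\<close>; padding with 0 keeps them in
    \<open>X\<close>.\<close>
  define E where "E k v = (\<lambda>i::nat. if i < k then v i else 0)" for k :: nat and v :: "nat \<Rightarrow> 'a"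
  have E: "E k v \<in> UNIV \<rightarrow> X" if "v \<in> {..<k} \<rightarrow>\<^sub>E X" for k v
  proof (rule Pi_I)
    show "E k v i \<in> X" for i
      using PiE_mem[OF that, of i] subspace_0[OF X] by (cases "i < k") (simp_all add: E_def)
  qed
  have DE: "iterated_derivative k f x v = h k x (E k v)" if "x \<in> U" "v \<in> {..<k} \<rightarrow>\<^sub>E X" for k x v
  proof -
    have "iterated_derivative k f x v = iterated_derivative k f x (E k v)"
      by (rule iterated_derivative_dirs_cong) (auto simp: E_def)
    then show ?thesis using D[OF that(1) E[OF that(2)]] by simp
  qed
  have "f ` U \<subseteq> Y"
  proof (intro image_subsetI)
    fix x assume "x \<in> U"
    moreover have "(\<lambda>_. 0) \<in> UNIV \<rightarrow> X" using subspace_0[OF X] by (simp add: Pi_I)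
    ultimately have "h 0 x (\<lambda>_. 0) \<in> Y" "h 0 x (\<lambda>_. 0) = f x"
      by (rule smooth_family_in[OF h], rule f)
    then show "f x \<in> Y" by simp
  qed
  moreover have "\<exists>l\<in>Y. has_directional_derivative (\<lambda>y. iterated_derivative k f y v) l x (v k)"
    if x: "x \<in> U" "v \<in> {..<Suc k} \<rightarrow>\<^sub>E X" for k x v
  proof -
    let ?w = "E (Suc k) v"
    have w: "?w \<in> UNIV \<rightarrow> X" using x(2) by (rule E)
    have "has_directional_derivative (\<lambda>y. h k y ?w) (h (Suc k) x ?w) x (?w k)" "h (Suc k) x ?w \<in> Y"
      by (rule smooth_family_derivative[OF h x(1) w], rule smooth_family_in[OF h x(1) w])
    moreover have "h k y ?w = iterated_derivative k f y v" if "y \<in> U" for y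
    proof -
      have "iterated_derivative k f y v = iterated_derivative k f y ?w"
        by (rule iterated_derivative_dirs_cong) (auto simp: E_def)
      then show ?thesis using D[OF that w] by simp
    qed
    moreover have "v k \<in> X" using PiE_mem[OF x(2), of k] by simp
    ultimately have "has_directional_derivative (\<lambda>y. iterated_derivative k f y v) (h (Suc k) x ?w) x (v k)"
      by - (rule has_directional_derivative_cong[OF X U x(1), of "v k" "\<lambda>y. h k y ?w"], auto simp: E_def)
    then show ?thesis using \<open>h (Suc k) x ?w \<in> Y\<close> by blast
  qed
  moreover have "continuous_on (U \<times> ({..<k} \<rightarrow>\<^sub>E X)) (\<lambda>(x, v). iterated_derivative k f x v)" for k
  proof -
    have "continuous_on (U \<times> (UNIV \<rightarrow> X)) (\<lambda>(x, v). h k x v)"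
      using h by (rule smooth_family_continuous)
    moreover have "continuous_on (U \<times> ({..<k} \<rightarrow>\<^sub>E X)) (\<lambda>(x, v). (x, E k v))"
    proof -
      have "continuous_on (U \<times> ({..<k} \<rightarrow>\<^sub>E X)) (\<lambda>p. E k (snd p) i)" for i
      proof (cases "i < k")
        case True
        have "continuous_on (U \<times> ({..<k} \<rightarrow>\<^sub>E X)) (\<lambda>p. snd p i)"
          by (rule continuous_on_snd_apply)
        with True show ?thesis by (simp add: E_def)
      qed (simp add: E_def)
      then have "continuous_on (U \<times> ({..<k} \<rightarrow>\<^sub>E X)) (\<lambda>p. E k (snd p))"
        by (rule continuous_on_coordinatewise_then_product)
      then show ?thesis
        unfolding case_prod_unfold by (intro continuous_on_Pair continuous_on_fst continuous_on_id)
    qed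
    moreover have "(\<lambda>(x, v). (x, E k v)) ` (U \<times> ({..<k} \<rightarrow>\<^sub>E X)) \<subseteq> U \<times> (UNIV \<rightarrow> X)"
    proof (intro image_subsetI)
      fix p assume "p \<in> U \<times> ({..<k} \<rightarrow>\<^sub>E X)"
      then have "fst p \<in> U" "snd p \<in> {..<k} \<rightarrow>\<^sub>E X" by (simp_all add: mem_Times_iff)
      with E[OF this(2)] show "(case p of (x, v) \<Rightarrow> (x, E k v)) \<in> U \<times> (UNIV \<rightarrow> X)"
        by (simp add: case_prod_unfold)
    qed
    ultimately have "continuous_on (U \<times> ({..<k} \<rightarrow>\<^sub>E X))
        (\<lambda>p. (\<lambda>(x, v). h k x v) ((\<lambda>(x, v). (x, E k v)) p))"
      by (rule continuous_on_compose2)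
    then show ?thesis
    proof (rule continuous_on_eq)
      fix p assume "p \<in> U \<times> ({..<k} \<rightarrow>\<^sub>E X)"
      then have "fst p \<in> U" "snd p \<in> {..<k} \<rightarrow>\<^sub>E X" by (simp_all add: mem_Times_iff)
      from DE[OF this] show "(case case p of (x, v) \<Rightarrow> (x, E k v) of (x, v) \<Rightarrow> h k x v)
          = (case p of (x, v) \<Rightarrow> iterated_derivative k f x v)"
        by (simp add: case_prod_unfold)
    qed
  qed
  ultimately show ?thesis using U by (simp add: smooth_on_def)
qed

text \<open>Choosing within \<open>S\<close> a derivative along \<open>v k\<close> at stage
  \<open>k\<close>, and iterating from \<open>f\<close>, produces a smooth family. Higher
  derivatives thus need no closed formula, only a set of expressions stable under
  differentiation.\<close>

lemma smooth_onI_closed: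
  fixes S :: "('a::locally_convex \<Rightarrow> (nat \<Rightarrow> 'a) \<Rightarrow> 'b::locally_convex) set"
  assumes X: "subspace X" and U: "openin (top_of_set X) U"
    and cont: "\<And>h. h \<in> S \<Longrightarrow> continuous_on (U \<times> (UNIV \<rightarrow> X)) (\<lambda>(x, v). h x v)"
    and inY: "\<And>h x v. h \<in> S \<Longrightarrow> x \<in> U \<Longrightarrow> v \<in> UNIV \<rightarrow> X \<Longrightarrow> h x v \<in> Y"
    and der: "\<And>h k. h \<in> S \<Longrightarrow> \<exists>h'\<in>S. \<forall>x\<in>U. \<forall>v\<in>UNIV \<rightarrow> X.
                  has_directional_derivative (\<lambda>y. h y v) (h' x v) x (v k)"
    and f: "(\<lambda>x v. f x) \<in> S"
  shows "smooth_on X U Y f"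
proof -
  define R where "R k h h' \<longleftrightarrow> h' \<in> S \<and> (\<forall>x\<in>U. \<forall>v\<in>UNIV \<rightarrow> X.
      has_directional_derivative (\<lambda>y. h y v) (h' x v) x (v k))" for k h h'
  define \<delta> where "\<delta> k h = Eps (R k h)" for k h
  have \<delta>: "R k h (\<delta> k h)" if "h \<in> S" for k h
  proof -
    have "\<exists>h'. R k h h'" using der[OF that, of k] unfolding R_def Bex_def .
    then show ?thesis unfolding \<delta>_def by (rule someI_ex)
  qed
  define h where "h = rec_nat (\<lambda>x v. f x) \<delta>"
  have S: "h k \<in> S" for k
  proof (induction k)
    case (Suc k)
    then show ?case using \<delta>[of "h k" k] by (simp add: h_def R_def)
  qed (simp add: h_def f)
  have step: "has_directional_derivative (\<lambda>y. h k y v) (h (Suc k) x v) x (v k)"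
    if "x \<in> U" "v \<in> UNIV \<rightarrow> X" for k x v
    using \<delta>[OF S[of k], of k] that by (simp add: R_def h_def)
  have "smooth_family X U Y h"
    unfolding smooth_family_def by (intro conjI allI ballI inY[OF S] cont[OF S] step)
  then show ?thesis by (rule smooth_onI_family[OF X U]) (simp add: h_def)
qed

section \<open>Multilinearity of iterated derivatives\<close>

declare iterated_derivative.simps(2) [simp del]

lemma smooth_on_openin: "smooth_on X U Y f \<Longrightarrow> openin (top_of_set X) U"
  and smooth_on_image: "smooth_on X U Y f \<Longrightarrow> f ` U \<subseteq> Y"
  by (simp_all add: smooth_on_def)

lemma smooth_on_range: "smooth_on X U Y f \<Longrightarrow> x \<in> U \<Longrightarrow> f x \<in> Y"
  by (auto simp: smooth_on_def)

lemma smooth_on_subset_model: "smooth_on X U Y f \<Longrightarrow> U \<subseteq> X"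
  using smooth_on_openin openin_imp_subset by blast

text \<open>Because sequences of directions carry the product topology, convergence in each slot is
  all that a limit along a filter requires.\<close>

lemma continuous_on_family_tendsto:
  assumes "continuous_on (U \<times> (UNIV \<rightarrow> X)) (\<lambda>(x, v). h x v)"
    and "(c \<longlongrightarrow> c0) F" "\<And>i. ((\<lambda>t. w t i) \<longlongrightarrow> w0 i) F"
    and "c0 \<in> U" "w0 \<in> UNIV \<rightarrow> X"
    and "\<forall>\<^sub>F t in F. c t \<in> U \<and> w t \<in> UNIV \<rightarrow> X"
  shows "((\<lambda>t. h (c t) (w t)) \<longlongrightarrow> h c0 w0) F"
proof -
  have "((\<lambda>t. (c t, w t)) \<longlongrightarrow> (c0, w0)) F"
    using assms(2,3) by (intro tendsto_Pair) (simp_all add: tendsto_fun_iff)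
  moreover have "\<forall>\<^sub>F t in F. (c t, w t) \<in> U \<times> (UNIV \<rightarrow> X)"
    using assms(6) by eventually_elim (simp add: mem_Times_iff)
  ultimately have "((\<lambda>t. (\<lambda>(x, v). h x v) (c t, w t)) \<longlongrightarrow> (\<lambda>(x, v). h x v) (c0, w0)) F"
    using assms(4,5) by (intro continuous_on_tendsto_compose[OF assms(1)]) (simp_all add: mem_Times_iff)
  then show ?thesis by simp
qed

lemma fun_upd_in_Pi: "v \<in> UNIV \<rightarrow> X \<Longrightarrow> a \<in> X \<Longrightarrow> v(i := a) \<in> UNIV \<rightarrow> X"
  by (simp add: Pi_iff)

lemma continuous_on_last_direction:
  assumes h: "continuous_on (U \<times> (UNIV \<rightarrow> X)) (\<lambda>(x, v). h x v)" and v: "v \<in> UNIV \<rightarrow> X"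
  shows "continuous_on (U \<times> X) (\<lambda>(x, a). h x (v(k := a)))"
  unfolding continuous_on_def
proof
  fix p assume p: "p \<in> U \<times> X"
  have "((\<lambda>q. h (fst q) (v(k := snd q))) \<longlongrightarrow> h (fst p) (v(k := snd p))) (at p within U \<times> X)"
  proof (rule continuous_on_family_tendsto[OF h])
    show "((\<lambda>q. (v(k := snd q)) i) \<longlongrightarrow> (v(k := snd p)) i) (at p within U \<times> X)" for i
      by (cases "i = k") (auto intro: tendsto_intros)
    show "\<forall>\<^sub>F q in at p within U \<times> X. fst q \<in> U \<and> v(k := snd q) \<in> UNIV \<rightarrow> X"
      unfolding eventually_at_filter
      by (rule always_eventually) (use v in \<open>auto simp: mem_Times_iff fun_upd_in_Pi\<close>)
  qed (use p v in \<open>auto simp: mem_Times_iff fun_upd_in_Pi intro: tendsto_intros\<close>)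
  then show "((\<lambda>(x, a). h x (v(k := a))) \<longlongrightarrow> (case p of (x, a) \<Rightarrow> h x (v(k := a)))) (at p within U \<times> X)"
    by (simp add: case_prod_unfold)
qed

lemma smooth_derivative_along:
  assumes X: "subspace X" and f: "smooth_on X U Y f" and v: "v \<in> UNIV \<rightarrow> X"
    and x: "x \<in> U" "a \<in> X"
  shows "has_directional_derivative (\<lambda>y. iterated_derivative k f y v)
           (iterated_derivative (Suc k) f x (v(k := a))) x a"
proof -
  have "has_directional_derivative (\<lambda>y. iterated_derivative k f y (v(k := a)))
           (iterated_derivative (Suc k) f x (v(k := a))) x ((v(k := a)) k)"
    by (rule smooth_family_derivative[OF smooth_on_iterated_derivative[OF X f] x(1)])
      (rule fun_upd_in_Pi[OF v x(2)])
  moreover have "iterated_derivative k f y (v(k := a)) = iterated_derivative k f y v" for y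
    by (rule iterated_derivative_dirs_cong) simp
  ultimately show ?thesis by (simp del: iterated_derivative.simps)
qed

lemma smooth_strict_derivative:
  assumes X: "subspace X" and f: "smooth_on X U Y f" and v: "v \<in> UNIV \<rightarrow> X"
    and x: "(x \<longlongrightarrow> x0) (at 0)" "\<forall>\<^sub>F t in at (0::real). x t \<in> X" "x0 \<in> U"
    and w: "(w \<longlongrightarrow> w0) (at 0)" "\<forall>\<^sub>F t in at (0::real). w t \<in> X" "w0 \<in> X"
  shows "((\<lambda>t. (iterated_derivative k f (x t + t *\<^sub>R w t) v - iterated_derivative k f (x t) v) /\<^sub>R t)
            \<longlongrightarrow> iterated_derivative (Suc k) f x0 (v(k := w0))) (at 0)"
proof (rule strict_directional_derivative[OF X smooth_on_openin[OF f] _ _ x w,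
      where f' = "\<lambda>x a. iterated_derivative (Suc k) f x (v(k := a))"])
  show "continuous_on (U \<times> X) (\<lambda>(x, a). iterated_derivative (Suc k) f x (v(k := a)))"
    by (rule continuous_on_last_direction[OF smooth_family_continuous[OF smooth_on_iterated_derivative[OF X f]] v])
qed (rule smooth_derivative_along[OF X f v])

text \<open>Additivity rests on strictness: the quotient from x + ta to x + ta + tb tends to
  \<open>D b\<close> although its base point moves, and adding the quotient from x to x + ta
  telescopes. Homogeneity is a substitution in the limit.\<close>

lemma iterated_derivative_linear_last:
  fixes k :: nat
  assumes X: "subspace X" and f: "smooth_on X U Y f" and v: "v \<in> UNIV \<rightarrow> X"
    and x: "x \<in> U" and ab: "a \<in> X" "b \<in> X"
  defines "D \<equiv> \<lambda>a. iterated_derivative (Suc k) f x (v(k := a))"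
  shows "D (a + b) = D a + D b" and "D (c *\<^sub>R a) = c *\<^sub>R D a"
proof -
  let ?f = "\<lambda>y. iterated_derivative k f y v"
  have xX: "x \<in> X" using smooth_on_subset_model[OF f] x by auto
  have inX: "\<forall>\<^sub>F t in at (0::real). x + t *\<^sub>R a \<in> X" "\<forall>\<^sub>F t in at (0::real). x \<in> X"
    "\<forall>\<^sub>F t in at (0::real). b \<in> X" "\<forall>\<^sub>F t in at (0::real). a \<in> X" "\<forall>\<^sub>F t in at (0::real). a + b \<in> X"
    using ab xX X by (auto intro!: always_eventually subspace_add subspace_scale)
  have sd: "((\<lambda>t. (?f (z t + t *\<^sub>R w t) - ?f (z t)) /\<^sub>R t) \<longlongrightarrow> D w0) (at 0)"
    if "(z \<longlongrightarrow> x) (at 0)" "\<forall>\<^sub>F t in at 0. z t \<in> X"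
      "(w \<longlongrightarrow> w0) (at 0)" "\<forall>\<^sub>F t in at 0. w t \<in> X" "w0 \<in> X" for z w w0
    unfolding D_def by (rule smooth_strict_derivative[OF X f v that(1,2) x that(3-5)])
  have 1: "((\<lambda>t. (?f (x + t *\<^sub>R a + t *\<^sub>R b) - ?f (x + t *\<^sub>R a)) /\<^sub>R t) \<longlongrightarrow> D b) (at 0)"
    by (rule sd) (use line_tendsto inX ab in auto)
  have 2: "((\<lambda>t. (?f (x + t *\<^sub>R a) - ?f x) /\<^sub>R t) \<longlongrightarrow> D a) (at 0)"
    by (rule sd) (use inX ab in auto)
  have 3: "((\<lambda>t. (?f (x + t *\<^sub>R (a + b)) - ?f x) /\<^sub>R t) \<longlongrightarrow> D (a + b)) (at 0)"
    by (rule sd) (use inX ab X in \<open>auto intro: subspace_add\<close>)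
  from tendsto_add[OF 1 2]
  have "((\<lambda>t. (?f (x + t *\<^sub>R (a + b)) - ?f x) /\<^sub>R t) \<longlongrightarrow> D b + D a) (at 0)"
    by (simp add: scaleR_add_right[symmetric] add.assoc)
  from tendsto_unique[OF _ 3 this] show "D (a + b) = D a + D b" by (simp add: add.commute)
  show "D (c *\<^sub>R a) = c *\<^sub>R D a"
  \<comment> \<open>The substitution \<open>t * c\<close> degenerates at \<open>c = 0\<close>; there
    \<open>D 0\<close> is a limit of vanishing quotients.\<close>
  proof (cases "c = 0")
    case True
    have "((\<lambda>t. (?f (x + t *\<^sub>R 0) - ?f x) /\<^sub>R t) \<longlongrightarrow> D 0) (at 0)"
      by (rule sd) (use inX X in \<open>auto intro: subspace_0\<close>)
    then show ?thesis using True by (simp add: tendsto_const_iff)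
  next
    case False
    have "((\<lambda>t. (?f (x + t *\<^sub>R c *\<^sub>R a) - ?f x) /\<^sub>R t) \<longlongrightarrow> D (c *\<^sub>R a)) (at 0)"
      by (rule sd) (use inX ab X in \<open>auto intro: subspace_scale\<close>)
    moreover have "filterlim (\<lambda>t. t * c) (at 0) (at 0)"
      using False by (auto simp: filterlim_at eventually_at_filter intro!: tendsto_eq_intros)
    from filterlim_compose[OF 2 this]
    have "((\<lambda>t. c *\<^sub>R ((?f (x + (t * c) *\<^sub>R a) - ?f x) /\<^sub>R (t * c))) \<longlongrightarrow> c *\<^sub>R D a) (at 0)"
      by (intro tendsto_scaleR_locally_convex tendsto_const)
    then have "((\<lambda>t. (?f (x + t *\<^sub>R c *\<^sub>R a) - ?f x) /\<^sub>R t) \<longlongrightarrow> c *\<^sub>R D a) (at 0)"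
    proof -
      have [simp]: "c * (inverse t * inverse c) = inverse t" for t using False by (simp add: field_simps)
      show ?thesis if "((\<lambda>t. c *\<^sub>R ((?f (x + (t * c) *\<^sub>R a) - ?f x) /\<^sub>R (t * c))) \<longlongrightarrow> c *\<^sub>R D a) (at 0)"
        using that by simp
    qed
    ultimately show ?thesis by (rule tendsto_unique[rotated]) simp
  qed
qed

text \<open>The slot differentiated last is \<open>iterated_derivative_linear_last\<close>. In an
  earlier slot the identity holds one order lower by induction, and differentiating both sides along
  \<open>v k\<close> preserves it by uniqueness of limits.\<close>

lemma iterated_derivative_multilinear:
  assumes X: "subspace X" and f: "smooth_on X U Y f" and v: "v \<in> UNIV \<rightarrow> X"
    and x: "x \<in> U" and ab: "a \<in> X" "b \<in> X" and i: "i < k"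
  shows "iterated_derivative k f x (v(i := a + b)) =
           iterated_derivative k f x (v(i := a)) + iterated_derivative k f x (v(i := b))"
    and "iterated_derivative k f x (v(i := c *\<^sub>R a)) = c *\<^sub>R iterated_derivative k f x (v(i := a))"
  using v x i
proof (induction k arbitrary: v x)
  case (Suc k)
  let ?D = "\<lambda>k. iterated_derivative k f"
  case 1
  show ?case
  proof (cases "i = k")
    case True
    show ?thesis unfolding True by (rule iterated_derivative_linear_last[OF X f 1(1,2) ab])
  next
    case False
    then have i: "i < k" using 1 by simp
    have d: "has_directional_derivative (\<lambda>y. ?D k y (v(i := a))) (?D (Suc k) x (v(i := a))) x (v k)"
      if "a \<in> X" for a
      using smooth_family_derivative[OF smooth_on_iterated_derivative[OF X f] 1(2) fun_upd_in_Pi[OF 1(1) that], of k i] False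
      by (simp del: iterated_derivative.simps)
    have "has_directional_derivative (\<lambda>y. ?D k y (v(i := a)) + ?D k y (v(i := b)))
        (?D (Suc k) x (v(i := a)) + ?D (Suc k) x (v(i := b))) x (v k)"
      using curve_derivative_add d[OF ab(1)] d[OF ab(2)] unfolding has_directional_derivative_iff_curve by blast
    then have "has_directional_derivative (\<lambda>y. ?D k y (v(i := a + b)))
        (?D (Suc k) x (v(i := a)) + ?D (Suc k) x (v(i := b))) x (v k)"
      by (rule has_directional_derivative_cong[OF X smooth_on_openin[OF f] 1(2), rotated 2])
        (use 1(1) in \<open>simp add: Pi_iff\<close>, rule Suc.IH(1)[OF 1(1) _ i, symmetric])
    with d[of "a + b"] subspace_add[OF X ab]
    show ?thesis unfolding has_directional_derivative_iff_curve
      using curve_derivative_unique by blast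
  qed
  case 2
  show ?case
  proof (cases "i = k")
    case True
    show ?thesis unfolding True by (rule iterated_derivative_linear_last[OF X f 2(1,2) ab])
  next
    case False
    then have i: "i < k" using 2 by simp
    have d: "has_directional_derivative (\<lambda>y. ?D k y (v(i := a))) (?D (Suc k) x (v(i := a))) x (v k)"
      if "a \<in> X" for a
      using smooth_family_derivative[OF smooth_on_iterated_derivative[OF X f] 2(2) fun_upd_in_Pi[OF 2(1) that], of k i] False
      by (simp del: iterated_derivative.simps)
    have "has_directional_derivative (\<lambda>y. c *\<^sub>R ?D k y (v(i := a)))
        (c *\<^sub>R ?D (Suc k) x (v(i := a))) x (v k)"
      using tendsto_scaleR_locally_convex[OF tendsto_const[of c] d[OF ab(1), unfolded has_directional_derivative_def]]
      unfolding has_directional_derivative_def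
      by (simp add: scaleR_diff_right mult.commute)
    then have "has_directional_derivative (\<lambda>y. ?D k y (v(i := c *\<^sub>R a)))
        (c *\<^sub>R ?D (Suc k) x (v(i := a))) x (v k)"
      by (rule has_directional_derivative_cong[OF X smooth_on_openin[OF f] 2(2), rotated 2])
        (use 2(1) in \<open>simp add: Pi_iff\<close>, rule Suc.IH(2)[OF 2(1) _ i, symmetric])
    with d[of "c *\<^sub>R a"] subspace_scale[OF X ab(1)]
    show ?thesis unfolding has_directional_derivative_iff_curve
      using curve_derivative_unique by blast
  qed
qed simp_all

section \<open>Composition of smooth maps\<close>

lemma iterated_derivative_diff_direction:
  assumes X: "subspace X" and f: "smooth_on X U Y f" and v: "v \<in> UNIV \<rightarrow> X"
    and x: "x \<in> U" and ab: "a \<in> X" "b \<in> X" and i: "i < k"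
  shows "(iterated_derivative k f x (v(i := a)) - iterated_derivative k f x (v(i := b))) /\<^sub>R t
     = iterated_derivative k f x (v(i := (a - b) /\<^sub>R t))"
proof -
  note ml = iterated_derivative_multilinear[OF X f v x _ _ i]
  have ab': "a - b \<in> X" using ab X by (rule_tac subspace_diff)
  have "iterated_derivative k f x (v(i := (a - b) + b)) =
      iterated_derivative k f x (v(i := a - b)) + iterated_derivative k f x (v(i := b))"
    by (rule ml(1)[OF ab' ab(2)])
  moreover have "iterated_derivative k f x (v(i := (a - b) /\<^sub>R t)) =
      iterated_derivative k f x (v(i := a - b)) /\<^sub>R t"
    by (rule ml(2)[OF ab' ab'])
  ultimately show ?thesis by simp
qed

text \<open>Product rule: base point and directions move one after the other. The base point
  contributes by strict differentiability, each direction by linearity in its slot, into which the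
  quotient of that direction can be inserted. The velocity \<open>c'\<close> goes to slot
  \<open>k\<close>, which order \<open>k\<close> does not read.\<close>

lemma curve_derivative_iterated:
  assumes X: "subspace X" and g: "smooth_on X U Y g"
    and c: "curve_derivative c c'" "c 0 \<in> U" "c' \<in> X"
    and w: "\<And>i. curve_derivative (\<lambda>t. w t i) (w' i)" "w 0 \<in> UNIV \<rightarrow> X" "w' \<in> UNIV \<rightarrow> X"
    and ev: "\<forall>\<^sub>F t in at 0. c t \<in> U \<and> w t \<in> UNIV \<rightarrow> X"
  shows "curve_derivative (\<lambda>t. iterated_derivative k g (c t) (w t))
     (iterated_derivative (Suc k) g (c 0) ((w 0)(k := c')) +
       (\<Sum>i<k. iterated_derivative k g (c 0) ((w 0)(i := w' i))))"
proof -
  let ?D = "iterated_derivative k g"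
  \<comment> \<open>The first \<open>m\<close> directions follow the curve and the others are frozen
    at time 0; the induction on \<open>m\<close> releases one at a time.\<close>
  define v where "v m t = (\<lambda>i. if i < m then w t i else w 0 i)" for m :: nat and t
  have cont: "continuous_on (U \<times> (UNIV \<rightarrow> X)) (\<lambda>(x, v). ?D x v)"
    by (rule smooth_family_continuous[OF smooth_on_iterated_derivative[OF X g]])
  have v0: "v m 0 = w 0" for m by (auto simp: v_def)
  have vX: "v m t \<in> UNIV \<rightarrow> X" if "w t \<in> UNIV \<rightarrow> X" for m t
    using that w(2) by (simp add: v_def Pi_iff)
  have wi: "((\<lambda>t. w t i) \<longlongrightarrow> w 0 i) (at 0)" for i
    using curve_derivative_tendsto[OF w(1)[of i]] .
  have "curve_derivative (\<lambda>t. ?D (c t) (v m t))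
     (iterated_derivative (Suc k) g (c 0) ((w 0)(k := c')) + (\<Sum>i<m. ?D (c 0) ((w 0)(i := w' i))))"
    if "m \<le> k" for m
    using that
  proof (induction m)
    case 0
    \<comment> \<open>\<open>c 0 + t *\<^sub>R q t = c t\<close> writes the curve as a line with
      moving direction, the form that the strict derivative accepts.\<close>
    define q where "q t = (if t = 0 then c' else (c t - c 0) /\<^sub>R t)" for t
    have U: "c 0 \<in> X" using smooth_on_subset_model[OF g] c by auto
    have q: "(q \<longlongrightarrow> c') (at 0)"
    proof (rule Lim_transform_eventually)
      show "((\<lambda>t. (c t - c 0) /\<^sub>R t) \<longlongrightarrow> c') (at 0)" using c(1) by (simp add: curve_derivative_def)
    qed (simp add: q_def eventually_at_filter)
    have "((\<lambda>t. (?D (c 0 + t *\<^sub>R q t) (w 0) - ?D (c 0) (w 0)) /\<^sub>R t)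
            \<longlongrightarrow> iterated_derivative (Suc k) g (c 0) ((w 0)(k := c'))) (at 0)"
    proof (rule smooth_strict_derivative[OF X g w(2) tendsto_const _ c(2) q _ c(3)])
      show "\<forall>\<^sub>F t in at 0. q t \<in> X"
        using ev
      proof eventually_elim
        case (elim t)
        then have "c t \<in> X" using smooth_on_subset_model[OF g] by auto
        then show ?case using c(3) U X by (simp add: q_def subspace_scale subspace_diff)
      qed
    qed (use U in simp)
    moreover have "c 0 + t *\<^sub>R q t = c t" for t by (simp add: q_def)
    moreover have "v 0 t = w 0" for t by (simp add: v_def)
    ultimately show ?case by (simp only: curve_derivative_def lessThan_0 sum.empty add_0_right)
  next
    case (Suc m)
    then have m: "m < k" by simp
    \<comment> \<open>The base point and the earlier directions move as well; joint continuity at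
      order \<open>k\<close> absorbs this.\<close>
    have "((\<lambda>t. ?D (c t) ((v m t)(m := (w t m - w 0 m) /\<^sub>R t))) \<longlongrightarrow> ?D (c 0) ((w 0)(m := w' m))) (at 0)"
    proof (rule continuous_on_family_tendsto[OF cont curve_derivative_tendsto[OF c(1)] _ c(2)])
      show "((\<lambda>t. ((v m t)(m := (w t m - w 0 m) /\<^sub>R t)) i) \<longlongrightarrow> ((w 0)(m := w' m)) i) (at 0)" for i
      proof (cases "i = m")
        case True
        then show ?thesis using w(1)[of m] by (simp add: curve_derivative_def)
      next
        case False
        then show ?thesis using wi[of i] by (cases "i < m") (simp_all add: v_def)
      qed
      show "(w 0)(m := w' m) \<in> UNIV \<rightarrow> X" using w by (simp add: Pi_iff)
      show "\<forall>\<^sub>F t in at 0. c t \<in> U \<and> (v m t)(m := (w t m - w 0 m) /\<^sub>R t) \<in> UNIV \<rightarrow> X"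
        using ev
      proof eventually_elim
        case (elim t)
        then have "w t m \<in> X" "w 0 m \<in> X" using w(2) by (auto simp: Pi_iff)
        then have "(w t m - w 0 m) /\<^sub>R t \<in> X" by (intro subspace_scale subspace_diff X)
        then show ?case using elim vX[of t m] by (auto intro: fun_upd_in_Pi)
      qed
    qed
    then have "((\<lambda>t. (?D (c t) (v (Suc m) t) - ?D (c t) (v m t)) /\<^sub>R t) \<longlongrightarrow> ?D (c 0) ((w 0)(m := w' m))) (at 0)"
    proof (rule Lim_transform_eventually)
      show "\<forall>\<^sub>F t in at 0. ?D (c t) ((v m t)(m := (w t m - w 0 m) /\<^sub>R t)) =
          (?D (c t) (v (Suc m) t) - ?D (c t) (v m t)) /\<^sub>R t"
        using ev
      proof eventually_elim
        case (elim t)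
        then have X2: "w t m \<in> X" "w 0 m \<in> X" using w(2) by (auto simp: Pi_iff)
        have "v (Suc m) t = (v m t)(m := w t m)" "v m t = (v m t)(m := w 0 m)"
          by (auto simp: v_def fun_eq_iff less_Suc_eq)
        then show ?case
          using iterated_derivative_diff_direction[OF X g vX[of t m] _ X2 m, of "c t" t] elim by metis
      qed
    qed
    then have "curve_derivative (\<lambda>t. ?D (c t) (v (Suc m) t) - ?D (c t) (v m t)) (?D (c 0) ((w 0)(m := w' m)))"
      by (simp add: curve_derivative_def v0)
    from curve_derivative_add[OF this Suc.IH[OF less_imp_le[OF m]], unfolded diff_add_cancel]
    show ?case by (simp only: sum.lessThan_Suc ac_simps)
  qed
  from this[of k] have "curve_derivative (\<lambda>t. ?D (c t) (v k t))
     (iterated_derivative (Suc k) g (c 0) ((w 0)(k := c')) + (\<Sum>i<k. ?D (c 0) ((w 0)(i := w' i))))"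
    by simp
  moreover have "?D (c t) (v k t) = ?D (c t) (w t)" for t
    by (rule iterated_derivative_dirs_cong) (simp add: v_def)
  ultimately show ?thesis by simp
qed

text \<open>The terms of Faa di Bruno's formula, with repeated summands in place of coefficients:
  slot \<open>i\<close> of a derivative of \<open>g\<close> holds the derivative of \<open>f\<close>
  of order \<open>m i\<close>, and \<open>\<sigma> i\<close> selects the directions it is taken
  in.\<close>

inductive_set composition_terms ::
    "('a::locally_convex \<Rightarrow> 'b::locally_convex) \<Rightarrow> ('b \<Rightarrow> 'c::locally_convex) \<Rightarrow>
     ('a \<Rightarrow> (nat \<Rightarrow> 'a) \<Rightarrow> 'c) set" for f g where
  zero: "(\<lambda>x v. 0) \<in> composition_terms f g"
| add: "h \<in> composition_terms f g \<Longrightarrow> h' \<in> composition_terms f g \<Longrightarrow>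
    (\<lambda>x v. h x v + h' x v) \<in> composition_terms f g"
| comp: "(\<lambda>x v. iterated_derivative k g (f x)
      (\<lambda>i. iterated_derivative (m i) f x (\<lambda>l. v (\<sigma> i l)))) \<in> composition_terms f g"

lemma composition_terms_sum:
  assumes "\<And>i. i < (n::nat) \<Longrightarrow> h i \<in> composition_terms f g"
  shows "(\<lambda>x v. \<Sum>i<n. h i x v) \<in> composition_terms f g"
  using assms
proof (induction n)
  case (Suc n)
  then show ?case using composition_terms.add[of "\<lambda>x v. \<Sum>i<n. h i x v" f g "h n"] by simp
qed (simp add: composition_terms.zero)

lemma reindex_in_Pi: "v \<in> UNIV \<rightarrow> X \<Longrightarrow> (\<lambda>l. v (\<sigma> l)) \<in> UNIV \<rightarrow> X"
  by (simp add: Pi_iff)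

lemma continuous_on_family_compose:
  assumes h: "continuous_on (U \<times> (UNIV \<rightarrow> X)) (\<lambda>(x, v). h x v)"
    and c: "continuous_on S c" "c ` S \<subseteq> U"
    and w: "\<And>i. continuous_on S (\<lambda>p. w p i)" "\<And>p. p \<in> S \<Longrightarrow> w p \<in> UNIV \<rightarrow> X"
  shows "continuous_on S (\<lambda>p. h (c p) (w p))"
  unfolding continuous_on_def
proof
  fix p assume p: "p \<in> S"
  show "((\<lambda>p. h (c p) (w p)) \<longlongrightarrow> h (c p) (w p)) (at p within S)"
  proof (rule continuous_on_family_tendsto[OF h])
    show "\<forall>\<^sub>F q in at p within S. c q \<in> U \<and> w q \<in> UNIV \<rightarrow> X"
      unfolding eventually_at_filter by (rule always_eventually) (use c w in \<open>auto simp del: Pi_iff\<close>)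
  qed (use c(1) w(1) p in \<open>simp_all add: continuous_on_def\<close>, use c w p in \<open>auto simp del: Pi_iff\<close>)
qed

lemma continuous_on_reindexed_family:
  assumes h: "continuous_on (U \<times> (UNIV \<rightarrow> X)) (\<lambda>(x, v). h x v)"
  shows "continuous_on (U \<times> (UNIV \<rightarrow> X)) (\<lambda>p. h (fst p) (\<lambda>l. snd p (\<sigma> l)))"
  by (rule continuous_on_family_compose[OF h continuous_on_fst[OF continuous_on_id]])
    (auto intro: continuous_on_snd_apply)

text \<open>The new direction occupies slot \<open>m\<close> and is entry \<open>k\<close> of the
  sequence, so the result is again a reindexed derivative. This keeps
  \<open>composition_terms\<close> closed.\<close>

lemma smooth_reindexed_derivative:
  assumes X: "subspace X" and f: "smooth_on X U Y f" and v: "v \<in> UNIV \<rightarrow> X" and x: "x \<in> U"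
  shows "curve_derivative (\<lambda>t. iterated_derivative m f (x + t *\<^sub>R v k) (\<lambda>l. v (\<sigma> l)))
    (iterated_derivative (Suc m) f x (\<lambda>l. v ((\<sigma>(m := k)) l)))"
proof -
  let ?w = "\<lambda>l. v ((\<sigma>(m := k)) l)"
  have "curve_derivative (\<lambda>t. iterated_derivative m f (x + t *\<^sub>R ?w m) ?w)
    (iterated_derivative (Suc m) f x ?w)"
    using smooth_family_derivative[OF smooth_on_iterated_derivative[OF X f] x reindex_in_Pi[OF v, of "\<sigma>(m := k)"], of m]
    by (simp add: has_directional_derivative_iff_curve)
  moreover have "iterated_derivative m f y ?w = iterated_derivative m f y (\<lambda>l. v (\<sigma> l))" for y
    by (rule iterated_derivative_dirs_cong) simp
  ultimately show ?thesis by simp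
qed

theorem smooth_on_compose:
  assumes X: "subspace X" and Y: "subspace Y" and Z: "subspace Z"
    and f: "smooth_on X U Y f" and g: "smooth_on Y V Z g" and sub: "f ` U \<subseteq> V"
  shows "smooth_on X U Z (\<lambda>x. g (f x))"
proof (rule smooth_onI_closed[OF X smooth_on_openin[OF f], of "composition_terms f g"])
  note Df = smooth_on_iterated_derivative[OF X f]
  note Dg = smooth_on_iterated_derivative[OF Y g]
  have fin: "f x \<in> V" if "x \<in> U" for x using sub that by auto
  have dirs: "(\<lambda>i. iterated_derivative (m i) f x (\<lambda>l. v (\<sigma> i l))) \<in> UNIV \<rightarrow> Y"
    if "x \<in> U" "v \<in> UNIV \<rightarrow> X" for x v and m :: "nat \<Rightarrow> nat" and \<sigma> :: "nat \<Rightarrow> nat \<Rightarrow> nat"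
    by (intro Pi_I smooth_family_in[OF Df that(1)] reindex_in_Pi[OF that(2)])
  have "(\<lambda>x v. iterated_derivative 0 g (f x)
      (\<lambda>i. iterated_derivative 0 f x (\<lambda>l. v 0))) \<in> composition_terms f g"
    using composition_terms.comp[of 0 g f "\<lambda>_. 0" "\<lambda>_ _. 0"] .
  then show "(\<lambda>x v. g (f x)) \<in> composition_terms f g" by simp
  show "continuous_on (U \<times> (UNIV \<rightarrow> X)) (\<lambda>(x, v). h x v)" if "h \<in> composition_terms f g" for h
    using that
  proof induction
    case (add h h')
    then have "continuous_on (U \<times> (UNIV \<rightarrow> X)) (\<lambda>p. (\<lambda>(x, v). h x v) p + (\<lambda>(x, v). h' x v) p)"
      unfolding continuous_on_def by (blast intro: tendsto_add)
    then show ?case by (simp add: case_prod_unfold)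
  next
    case (comp k m \<sigma>)
    have "continuous_on (U \<times> ((UNIV :: nat set) \<rightarrow> X)) (\<lambda>p. f (fst p))"
      using continuous_on_reindexed_family[OF smooth_family_continuous[OF Df, of 0], of "\<lambda>l. l"] by simp
    then show ?case unfolding case_prod_unfold
    proof (rule continuous_on_family_compose[OF smooth_family_continuous[OF Dg]])
      show "continuous_on (U \<times> (UNIV \<rightarrow> X))
          (\<lambda>p. iterated_derivative (m i) f (fst p) (\<lambda>l. snd p (\<sigma> i l)))" for i
        by (rule continuous_on_reindexed_family[OF smooth_family_continuous[OF Df]])
      show "(\<lambda>i. iterated_derivative (m i) f (fst p) (\<lambda>l. snd p (\<sigma> i l))) \<in> UNIV \<rightarrow> Y"
        if "p \<in> U \<times> (UNIV \<rightarrow> X)" for p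
        using that by (intro dirs) (simp_all add: mem_Times_iff)
    qed (use fin in auto)
  qed simp
  show "h x v \<in> Z" if "h \<in> composition_terms f g" "x \<in> U" "v \<in> UNIV \<rightarrow> X" for h x v
    using that
  proof induction
    case (comp k m \<sigma>)
    then show ?case by (intro smooth_family_in[OF Dg] fin dirs)
  qed (use Z in \<open>auto intro: subspace_0 subspace_add\<close>)
  show "\<exists>h'\<in>composition_terms f g. \<forall>x\<in>U. \<forall>v\<in>UNIV \<rightarrow> X.
      has_directional_derivative (\<lambda>y. h y v) (h' x v) x (v k)"
    if "h \<in> composition_terms f g" for h k
    using that
  proof induction
    case zero
    show ?case
      by (intro bexI[OF _ composition_terms.zero])
        (simp add: has_directional_derivative_iff_curve curve_derivative_const)
  next
    case (add h h')
    then obtain d d' where "d \<in> composition_terms f g" "d' \<in> composition_terms f g"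
      and d: "\<forall>x\<in>U. \<forall>v\<in>UNIV \<rightarrow> X. has_directional_derivative (\<lambda>y. h y v) (d x v) x (v k)"
        "\<forall>x\<in>U. \<forall>v\<in>UNIV \<rightarrow> X. has_directional_derivative (\<lambda>y. h' y v) (d' x v) x (v k)"
      by (elim bexE)
    then show ?case
      unfolding has_directional_derivative_iff_curve
      by (intro bexI[OF _ composition_terms.add[of d f g d']] ballI curve_derivative_add) simp_all
  next
    case (comp j m \<sigma>)
    let ?w = "\<lambda>x v i. iterated_derivative (m i) f x (\<lambda>l. v (\<sigma> i l))"
    let ?w' = "\<lambda>x v i. iterated_derivative (Suc (m i)) f x (\<lambda>l. v (((\<sigma> i)(m i := k)) l))"
    let ?c' = "\<lambda>x v. iterated_derivative (Suc 0) f x (\<lambda>l. v k)"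
    \<comment> \<open>The value that \<open>curve_derivative_iterated\<close> predicts along the
      image of a line: the new slot \<open>j\<close> receives the velocity of \<open>f\<close>, and
      the sum differentiates one existing slot after the other.\<close>
    define d where "d x v = iterated_derivative (Suc j) g (f x) ((?w x v)(j := ?c' x v)) +
       (\<Sum>i<j. iterated_derivative j g (f x) ((?w x v)(i := ?w' x v i)))" for x v
    have "d \<in> composition_terms f g"
      unfolding d_def
    proof (intro composition_terms.add composition_terms_sum)
      \<comment> \<open>Back to the shape of a term: slot \<open>j\<close> gets order 1 and the
        constant reindexing \<open>k\<close>.\<close>
      have "(?w x v)(j := ?c' x v) = (\<lambda>i. iterated_derivative ((m(j := Suc 0)) i) f x
          (\<lambda>l. v ((\<sigma>(j := \<lambda>_. k)) i l)))" for x v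
        by (auto simp: fun_eq_iff)
      then show "(\<lambda>x v. iterated_derivative (Suc j) g (f x) ((?w x v)(j := ?c' x v))) \<in> composition_terms f g"
        by (simp only: composition_terms.comp)
      fix i
      have "(?w x v)(i := ?w' x v i) = (\<lambda>n. iterated_derivative ((m(i := Suc (m i))) n) f x
          (\<lambda>l. v ((\<sigma>(i := (\<sigma> i)(m i := k))) n l)))" for x v
        by (auto simp: fun_eq_iff)
      then show "(\<lambda>x v. iterated_derivative j g (f x) ((?w x v)(i := ?w' x v i))) \<in> composition_terms f g"
        by (simp only: composition_terms.comp)
    qed
    moreover have "has_directional_derivative (\<lambda>y. iterated_derivative j g (f y) (?w y v)) (d x v) x (v k)"
      if x: "x \<in> U" and v: "v \<in> UNIV \<rightarrow> X" for x v
    proof -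
      have "v k \<in> X" using v by auto
      have w': "?w' x v \<in> UNIV \<rightarrow> Y" using dirs[OF x v, of "\<lambda>i. Suc (m i)"] .
      have c': "?c' x v \<in> Y" by (rule smooth_family_in[OF Df x reindex_in_Pi[OF v]])
      have c: "curve_derivative (\<lambda>t. f (x + t *\<^sub>R v k)) (?c' x v)"
        using smooth_reindexed_derivative[OF X f v x, of 0 k "\<lambda>_. k"] by simp
      have w: "curve_derivative (\<lambda>t. ?w (x + t *\<^sub>R v k) v i) (?w' x v i)" for i
        by (rule smooth_reindexed_derivative[OF X f v x])
      have "\<forall>\<^sub>F t in at 0. x + t *\<^sub>R v k \<in> U"
        by (rule line_eventually_in[OF X smooth_on_openin[OF f] x \<open>v k \<in> X\<close>])
      then have "\<forall>\<^sub>F t in at 0. f (x + t *\<^sub>R v k) \<in> V \<and> ?w (x + t *\<^sub>R v k) v \<in> UNIV \<rightarrow> Y"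
        by eventually_elim (intro conjI fin dirs v)
      from curve_derivative_iterated[OF Y g c _ c' w _ w' this] fin[OF x] dirs[OF x v]
      show ?thesis unfolding has_directional_derivative_iff_curve d_def by simp
    qed
    ultimately show ?case by blast
  qed
qed

section \<open>Operations on smooth maps and calculus of first derivatives\<close>

lemma smooth_on_restrict:
  assumes "smooth_on X U Y f" "openin (top_of_set X) U'" "U' \<subseteq> U"
  shows "smooth_on X U' Y f"
proof -
  have "continuous_on (U' \<times> ({..<k} \<rightarrow>\<^sub>E X)) (\<lambda>(x, v). iterated_derivative k f x v)" for k
  proof (rule continuous_on_subset)
    show "continuous_on (U \<times> ({..<k} \<rightarrow>\<^sub>E X)) (\<lambda>(x, v). iterated_derivative k f x v)"
      using assms(1) by (simp add: smooth_on_def)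
    show "U' \<times> ({..<k} \<rightarrow>\<^sub>E X) \<subseteq> U \<times> ({..<k} \<rightarrow>\<^sub>E X)" using assms(3) by (rule Sigma_mono) simp
  qed
  moreover have "\<exists>l\<in>Y. has_directional_derivative (\<lambda>y. iterated_derivative k f y v) l x (v k)"
    if "x \<in> U'" "v \<in> {..<Suc k} \<rightarrow>\<^sub>E X" for k x v
    using assms(1,3) that by (simp add: smooth_on_def subset_iff)
  moreover have "f ` U' \<subseteq> Y" using assms by (auto simp: smooth_on_def)
  ultimately show ?thesis using assms(2) by (simp add: smooth_on_def)
qed

lemma smooth_on_cong:
  assumes X: "subspace X" and f: "smooth_on X U Y f" and eq: "\<And>x. x \<in> U \<Longrightarrow> f x = g x"
  shows "smooth_on X U Y g"
  by (rule smooth_onI_family[OF X smooth_on_openin[OF f] smooth_on_iterated_derivative[OF X f]])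
    (simp add: eq)

lemma smooth_on_affine:
  assumes X: "subspace X" and Y: "subspace Y"
    and T: "linear_on X T" "T ` X \<subseteq> Y" "continuous_on X T" and a: "a \<in> Y"
  shows "smooth_on X X Y (\<lambda>x. T x + a)"
proof -
  define h where "h k x v = (if k = 0 then T x + a else if k = 1 then T (v 0) else 0)"
    for k :: nat and x and v :: "nat \<Rightarrow> 'a"
  have "smooth_family X X Y h"
    unfolding smooth_family_def
  proof (intro conjI allI ballI)
    fix k x and v :: "nat \<Rightarrow> 'a" assume x: "x \<in> X" and v: "v \<in> UNIV \<rightarrow> X"
    show "h k x v \<in> Y"
      using x v T(2) a subspace_0[OF Y] by (auto simp: h_def Pi_iff intro!: subspace_add[OF Y])
    have "T (x + t *\<^sub>R v k) + a = (T x + a) + t *\<^sub>R T (v k)" for t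
    proof -
      have "T (x + t *\<^sub>R v k) = T x + T (t *\<^sub>R v k)"
        using T(1) x v subspace_scale[OF X, of "v k" t] by (simp add: linear_on_def Pi_iff)
      also have "T (t *\<^sub>R v k) = t *\<^sub>R T (v k)" using T(1) v by (simp add: linear_on_def Pi_iff)
      finally show ?thesis by simp
    qed
    then show "has_directional_derivative (\<lambda>y. h k y v) (h (Suc k) x v) x (v k)"
      using curve_derivative_line[of "T x + a" "T (v k)"]
      by (auto simp: has_directional_derivative_iff_curve h_def curve_derivative_const add.assoc
          add.commute[of _ a])
  next
    fix k
    have "continuous_on (X \<times> ((UNIV :: nat set) \<rightarrow> X)) (\<lambda>p. T (fst p))"
      by (rule continuous_on_compose2[OF T(3) continuous_on_fst[OF continuous_on_id]]) auto
    moreover have "continuous_on (X \<times> ((UNIV :: nat set) \<rightarrow> X)) (\<lambda>p. T (snd p 0))"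
      by (rule continuous_on_compose2[OF T(3) continuous_on_snd_apply]) auto
    ultimately show "continuous_on (X \<times> (UNIV \<rightarrow> X)) (\<lambda>(x, v). h k x v)"
      unfolding case_prod_unfold h_def continuous_on_def by (auto intro: tendsto_add)
  qed
  then show ?thesis by (rule smooth_onI_family[OF X openin_subtopology_self]) (simp add: h_def)
qed

lemma smooth_on_linear:
  assumes "subspace X" "subspace Y" "linear_on X T" "T ` X \<subseteq> Y" "continuous_on X T"
  shows "smooth_on X X Y T"
  using smooth_on_affine[OF assms subspace_0[OF assms(2)]] by simp

lemma smooth_on_translation:
  assumes "subspace X" "a \<in> X"
  shows "smooth_on X X X (\<lambda>x. x + a)"
  by (rule smooth_on_affine[OF assms(1,1) _ _ _ assms(2)]) (auto simp: linear_on_def)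

lemma smooth_on_add:
  assumes X: "subspace X" and Y: "subspace Y"
    and f: "smooth_on X U Y f" and g: "smooth_on X U Y g"
  shows "smooth_on X U Y (\<lambda>x. f x + g x)"
proof (rule smooth_onI_family[OF X smooth_on_openin[OF f],
      where h = "\<lambda>k x v. iterated_derivative k f x v + iterated_derivative k g x v"])
  note Df = smooth_on_iterated_derivative[OF X f] and Dg = smooth_on_iterated_derivative[OF X g]
  show "smooth_family X U Y (\<lambda>k x v. iterated_derivative k f x v + iterated_derivative k g x v)"
    unfolding smooth_family_def
  proof (intro conjI allI ballI)
    fix k x and v :: "nat \<Rightarrow> 'a" assume x: "x \<in> U" "v \<in> UNIV \<rightarrow> X"
    show "iterated_derivative k f x v + iterated_derivative k g x v \<in> Y"
      by (intro subspace_add[OF Y] smooth_family_in[OF Df x] smooth_family_in[OF Dg x])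
    show "has_directional_derivative (\<lambda>y. iterated_derivative k f y v + iterated_derivative k g y v)
        (iterated_derivative (Suc k) f x v + iterated_derivative (Suc k) g x v) x (v k)"
      using curve_derivative_add smooth_family_derivative[OF Df x] smooth_family_derivative[OF Dg x]
      unfolding has_directional_derivative_iff_curve by blast
  next
    fix k
    show "continuous_on (U \<times> (UNIV \<rightarrow> X))
        (\<lambda>(x, v). iterated_derivative k f x v + iterated_derivative k g x v)"
      using smooth_family_continuous[OF Df, of k] smooth_family_continuous[OF Dg, of k]
      unfolding case_prod_unfold continuous_on_def by (simp add: tendsto_add)
  qed
qed simp

lemma smooth_on_compose_linear:
  assumes X: "subspace X" and Y: "subspace Y" and Z: "subspace Z"
    and f: "smooth_on X U Y f" and T: "linear_on Y T" "T ` Y \<subseteq> Z" "continuous_on Y T"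
  shows "smooth_on X U Z (\<lambda>x. T (f x))"
  by (rule smooth_on_compose[OF X Y Z f smooth_on_linear[OF Y Z T] smooth_on_image[OF f]])

lemma continuous_on_uminus: "continuous_on S (\<lambda>x::'a::topological_ab_group_add. - x)"
  unfolding continuous_on_def by (auto intro!: tendsto_intros)

lemma smooth_on_diff:
  assumes X: "subspace X" and Y: "subspace Y"
    and f: "smooth_on X U Y f" and g: "smooth_on X U Y g"
  shows "smooth_on X U Y (\<lambda>x. f x - g x)"
proof -
  have "smooth_on X U Y (\<lambda>x. - g x)"
    by (rule smooth_on_compose_linear[OF X Y Y g _ _ continuous_on_uminus])
      (auto simp: linear_on_def subspace_neg[OF Y])
  from smooth_on_add[OF X Y f this] show ?thesis by simp
qed

lemma smooth_on_continuous: 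
  assumes X: "subspace X" and f: "smooth_on X U Y f"
  shows "continuous_on U f"
proof -
  have "continuous_on U (\<lambda>x. iterated_derivative 0 f x (\<lambda>_. 0))"
    by (rule continuous_on_family_compose[OF smooth_family_continuous[OF smooth_on_iterated_derivative[OF X f]]])
      (auto simp: subspace_0[OF X])
  then show ?thesis by simp
qed

lemma directional_derivative_eq_iterated:
  "directional_derivative f x v = iterated_derivative (Suc 0) f x (\<lambda>_. v)"
  by (simp add: iterated_derivative.simps(2))

lemma smooth_on_directional_derivative:
  assumes X: "subspace X" and f: "smooth_on X U Y f" and x: "x \<in> U"
  shows smooth_on_has_directional_derivative:
      "v \<in> X \<Longrightarrow> has_directional_derivative f (directional_derivative f x v) x v"
    and smooth_on_derivative_range: "v \<in> X \<Longrightarrow> directional_derivative f x v \<in> Y"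
    and smooth_on_derivative_linear: "linear_on X (directional_derivative f x)"
    and smooth_on_derivative_continuous: "continuous_on X (directional_derivative f x)"
proof -
  note Df = smooth_on_iterated_derivative[OF X f]
  have v: "(\<lambda>_::nat. v) \<in> UNIV \<rightarrow> X" if "v \<in> X" for v using that by auto
  show "has_directional_derivative f (directional_derivative f x v) x v" if "v \<in> X"
    using smooth_family_derivative[OF Df x v[OF that], of 0]
    by (simp add: directional_derivative_eq_iterated)
  show "directional_derivative f x v \<in> Y" if "v \<in> X"
    unfolding directional_derivative_eq_iterated by (rule smooth_family_in[OF Df x v[OF that]])
  have upd: "directional_derivative f x v = iterated_derivative (Suc 0) f x ((\<lambda>_. 0)(0 := v))" for v
    unfolding directional_derivative_eq_iterated by (rule iterated_derivative_dirs_cong) simp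
  show "linear_on X (directional_derivative f x)"
    unfolding linear_on_def upd
    using iterated_derivative_linear_last[OF X f v[OF subspace_0[OF X]] x] by blast
  show "continuous_on X (directional_derivative f x)"
    unfolding directional_derivative_eq_iterated
    by (rule continuous_on_family_compose[OF smooth_family_continuous[OF Df]])
      (use x in auto)
qed

text \<open>The case \<open>k = 0\<close> of \<open>curve_derivative_iterated\<close>. Asking for
  one directional derivative of \<open>f\<close> lets the rule start from derivatives computed by
  hand.\<close>

lemma has_directional_derivative_chain:
  assumes X: "subspace X" and Y: "subspace Y"
    and f: "openin (top_of_set X) U" "x \<in> U" "v \<in> X" "f ` U \<subseteq> V" "has_directional_derivative f l x v" "l \<in> Y"
    and g: "smooth_on Y V Z g"
  shows "has_directional_derivative (\<lambda>x. g (f x)) (directional_derivative g (f x) l) x v"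
proof -
  have "\<forall>\<^sub>F t in at 0. x + t *\<^sub>R v \<in> U" by (rule line_eventually_in[OF X f(1-3)])
  then have ev: "\<forall>\<^sub>F t in at 0. f (x + t *\<^sub>R v) \<in> V \<and> (\<lambda>_::nat. 0) \<in> UNIV \<rightarrow> Y"
    by eventually_elim (use f subspace_0[OF Y] in auto)
  have "curve_derivative (\<lambda>t. iterated_derivative 0 g (f (x + t *\<^sub>R v)) (\<lambda>_. 0))
     (iterated_derivative (Suc 0) g (f (x + 0 *\<^sub>R v)) ((\<lambda>_. 0)(0 := l)) +
       (\<Sum>i<0. iterated_derivative 0 g (f (x + 0 *\<^sub>R v)) ((\<lambda>_. 0)(i := 0))))"
    by (rule curve_derivative_iterated[OF Y g _ _ _ _ _ _ ev, where w' = "\<lambda>_. 0"])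
      (use f subspace_0[OF Y] in \<open>auto simp: has_directional_derivative_iff_curve curve_derivative_const\<close>)
  moreover have "iterated_derivative (Suc 0) g (f x) ((\<lambda>_. 0)(0 := l)) = directional_derivative g (f x) l"
    unfolding directional_derivative_eq_iterated by (rule iterated_derivative_dirs_cong) simp
  ultimately show ?thesis by (simp add: has_directional_derivative_iff_curve)
qed

lemma directional_derivative_chain:
  assumes X: "subspace X" and Y: "subspace Y"
    and f: "smooth_on X U Y f" and g: "smooth_on Y V Z g" and x: "f ` U \<subseteq> V" "x \<in> U" "v \<in> X"
  shows "directional_derivative (\<lambda>x. g (f x)) x v =
    directional_derivative g (f x) (directional_derivative f x v)"
  by (rule directional_derivative_eq, rule has_directional_derivative_chain[OF X Y
        smooth_on_openin[OF f] x(2,3,1) smooth_on_has_directional_derivative[OF X f x(2,3)]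
        smooth_on_derivative_range[OF X f x(2,3)] g])

lemma directional_derivative_cong:
  assumes "subspace X" "openin (top_of_set X) U" "x \<in> U" "v \<in> X" "\<And>y. y \<in> U \<Longrightarrow> f y = g y"
    and "smooth_on X U Y f"
  shows "directional_derivative g x v = directional_derivative f x v"
  by (rule directional_derivative_eq, rule has_directional_derivative_cong[OF assms(1-5)
        smooth_on_has_directional_derivative[OF assms(1,6,3,4)]])

lemma curve_derivative_diff:
  assumes "curve_derivative c l" "curve_derivative d k"
  shows "curve_derivative (\<lambda>t. c t - d t) (l - k)"
proof -
  have "((\<lambda>t. (c t - c 0) /\<^sub>R t - (d t - d 0) /\<^sub>R t) \<longlongrightarrow> l - k) (at 0)"
    using assms unfolding curve_derivative_def by (intro tendsto_diff)
  then show ?thesis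
    unfolding curve_derivative_def by (simp add: scaleR_diff_right algebra_simps)
qed

lemma has_directional_derivative_diff:
  "has_directional_derivative f l x v \<Longrightarrow> has_directional_derivative g k x v \<Longrightarrow>
    has_directional_derivative (\<lambda>x. f x - g x) (l - k) x v"
  unfolding has_directional_derivative_iff_curve by (rule curve_derivative_diff)

section \<open>The inverse function theorem in Banach spaces\<close>

text \<open>Fixes one norm \<open>n\<close> witnessing \<open>banach_space_on\<close>. Its metric
  topology is the topology inherited from the ambient type, so norm estimates and topological
  statements about \<open>X\<close> can be exchanged.\<close>

locale banach_subspace =
  fixes X :: "'a::locally_convex set" and n :: "'a \<Rightarrow> real"
  assumes X: "subspace X"
    and n_scale: "x \<in> X \<Longrightarrow> n (c *\<^sub>R x) = \<bar>c\<bar> * n x"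
    and metric: "Metric_space X (\<lambda>x y. n (x - y))"
    and mtopology: "Metric_space.mtopology X (\<lambda>x y. n (x - y)) = top_of_set X"
    and mcomplete: "Metric_space.mcomplete X (\<lambda>x y. n (x - y))"
begin

interpretation M: Metric_space X "\<lambda>x y. n (x - y)" by (rule metric)

lemma zero_in: "0 \<in> X" using X by (rule subspace_0)
lemma add_in: "x \<in> X \<Longrightarrow> y \<in> X \<Longrightarrow> x + y \<in> X" using X by (rule subspace_add)
lemma diff_in: "x \<in> X \<Longrightarrow> y \<in> X \<Longrightarrow> x - y \<in> X" using X by (rule subspace_diff)
lemma scale_in: "x \<in> X \<Longrightarrow> c *\<^sub>R x \<in> X" using X by (rule subspace_scale)
lemma minus_in: "x \<in> X \<Longrightarrow> - x \<in> X" using X by (rule subspace_neg)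

lemma n_nonneg: "0 \<le> n x"
  using M.nonneg[of x 0] by simp

lemma n_zero: "n 0 = 0"
  using M.zero[OF zero_in zero_in] by simp

lemma n_eq_0: "x \<in> X \<Longrightarrow> n x = 0 \<longleftrightarrow> x = 0"
  using M.zero[OF _ zero_in, of x] by simp

lemma n_minus: "n (- x) = n x"
  using M.commute[of 0 x] by simp

lemma n_minus_commute: "n (x - y) = n (y - x)"
  by (rule M.commute)

lemma n_add_le: "x \<in> X \<Longrightarrow> y \<in> X \<Longrightarrow> n (x + y) \<le> n x + n y"
  using M.triangle[OF _ zero_in minus_in, of x y] by simp

lemma n_diff_le: "x \<in> X \<Longrightarrow> y \<in> X \<Longrightarrow> n (x - y) \<le> n x + n y"
  using n_add_le[OF _ minus_in, of x y] by (simp add: n_minus)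

lemma openin_norm_ball: "a \<in> X \<Longrightarrow> openin (top_of_set X) {x \<in> X. n (x - a) < e}"
proof -
  assume "a \<in> X"
  then have "{x \<in> X. n (x - a) < e} = M.mball a e"
    by (auto simp: M.mball_def M.commute)
  then show ?thesis using M.openin_mball[of a e] by (simp add: mtopology)
qed

lemma openin_norm_ball0: "openin (top_of_set X) {x \<in> X. n x < e}"
  using openin_norm_ball[OF zero_in, of e] by simp

lemma openin_contains_norm_ball:
  assumes "openin (top_of_set X) U" "a \<in> U"
  shows "\<exists>e>0. \<forall>x\<in>X. n (x - a) < e \<longrightarrow> x \<in> U"
proof -
  have U: "openin M.mtopology U" using assms(1) mtopology by simp
  then obtain e where "e > 0" "M.mball a e \<subseteq> U"
    using assms(2) unfolding M.openin_mtopology by blast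
  moreover have "a \<in> X" using U assms(2) unfolding M.openin_mtopology by blast
  ultimately show ?thesis by (intro exI[of _ e]) (auto simp: M.mball_def M.commute subset_iff)
qed

lemma convex_norm_ball: "convex {x \<in> X. n x < e}"
proof (rule convexI)
  fix x y and u v :: real
  assume *: "x \<in> {x \<in> X. n x < e}" "y \<in> {x \<in> X. n x < e}" "0 \<le> u" "0 \<le> v" "u + v = 1"
  have "n (u *\<^sub>R x + v *\<^sub>R y) \<le> u * n x + v * n y"
    using n_add_le[of "u *\<^sub>R x" "v *\<^sub>R y"] * by (simp add: n_scale scale_in)
  also have "\<dots> < e" using * by (intro convex_bound_lt) auto
  finally show "u *\<^sub>R x + v *\<^sub>R y \<in> {x \<in> X. n x < e}" using * by (auto intro: add_in scale_in)
qed

text \<open>Links limits in the ambient type, in which derivatives are phrased, with norm estimates.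
  The values of \<open>g\<close> must stay in \<open>X\<close>, as \<open>n\<close> measures
  distances only there.\<close>

lemma tendsto_iff_norm:
  assumes "\<forall>\<^sub>F t in F. g t \<in> X" "a \<in> X"
  shows "(g \<longlongrightarrow> a) F \<longleftrightarrow> ((\<lambda>t. n (g t - a)) \<longlongrightarrow> 0) F"
proof
  assume g: "(g \<longlongrightarrow> a) F"
  show "((\<lambda>t. n (g t - a)) \<longlongrightarrow> 0) F"
  proof (rule tendstoI)
    fix e :: real assume "e > 0"
    then have "\<forall>\<^sub>F t in F. g t \<in> {x \<in> X. n (x - a) < e}"
      using assms n_zero by (intro tendsto_eventually_in_openin[OF openin_norm_ball g]) auto
    then show "\<forall>\<^sub>F t in F. dist (n (g t - a)) 0 < e"
      by eventually_elim (simp add: n_nonneg)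
  qed
next
  assume g: "((\<lambda>t. n (g t - a)) \<longlongrightarrow> 0) F"
  show "(g \<longlongrightarrow> a) F"
  proof (rule topological_tendstoI)
    fix S assume "open S" "a \<in> S"
    then have "openin (top_of_set X) (X \<inter> S)" "a \<in> X \<inter> S" using assms by auto
    then obtain e where e: "e > 0" "\<forall>x\<in>X. n (x - a) < e \<longrightarrow> x \<in> X \<inter> S"
      using openin_contains_norm_ball by blast
    have "\<forall>\<^sub>F t in F. n (g t - a) < e" using order_tendstoD(2)[OF g e(1)] .
    with assms(1) show "\<forall>\<^sub>F t in F. g t \<in> S" by eventually_elim (use e in auto)
  qed
qed

text \<open>The convex set of \<open>mean_value_convex\<close> must be open, so the ball of radius
  \<open>c + e\<close> is used and \<open>e\<close> tends to 0.\<close>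

lemma norm_mean_value:
  assumes der: "\<And>s. 0 \<le> s \<Longrightarrow> s \<le> 1 \<Longrightarrow> curve_derivative (\<lambda>t. \<gamma> (s + t)) (\<gamma>' s)"
    and inX: "\<And>s. 0 \<le> s \<Longrightarrow> s \<le> 1 \<Longrightarrow> \<gamma> s \<in> X" "\<And>s. 0 \<le> s \<Longrightarrow> s \<le> 1 \<Longrightarrow> \<gamma>' s \<in> X"
    and bound: "\<And>s. 0 \<le> s \<Longrightarrow> s \<le> 1 \<Longrightarrow> n (\<gamma>' s) \<le> c"
  shows "n (\<gamma> 1 - \<gamma> 0) \<le> c"
proof (rule field_le_epsilon)
  fix e :: real assume "e > 0"
  have "\<gamma> 1 - \<gamma> 0 \<in> {x \<in> X. n x < c + e}"
  proof (rule mean_value_convex[OF X openin_norm_ball0 convex_norm_ball der _ inX(1)])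
    fix s :: real assume s: "0 \<le> s" "s \<le> 1"
    show "\<gamma>' s \<in> {x \<in> X. n x < c + e}" using bound[OF s] inX(2)[OF s] \<open>e > 0\<close> by simp
  qed
  then show "n (\<gamma> 1 - \<gamma> 0) \<le> c + e" by simp
qed

section \<open>The contraction argument and perturbations of the identity\<close>

text \<open>Fixed point iteration of x \<mapsto> y - E x from 0. The Lipschitz constant 1/2 bounds
  the iterates by a geometric series, which keeps them where \<open>E\<close> is controlled. It
  serves twice: for \<open>\<Phi>\<close> itself and for its derivatives at points near 0.\<close>

lemma contraction_perturbation_solution:
  assumes E: "\<And>x. x \<in> X \<Longrightarrow> n x \<le> r \<Longrightarrow> E x \<in> X" "E 0 = 0"
    and lip: "\<And>x x'. x \<in> X \<Longrightarrow> n x \<le> r \<Longrightarrow> x' \<in> X \<Longrightarrow> n x' \<le> r \<Longrightarrow> n (E x - E x') \<le> n (x - x') / 2"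
    and y: "y \<in> X" "2 * n y \<le> r"
  shows "\<exists>x\<in>X. n x \<le> 2 * n y \<and> x + E x = y"
proof -
  define s where "s k = ((\<lambda>x. y - E x) ^^ k) 0" for k
  have s0: "s 0 = 0" and sS: "s (Suc k) = y - E (s k)" for k by (simp_all add: s_def)
  have Elip: "n (E x) \<le> n x / 2" if "x \<in> X" "n x \<le> r" for x
    using lip[OF that zero_in] E(2) n_zero y n_nonneg[of y] by simp
  \<comment> \<open>The bound is the geometric sum n y + n y / 2 + ... with \<open>k\<close> terms,
    so one more application of \<open>lip\<close> reproduces it.\<close>
  have s: "s k \<in> X \<and> n (s k) \<le> 2 * n y * (1 - (1/2)^k)" for k
  proof (induction k)
    case (Suc k)
    have "2 * n y * (1 - (1/2)^k) \<le> 2 * n y * 1"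
      using n_nonneg[of y] by (intro mult_left_mono) auto
    then have r: "n (s k) \<le> r" using Suc y by simp
    have "n (s (Suc k)) \<le> n y + n (E (s k))"
      unfolding sS using Suc y r by (intro n_diff_le E) auto
    also have "\<dots> \<le> n y + n y * (1 - (1/2)^k)"
      using Elip[of "s k"] Suc r by simp
    finally show ?case using Suc y r by (auto simp: sS algebra_simps intro!: diff_in E)
  qed (simp add: s0 zero_in n_zero)
  have sr: "n (s k) \<le> 2 * n y" "n (s k) \<le> r" for k
  proof -
    have "2 * n y * (1 - (1/2)^k) \<le> 2 * n y * 1"
      using n_nonneg[of y] by (intro mult_left_mono) auto
    then show "n (s k) \<le> 2 * n y" "n (s k) \<le> r" using s[of k] y by auto
  qed
  have step: "n (s (Suc k) - s k) \<le> n y * (1/2)^k" for k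
  proof (induction k)
    case (Suc k)
    have "n (s (Suc (Suc k)) - s (Suc k)) = n (E (s k) - E (s (Suc k)))"
      unfolding sS by simp
    also have "\<dots> \<le> n (s (Suc k) - s k) / 2"
      using lip[of "s k" "s (Suc k)"] s sr by (simp add: n_minus_commute)
    also have "\<dots> \<le> n y * (1/2)^(Suc k)" using Suc by simp
    finally show ?case .
  qed (use E y in \<open>simp add: s0 sS\<close>)
  have diff: "n (s (k + m) - s k) \<le> 2 * n y * (1/2)^k * (1 - (1/2)^m)" for k m
  proof (induction m)
    case (Suc m)
    have "s (k + Suc m) - s k = (s (Suc (k + m)) - s (k + m)) + (s (k + m) - s k)" by simp
    then have "n (s (k + Suc m) - s k) \<le> n (s (Suc (k + m)) - s (k + m)) + n (s (k + m) - s k)"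
      using n_add_le s by (metis diff_in)
    also have "\<dots> \<le> n y * (1/2)^(k + m) + 2 * n y * (1/2)^k * (1 - (1/2)^m)"
      using step[of "k + m"] Suc by (intro add_mono) auto
    also have "\<dots> = 2 * n y * (1/2)^k * (1 - (1/2)^(Suc m))"
      by (simp add: power_add algebra_simps)
    finally show ?case .
  qed (simp add: n_zero)
  have bound: "n (s (k + m) - s k) \<le> 2 * n y * (1/2)^k" for k m
  proof -
    have "2 * n y * (1/2)^k * (1 - (1/2)^m) \<le> 2 * n y * (1/2)^k * 1"
      using n_nonneg[of y] by (intro mult_left_mono) auto
    then show ?thesis using diff[of k m] by simp
  qed
  have "M.MCauchy s"
    unfolding M.MCauchy_def
  proof (intro conjI allI impI)
    show "range s \<subseteq> X" using s by auto
    fix e :: real assume "e > 0"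
    have "(\<lambda>k. 4 * n y * (1/2)^k) \<longlonglongrightarrow> 4 * n y * 0"
      by (intro tendsto_mult tendsto_const LIMSEQ_power_zero) simp
    then have "\<forall>\<^sub>F k in sequentially. 4 * n y * (1/2)^k < e"
      using \<open>e > 0\<close> by (intro order_tendstoD(2)[where a = e]) auto
    then obtain N where N: "4 * n y * (1/2)^N < e" by (auto simp: eventually_sequentially)
    have "n (s k - s k') < e" if k: "N \<le> k" "N \<le> k'" for k k'
    proof -
      have "s k - s k' = (s k - s N) - (s k' - s N)" by simp
      then have "n (s k - s k') \<le> n (s k - s N) + n (s k' - s N)"
        using n_diff_le s by (metis diff_in)
      also have "\<dots> \<le> 2 * n y * (1/2)^N + 2 * n y * (1/2)^N"
        using bound[of N "k - N"] bound[of N "k' - N"] k by simp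
      finally show ?thesis using N by simp
    qed
    then show "\<exists>N. \<forall>k k'. N \<le> k \<longrightarrow> N \<le> k' \<longrightarrow> n (s k - s k') < e" by blast
  qed
  then obtain x where x: "limitin M.mtopology s x sequentially"
    using mcomplete unfolding M.mcomplete_def by blast
  then have xX: "x \<in> X" and "s \<longlonglongrightarrow> x"
    unfolding mtopology by (auto simp: limitin_subtopology)
  then have lim: "(\<lambda>k. n (s k - x)) \<longlonglongrightarrow> 0"
    using tendsto_iff_norm[of s sequentially x] s by simp
  have xle: "n x \<le> 2 * n y"
  proof (rule tendsto_lowerbound)
    show "(\<lambda>k. 2 * n y + n (s k - x)) \<longlonglongrightarrow> 2 * n y" using tendsto_add[OF tendsto_const lim] by simp
    have "n x \<le> 2 * n y + n (s k - x)" for k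
    proof -
      have "x = s k - (s k - x)" by simp
      then have "n x \<le> n (s k) + n (s k - x)" using n_diff_le s xX by (metis diff_in)
      then show ?thesis using sr(1)[of k] by simp
    qed
    then show "\<forall>\<^sub>F k in sequentially. n x \<le> 2 * n y + n (s k - x)" by simp
  qed simp
  then have xr: "n x \<le> r" using y by simp
  \<comment> \<open>The residual equals \<open>(E x - E (s k)) - (s (Suc k) - x)\<close>, so
    distances of consecutive iterates from their limit bound it.\<close>
  have "n (x + E x - y) \<le> 0"
  proof (rule tendsto_lowerbound)
    show "(\<lambda>k. n (s (Suc k) - x) + n (s k - x) / 2) \<longlonglongrightarrow> 0"
      using tendsto_add[OF LIMSEQ_Suc[OF lim] tendsto_divide[OF lim tendsto_const, of 2]] by simp
    have "n (x + E x - y) \<le> n (s (Suc k) - x) + n (s k - x) / 2" for k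
    proof -
      have eq: "x + E x - y = (E x - E (s k)) - (s (Suc k) - x)" by (simp add: sS)
      have "n (x + E x - y) \<le> n (E x - E (s k)) + n (s (Suc k) - x)"
        unfolding eq using s sr xX xr E by (intro n_diff_le diff_in) auto
      then show ?thesis using lip[of x "s k"] xX xr s sr by (simp add: n_minus_commute)
    qed
    then show "\<forall>\<^sub>F k in sequentially. n (x + E x - y) \<le> n (s (Suc k) - x) + n (s k - x) / 2" by simp
  qed simp
  then have "n (x + E x - y) = 0" using n_nonneg[of "x + E x - y"] by simp
  moreover have "x + E x - y \<in> X" using E xX xr y by (intro diff_in add_in) auto
  ultimately show ?thesis using n_eq_0 xX xle by auto
qed

text \<open>Joint continuity of the first derivative gives no bound uniform in \<open>v\<close>; the
  second derivative \<open>B\<close> does. Continuity at the origin bounds \<open>B\<close> on a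
  product of small balls, bilinearity turns this into
  \<open>n (B x a b) \<le> K * n a * n b\<close>, and the mean value theorem along the segment from
  0 to \<open>x\<close> integrates it to \<open>K * n v * n x\<close>.\<close>

lemma derivative_near_identity:
  assumes \<Phi>: "smooth_on X U X \<Phi>" and U: "0 \<in> U"
    and d0: "\<And>v. v \<in> X \<Longrightarrow> directional_derivative \<Phi> 0 v = v"
  shows "\<exists>r>0. \<forall>x\<in>X. n x < r \<longrightarrow> x \<in> U \<and> (\<forall>v\<in>X. n (directional_derivative \<Phi> x v - v) \<le> n v / 2)"
proof -
  define D where "D k = iterated_derivative k \<Phi>" for k
  note D\<Phi> = smooth_on_iterated_derivative[OF X \<Phi>, folded D_def]
  define B where "B x a b = D (Suc (Suc 0)) x ((\<lambda>_. 0)(0 := a, 1 := b))" for x a b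
  have v_in: "(\<lambda>_. 0)(0 := a, 1 := b) \<in> (UNIV :: nat set) \<rightarrow> X" "(\<lambda>_. 0)(i := a) \<in> (UNIV :: nat set) \<rightarrow> X"
    if "a \<in> X" "b \<in> X" for a b i
    using that zero_in by (auto simp: Pi_iff)
  have B_in: "B x a b \<in> X" if "x \<in> U" "a \<in> X" "b \<in> X" for x a b
    unfolding B_def by (rule smooth_family_in[OF D\<Phi> that(1) v_in(1)[OF that(2,3)]])
  have Bscale: "B x (c *\<^sub>R a) (d *\<^sub>R b) = c *\<^sub>R d *\<^sub>R B x a b"
    if "x \<in> U" "a \<in> X" "b \<in> X" for x a b c d
  proof -
    have 1: "B x a' (d *\<^sub>R b) = d *\<^sub>R B x a' b" if "a' \<in> X" for a'
      unfolding B_def D_def using \<open>x \<in> U\<close> \<open>b \<in> X\<close> that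
      by (intro iterated_derivative_multilinear(2)[OF X \<Phi> v_in(2)]) auto
    \<comment> \<open>The two updates commute; in this order slot 0 is the one exposed to
      multilinearity.\<close>
    have tw: "(\<lambda>_. 0)(0 := a, 1 := b) = ((\<lambda>_::nat. 0)(1 := b))(0 := a)" for a b :: 'a
      by (auto simp: fun_eq_iff)
    have 2: "B x (c *\<^sub>R a) b = c *\<^sub>R B x a b"
      unfolding B_def D_def tw using that
      by (intro iterated_derivative_multilinear(2)[OF X \<Phi> v_in(2)]) auto
    show ?thesis
      using 1[OF scale_in[OF that(2)], of c] 2 by (simp add: scaleR_left_commute)
  qed
  have contB: "continuous_on (U \<times> X \<times> X) (\<lambda>p. B (fst p) (fst (snd p)) (snd (snd p)))"
    unfolding B_def
  proof (rule continuous_on_family_compose[OF smooth_family_continuous[OF D\<Phi>]])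
    show "continuous_on (U \<times> X \<times> X) (\<lambda>p. ((\<lambda>_. 0)(0 := fst (snd p), 1 := snd (snd p))) i)" for i :: nat
      by (cases "i = 0"; cases "i = 1") (auto intro!: continuous_intros)
    show "(\<lambda>_::nat. 0)(0 := fst (snd p), 1 := snd (snd p)) \<in> UNIV \<rightarrow> X" if "p \<in> U \<times> X \<times> X" for p
      using that by (intro v_in(1)) auto
  qed (auto intro!: continuous_intros)
  have "openin (top_of_set X) {z \<in> X. n z < 1}" by (rule openin_norm_ball0)
  then obtain W where W: "open W" "{z \<in> X. n z < 1} = X \<inter> W" by (auto simp: openin_open)
  have "openin (top_of_set (U \<times> X \<times> X))
      ((U \<times> X \<times> X) \<inter> (\<lambda>p. B (fst p) (fst (snd p)) (snd (snd p))) -` W)"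
    by (rule continuous_openin_preimage_gen[OF contB W(1)])
  then obtain P where P: "open P"
    "(U \<times> X \<times> X) \<inter> (\<lambda>p. B (fst p) (fst (snd p)) (snd (snd p))) -` W = (U \<times> X \<times> X) \<inter> P"
    by (auto simp: openin_open)
  have "B 0 0 0 = 0" using Bscale[OF U zero_in zero_in, of 0 0] by simp
  moreover have "0 \<in> {z \<in> X. n z < 1}" using zero_in n_zero by simp
  then have "0 \<in> W" unfolding W(2) by simp
  ultimately have "(0, 0, 0) \<in> (U \<times> X \<times> X) \<inter> (\<lambda>p. B (fst p) (fst (snd p)) (snd (snd p))) -` W"
    using zero_in U by simp
  then have "(0, 0, 0) \<in> P" unfolding P(2) by simp
  then obtain A Q where AQ: "open A" "open Q" "0 \<in> A" "(0, 0) \<in> Q" "A \<times> Q \<subseteq> P"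
    using P(1) by (metis mem_Sigma_iff open_prod_elim)
  from open_prod_elim[OF AQ(2,4)] obtain A1 A2
    where A12: "open A1" "open A2" "(0, 0) \<in> A1 \<times> A2" "A1 \<times> A2 \<subseteq> Q" by blast
  have "openin (top_of_set X) (U \<inter> (A \<inter> A1 \<inter> A2))"
    using smooth_on_openin[OF \<Phi>] AQ A12 by (intro openin_Int_open) auto
  moreover have "0 \<in> U \<inter> (A \<inter> A1 \<inter> A2)" using U AQ A12 by auto
  ultimately obtain \<delta> where \<delta>: "\<delta> > 0" "\<forall>x\<in>X. n (x - 0) < \<delta> \<longrightarrow> x \<in> U \<inter> (A \<inter> A1 \<inter> A2)"
    using openin_contains_norm_ball by blast
  have B1: "n (B x a b) < 1" if "x \<in> X" "n x < \<delta>" "a \<in> X" "n a < \<delta>" "b \<in> X" "n b < \<delta>" for x a b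
  proof -
    have \<delta>': "x \<in> U" "x \<in> A" "a \<in> A1" "b \<in> A2"
      using \<delta>(2) that by auto
    then have "(a, b) \<in> Q" using A12(4) by blast
    then have "(x, a, b) \<in> P" using \<delta>' AQ(5) by blast
    then have "(x, a, b) \<in> (U \<times> X \<times> X) \<inter> P" using \<delta>' that by simp
    then have "B x a b \<in> W" unfolding P(2)[symmetric] by simp
    then have "B x a b \<in> X \<inter> W" using B_in[OF \<delta>'(1) that(3,5)] by simp
    then show ?thesis unfolding W(2)[symmetric] by simp
  qed
  \<comment> \<open>Rescaling \<open>a\<close> and \<open>b\<close> to norm \<delta>/2, where
    \<open>B\<close> has norm below 1, costs the factors \<open>2 * n a / \<delta>\<close> and
    \<open>2 * n b / \<delta>\<close>.\<close>
  define K where "K = 4 / \<delta>^2"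
  have K: "K > 0" using \<delta> by (simp add: K_def)
  have BK: "n (B x a b) \<le> K * n a * n b" if x: "x \<in> X" "n x < \<delta>" and ab: "a \<in> X" "b \<in> X" for x a b
  proof (cases "a = 0 \<or> b = 0")
    case True
    have xU: "x \<in> U" using \<delta> x by auto
    have "B x a b = 0"
      using True Bscale[OF xU zero_in ab(2), of 0 1] Bscale[OF xU ab(1) zero_in, of 1 0] by auto
    then show ?thesis using K by (simp add: n_zero n_nonneg)
  next
    case False
    have xU: "x \<in> U" using \<delta> x by auto
    have na: "n a > 0" "n b > 0" using False n_eq_0 ab n_nonneg by (metis less_le)+
    define a' b' where "a' = (\<delta> / (2 * n a)) *\<^sub>R a" and "b' = (\<delta> / (2 * n b)) *\<^sub>R b"
    have ab': "a' \<in> X" "b' \<in> X" "n a' < \<delta>" "n b' < \<delta>"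
      using ab na \<delta> by (auto simp: a'_def b'_def n_scale scale_in)
    have "B x a b = B x ((2 * n a / \<delta>) *\<^sub>R a') ((2 * n b / \<delta>) *\<^sub>R b')"
      using na \<delta> by (simp add: a'_def b'_def)
    also have "\<dots> = (2 * n a / \<delta>) *\<^sub>R (2 * n b / \<delta>) *\<^sub>R B x a' b'"
      by (rule Bscale[OF xU ab'(1,2)])
    finally have "n (B x a b) = (2 * n a / \<delta>) * ((2 * n b / \<delta>) * n (B x a' b'))"
      using B_in[OF xU ab'(1,2)] na \<delta> by (simp add: n_scale scale_in)
    also have "\<dots> \<le> (2 * n a / \<delta>) * ((2 * n b / \<delta>) * 1)"
      using B1[OF x ab'(1,3,2,4)] na \<delta> by (intro mult_left_mono) auto
    also have "\<dots> = K * n a * n b" by (simp add: K_def power2_eq_square)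
    finally show ?thesis .
  qed
  have near: "n (directional_derivative \<Phi> x v - v) \<le> K * n v * n x" if x: "x \<in> X" "n x < \<delta>" and v: "v \<in> X" for x v
  proof -
    define \<gamma> where "\<gamma> s = directional_derivative \<Phi> (s *\<^sub>R x) v" for s
    have sx: "s *\<^sub>R x \<in> X" "n (s *\<^sub>R x) < \<delta>" "s *\<^sub>R x \<in> U" if "0 \<le> s" "s \<le> 1" for s
    proof -
      show 1: "s *\<^sub>R x \<in> X" using x by (rule_tac scale_in)
      have "s * n x \<le> n x" using that n_nonneg[of x] by (simp add: mult_left_le_one_le)
      then show 2: "n (s *\<^sub>R x) < \<delta>" using x that by (simp add: n_scale)
      show "s *\<^sub>R x \<in> U" using \<delta>(2) 1 2 by auto
    qed
    have D1: "directional_derivative \<Phi> y v = D (Suc 0) y ((\<lambda>_. 0)(0 := v))" for y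
      by (simp add: D_def iterated_derivative.simps(2))
    have "n (\<gamma> 1 - \<gamma> 0) \<le> K * n v * n x"
    proof (rule norm_mean_value[where \<gamma>' = "\<lambda>s. B (s *\<^sub>R x) v x"])
      fix s :: real assume s: "0 \<le> s" "s \<le> 1"
      have "has_directional_derivative (\<lambda>y. D (Suc 0) y ((\<lambda>_. 0)(0 := v)))
          (D (Suc (Suc 0)) (s *\<^sub>R x) (((\<lambda>_. 0)(0 := v))(Suc 0 := x))) (s *\<^sub>R x) x"
        unfolding D_def by (rule smooth_derivative_along[OF X \<Phi> v_in(2)[OF v v] sx(3)[OF s] x(1)])
      then show "curve_derivative (\<lambda>t. \<gamma> (s + t)) (B (s *\<^sub>R x) v x)"
        by (simp add: has_directional_derivative_iff_curve \<gamma>_def B_def D1 scaleR_add_left)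
      show "\<gamma> s \<in> X" unfolding \<gamma>_def by (rule smooth_on_derivative_range[OF X \<Phi> sx(3)[OF s] v])
      show "B (s *\<^sub>R x) v x \<in> X" by (rule B_in[OF sx(3)[OF s] v x(1)])
      have "n (B (s *\<^sub>R x) v x) \<le> K * n v * n x" by (rule BK[OF sx(1,2)[OF s] v x(1)])
      then show "n (B (s *\<^sub>R x) v x) \<le> K * n v * n x" .
    qed
    then show ?thesis using d0[OF v] by (simp add: \<gamma>_def)
  qed
  \<comment> \<open>The second bound makes \<open>K * n x \<le> 1 / 2\<close>, which turns
    \<open>K * n v * n x\<close> into half of \<open>n v\<close>.\<close>
  define r where "r = min \<delta> (1 / (2 * K))"
  have "r > 0" using \<delta> K by (simp add: r_def)
  moreover have "x \<in> U \<and> (\<forall>v\<in>X. n (directional_derivative \<Phi> x v - v) \<le> n v / 2)"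
    if x: "x \<in> X" "n x < r" for x
  proof (intro conjI ballI)
    show "x \<in> U" using x \<delta> by (auto simp: r_def)
    fix v assume v: "v \<in> X"
    have "K * n x \<le> 1 / 2" using x K by (simp add: r_def field_simps)
    then have "n v * (K * n x) \<le> n v * (1/2)" using n_nonneg by (rule mult_left_mono)
    then show "n (directional_derivative \<Phi> x v - v) \<le> n v / 2"
      using near[OF x(1) _ v] x by (simp add: r_def mult.commute mult.left_commute)
  qed
  ultimately show ?thesis by blast
qed

text \<open>Balls are convex, so the segment from \<open>y\<close> to \<open>x\<close> stays where
  \<open>near\<close> bounds the derivative of \<Phi> - id, and the mean value theorem applies along
  it.\<close>

lemma perturbation_lipschitz:
  assumes \<Phi>: "smooth_on X U X \<Phi>"
    and near: "\<And>x v. x \<in> X \<Longrightarrow> n x < r \<Longrightarrow> v \<in> X \<Longrightarrow> x \<in> U \<and> n (directional_derivative \<Phi> x v - v) \<le> n v / 2"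
    and x: "x \<in> X" "n x < r" and y: "y \<in> X" "n y < r"
  shows "n ((\<Phi> x - x) - (\<Phi> y - y)) \<le> n (x - y) / 2"
proof -
  let ?z = "\<lambda>s. y + s *\<^sub>R (x - y)"
  define \<gamma> where "\<gamma> s = \<Phi> (?z s) - ?z s" for s
  have xy: "x - y \<in> X" using x y by (intro diff_in)
  have z: "?z s \<in> X" "n (?z s) < r" "?z s \<in> U" if "0 \<le> s" "s \<le> 1" for s
  proof -
    have "(1 - s) *\<^sub>R y + s *\<^sub>R x \<in> {x \<in> X. n x < r}"
      using that x y by (intro convexD[OF convex_norm_ball]) auto
    moreover have "(1 - s) *\<^sub>R y + s *\<^sub>R x = ?z s" by (simp add: algebra_simps)
    ultimately show 1: "?z s \<in> X" and 2: "n (?z s) < r" by auto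
    show "?z s \<in> U" using near[OF 1 2 zero_in] by simp
  qed
  have "n (\<gamma> 1 - \<gamma> 0) \<le> n (x - y) / 2"
  proof (rule norm_mean_value[where \<gamma>' = "\<lambda>s. directional_derivative \<Phi> (?z s) (x - y) - (x - y)"])
    fix s :: real assume s: "0 \<le> s" "s \<le> 1"
    have "curve_derivative (\<lambda>t. \<Phi> (?z s + t *\<^sub>R (x - y))) (directional_derivative \<Phi> (?z s) (x - y))"
      using smooth_on_has_directional_derivative[OF X \<Phi> z(3)[OF s] xy]
      by (simp add: has_directional_derivative_iff_curve)
    from curve_derivative_add[OF this curve_derivative_line[of "- ?z s" "- (x - y)"]]
    show "curve_derivative (\<lambda>t. \<gamma> (s + t)) (directional_derivative \<Phi> (?z s) (x - y) - (x - y))"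
      by (simp add: \<gamma>_def algebra_simps)
    show "\<gamma> s \<in> X" unfolding \<gamma>_def using z[OF s] smooth_on_range[OF \<Phi> z(3)[OF s]] by (intro diff_in)
    show "directional_derivative \<Phi> (?z s) (x - y) - (x - y) \<in> X"
      by (intro diff_in[OF _ xy] smooth_on_derivative_range[OF X \<Phi> z(3)[OF s] xy])
    show "n (directional_derivative \<Phi> (?z s) (x - y) - (x - y)) \<le> n (x - y) / 2"
      using near[OF z(1,2)[OF s] xy] by simp
  qed
  then show ?thesis by (simp add: \<gamma>_def)
qed

end

section \<open>Smoothness of the local inverse\<close>

text \<open>\<open>near\<close> and \<open>expansive\<close> say quantitatively that
  \<open>\<Phi>\<close> perturbs the identity; \<open>expansive\<close> also makes the right inverse
  \<open>G\<close> unique and Lipschitz. In the application \<open>U\<close> is a small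
  ball.\<close>

locale local_inverse = banach_subspace X n
  for X :: "'a::locally_convex set" and n +
  fixes U V :: "'a set" and \<Phi> G :: "'a \<Rightarrow> 'a"
  assumes \<Phi>: "smooth_on X U X \<Phi>"
    and near: "x \<in> U \<Longrightarrow> v \<in> X \<Longrightarrow> n (directional_derivative \<Phi> x v - v) \<le> n v / 2"
    and expansive: "x \<in> U \<Longrightarrow> x' \<in> U \<Longrightarrow> n (x - x') \<le> 2 * n (\<Phi> x - \<Phi> x')"
    and V: "openin (top_of_set X) V"
    and G_in: "y \<in> V \<Longrightarrow> G y \<in> U"
    and \<Phi>_G: "y \<in> V \<Longrightarrow> \<Phi> (G y) = y"
begin

abbreviation L where "L \<equiv> directional_derivative \<Phi>"
abbreviation D where "D k \<equiv> iterated_derivative k \<Phi>"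

text \<open>The inverse of the derivative, in evaluated form: as a function of point and vector its
  joint continuity makes sense with no topology on operators.\<close>

definition A where "A x w = (THE a. a \<in> X \<and> L x a = w)"

lemma U_X: "x \<in> U \<Longrightarrow> x \<in> X" using smooth_on_subset_model[OF \<Phi>] by auto
lemma V_X: "x \<in> V \<Longrightarrow> x \<in> X" using openin_imp_subset[OF V] by auto

lemma L_in: "x \<in> U \<Longrightarrow> v \<in> X \<Longrightarrow> L x v \<in> X"
  by (rule smooth_on_derivative_range[OF X \<Phi>])

lemma L_scale: "x \<in> U \<Longrightarrow> v \<in> X \<Longrightarrow> L x (c *\<^sub>R v) = c *\<^sub>R L x v"
  using smooth_on_derivative_linear[OF X \<Phi>, of x] by (simp add: linear_on_def)

lemma L_add: "x \<in> U \<Longrightarrow> v \<in> X \<Longrightarrow> w \<in> X \<Longrightarrow> L x (v + w) = L x v + L x w"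
  using smooth_on_derivative_linear[OF X \<Phi>, of x] by (simp add: linear_on_def)

lemma L_diff: "x \<in> U \<Longrightarrow> v \<in> X \<Longrightarrow> w \<in> X \<Longrightarrow> L x (v - w) = L x v - L x w"
  using L_add[of x "v - w" w] by (simp add: diff_in)

lemma L_0: "x \<in> U \<Longrightarrow> L x 0 = 0"
  using L_scale[of x 0 0] zero_in by simp

lemma L_lower: "n v \<le> 2 * n (L x v)" if "x \<in> U" "v \<in> X"
proof -
  have "v = L x v - (L x v - v)" by simp
  then have "n v \<le> n (L x v) + n (L x v - v)"
    using n_diff_le L_in[OF that] that by (metis diff_in)
  then show ?thesis using near[OF that] by simp
qed

text \<open>Existence is the perturbation equation with E = L x - id; since \<open>near\<close>
  holds for all vectors, the radius can be adapted to \<open>w\<close>. Uniqueness comes from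
  \<open>L_lower\<close>.\<close>

lemma L_bij: "\<exists>!a. a \<in> X \<and> L x a = w" if x: "x \<in> U" and w: "w \<in> X"
proof -
  have "\<exists>a\<in>X. n a \<le> 2 * n w \<and> a + (L x a - a) = w"
  proof (rule contraction_perturbation_solution[where r = "2 * n w"])
    fix a b assume ab: "a \<in> X" "b \<in> X"
    have eq: "L x a - a - (L x b - b) = L x (a - b) - (a - b)" using L_diff[OF x ab] by simp
    show "n (L x a - a - (L x b - b)) \<le> n (a - b) / 2"
      unfolding eq by (rule near[OF x diff_in[OF ab]])
  qed (use x w in \<open>auto simp: L_0 intro: diff_in L_in\<close>)
  then obtain a where a: "a \<in> X" "L x a = w" by auto
  moreover have "b = a" if b: "b \<in> X" "L x b = w" for b
  proof -
    have "n (b - a) \<le> 0" using L_lower[OF x diff_in[OF b(1) a(1)]] L_diff[OF x b(1) a(1)] a b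
      by (simp add: n_zero)
    then show ?thesis using n_eq_0[OF diff_in[OF b(1) a(1)]] n_nonneg[of "b - a"] by simp
  qed
  ultimately show ?thesis by blast
qed

lemma A_in: "x \<in> U \<Longrightarrow> w \<in> X \<Longrightarrow> A x w \<in> X"
  and L_A: "x \<in> U \<Longrightarrow> w \<in> X \<Longrightarrow> L x (A x w) = w"
  using theI'[OF L_bij] by (simp_all add: A_def)

lemma A_L: "x \<in> U \<Longrightarrow> a \<in> X \<Longrightarrow> A x (L x a) = a"
  using L_bij[of x "L x a"] A_in L_A L_in by blast

lemma continuous_L: "continuous_on (U \<times> X) (\<lambda>(x, a). L x a)"
proof -
  have "continuous_on (U \<times> X) (\<lambda>p. D (Suc 0) (fst p) (\<lambda>_. snd p))"
    by (rule continuous_on_family_compose[OF smooth_family_continuous[OF smooth_on_iterated_derivative[OF X \<Phi>]]])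
      (auto intro!: continuous_intros)
  then show ?thesis by (simp add: directional_derivative_eq_iterated case_prod_unfold)
qed

lemma L_tendsto:
  assumes "(x \<longlongrightarrow> x0) F" "(w \<longlongrightarrow> w0) F" "x0 \<in> U" "w0 \<in> X" "\<forall>\<^sub>F t in F. x t \<in> U \<and> w t \<in> X"
  shows "((\<lambda>t. L (x t) (w t)) \<longlongrightarrow> L x0 w0) F"
  using continuous_on_tendsto_compose[OF continuous_L tendsto_Pair[OF assms(1,2)]] assms(3-5) by simp

text \<open>Comparison with the fixed vector a = A x0 w0: by \<open>L_lower\<close> the error is at
  most \<open>2 * n (w t - L (x t) a)\<close>, which tends to 0 by continuity of \<open>L\<close>,
  as \<open>L x0 a = w0\<close>.\<close>

lemma A_tendsto:
  assumes x: "(x \<longlongrightarrow> x0) F" and w: "(w \<longlongrightarrow> w0) F" and in0: "x0 \<in> U" "w0 \<in> X"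
    and ev: "\<forall>\<^sub>F t in F. x t \<in> U \<and> w t \<in> X"
  shows "((\<lambda>t. A (x t) (w t)) \<longlongrightarrow> A x0 w0) F"
proof -
  let ?a = "A x0 w0"
  have a: "?a \<in> X" using A_in in0 by auto
  have "((\<lambda>t. L (x t) ?a) \<longlongrightarrow> L x0 ?a) F"
    by (rule L_tendsto[OF x tendsto_const in0(1) a]) (use ev a in \<open>auto elim: eventually_mono\<close>)
  then have "((\<lambda>t. w t - L (x t) ?a) \<longlongrightarrow> w0 - w0) F"
    using L_A in0 by (intro tendsto_diff w) simp
  then have "((\<lambda>t. w t - L (x t) ?a) \<longlongrightarrow> 0) F" by simp
  moreover have "\<forall>\<^sub>F t in F. w t - L (x t) ?a \<in> X"
    using ev by eventually_elim (use a in \<open>auto intro: diff_in L_in\<close>)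
  ultimately have "((\<lambda>t. n (w t - L (x t) ?a)) \<longlongrightarrow> 0) F"
    using tendsto_iff_norm[of "\<lambda>t. w t - L (x t) ?a" F 0] zero_in by simp
  then have lim: "((\<lambda>t. 2 * n (w t - L (x t) ?a)) \<longlongrightarrow> 0) F"
    using tendsto_mult[OF tendsto_const] by fastforce
  have "((\<lambda>t. n (A (x t) (w t) - ?a)) \<longlongrightarrow> 0) F"
  proof (rule tendsto_sandwich[OF _ _ tendsto_const lim])
    show "\<forall>\<^sub>F t in F. n (A (x t) (w t) - ?a) \<le> 2 * n (w t - L (x t) ?a)"
      using ev
    proof eventually_elim
      case (elim t)
      then have "A (x t) (w t) \<in> X" by (auto intro: A_in)
      then show ?case using L_lower[of "x t" "A (x t) (w t) - ?a"] L_diff[of "x t" "A (x t) (w t)" ?a] elim a L_A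
        by (simp add: diff_in)
    qed
  qed (simp add: n_nonneg)
  moreover have "\<forall>\<^sub>F t in F. A (x t) (w t) \<in> X" using ev by eventually_elim (auto intro: A_in)
  ultimately show ?thesis using tendsto_iff_norm[OF _ a, of "\<lambda>t. A (x t) (w t)"] by simp
qed

lemma G_lipschitz: "y \<in> V \<Longrightarrow> y' \<in> V \<Longrightarrow> n (G y - G y') \<le> 2 * n (y - y')"
  using expansive[OF G_in G_in, of y y'] \<Phi>_G by simp

lemma G_tendsto:
  assumes "(y \<longlongrightarrow> y0) F" "y0 \<in> V" "\<forall>\<^sub>F t in F. y t \<in> V"
  shows "((\<lambda>t. G (y t)) \<longlongrightarrow> G y0) F"
proof -
  have "\<forall>\<^sub>F t in F. y t \<in> X" using assms(3) by eventually_elim (rule V_X)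
  then have "((\<lambda>t. n (y t - y0)) \<longlongrightarrow> 0) F"
    using tendsto_iff_norm[OF _ V_X[OF assms(2)], of y] assms by simp
  then have lim: "((\<lambda>t. 2 * n (y t - y0)) \<longlongrightarrow> 0) F"
    using tendsto_mult[OF tendsto_const] by fastforce
  have "((\<lambda>t. n (G (y t) - G y0)) \<longlongrightarrow> 0) F"
    by (rule tendsto_sandwich[OF _ _ tendsto_const lim])
      (use assms(3) in \<open>auto simp: n_nonneg elim!: eventually_mono intro: G_lipschitz assms(2)\<close>)
  moreover have "\<forall>\<^sub>F t in F. G (y t) \<in> X" using assms(3) by eventually_elim (intro U_X G_in)
  ultimately show ?thesis
    using tendsto_iff_norm[OF _ U_X[OF G_in[OF assms(2)]], of "\<lambda>t. G (y t)"] by simp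
qed

text \<open>By \<open>expansive\<close>, the distance of G (y + tv) from the guess G y + ta, with a
  = A (G y) v, is at most twice that of their images. These agree to first order, because
  \<open>\<Phi>\<close> has derivative \<open>v\<close> along \<open>a\<close>.\<close>

lemma G_derivative:
  assumes y: "y \<in> V" and v: "v \<in> X"
  shows "curve_derivative (\<lambda>t. G (y + t *\<^sub>R v)) (A (G y) v)"
proof -
  let ?x = "G y" and ?a = "A (G y) v"
  have x: "?x \<in> U" and a: "?a \<in> X" using y v by (auto intro: G_in A_in)
  let ?q = "\<lambda>t. (G (y + t *\<^sub>R v) - ?x) /\<^sub>R t"
  let ?p = "\<lambda>t. (\<Phi> (?x + t *\<^sub>R ?a) - \<Phi> ?x) /\<^sub>R t"
  have p: "(?p \<longlongrightarrow> v) (at 0)"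
    using smooth_on_has_directional_derivative[OF X \<Phi> x a] L_A[OF x v]
    by (simp add: has_directional_derivative_def)
  have ev: "\<forall>\<^sub>F t in at 0. ?x + t *\<^sub>R ?a \<in> U \<and> y + t *\<^sub>R v \<in> V \<and> t \<noteq> 0"
    using line_eventually_in[OF X smooth_on_openin[OF \<Phi>] x a] line_eventually_in[OF X V y v]
    by (intro eventually_conj) (auto simp: eventually_at_filter)
  have pX: "\<forall>\<^sub>F t in at 0. ?p t \<in> X"
    using ev by eventually_elim (intro scale_in diff_in smooth_on_range[OF \<Phi>] x, auto)
  have lim: "((\<lambda>t. 2 * n (?p t - v)) \<longlongrightarrow> 0) (at 0)"
    using p tendsto_mult[OF tendsto_const] unfolding tendsto_iff_norm[OF pX v] by fastforce
  have "((\<lambda>t. n (?q t - ?a)) \<longlongrightarrow> 0) (at 0)"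
  proof (rule tendsto_sandwich[OF _ _ tendsto_const lim])
    show "\<forall>\<^sub>F t in at 0. n (?q t - ?a) \<le> 2 * n (?p t - v)"
      using ev
    proof eventually_elim
      case (elim t)
      let ?z = "?x + t *\<^sub>R ?a"
      have G: "G (y + t *\<^sub>R v) \<in> U" "G (y + t *\<^sub>R v) \<in> X" "?z \<in> X" using elim G_in U_X by auto
      have \<Phi>X: "\<Phi> ?z \<in> X" "\<Phi> ?x \<in> X" using elim x smooth_on_range[OF \<Phi>] by auto
      have "?q t - ?a = (G (y + t *\<^sub>R v) - ?z) /\<^sub>R t"
        using elim by (simp add: algebra_simps)
      then have "n (?q t - ?a) = n (G (y + t *\<^sub>R v) - ?z) / \<bar>t\<bar>"
        using n_scale[of "G (y + t *\<^sub>R v) - ?z"] G by (simp add: diff_in divide_inverse)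
      also have "\<dots> \<le> (2 * n (\<Phi> (G (y + t *\<^sub>R v)) - \<Phi> ?z)) / \<bar>t\<bar>"
        using expansive[OF G(1)] elim by (intro divide_right_mono) auto
      also have "\<dots> = 2 * (n (\<Phi> ?z - (\<Phi> ?x + t *\<^sub>R v)) / \<bar>t\<bar>)"
        using elim \<Phi>_G y by (simp add: n_minus_commute)
      also have "n (\<Phi> ?z - (\<Phi> ?x + t *\<^sub>R v)) / \<bar>t\<bar> = n ((\<Phi> ?z - (\<Phi> ?x + t *\<^sub>R v)) /\<^sub>R t)"
        using n_scale[of "\<Phi> ?z - (\<Phi> ?x + t *\<^sub>R v)"] \<Phi>X v
        by (simp add: diff_in add_in scale_in divide_inverse)
      also have "(\<Phi> ?z - (\<Phi> ?x + t *\<^sub>R v)) /\<^sub>R t = ?p t - v"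
        using elim by (simp add: algebra_simps)
      finally show ?case .
    qed
  qed (simp add: n_nonneg)
  moreover have "\<forall>\<^sub>F t in at 0. ?q t \<in> X"
    using ev by eventually_elim (intro scale_in diff_in U_X G_in y, auto)
  ultimately show ?thesis using tendsto_iff_norm[OF _ a, of ?q] by (simp add: curve_derivative_def)
qed

text \<open>Dictated by closure under differentiation: the derivative of \<open>G\<close> is
  \<open>A\<close> applied to a direction, differentiating \<open>A\<close> produces a difference
  with a second derivative of \<open>\<Phi>\<close>, and differentiating \<open>D k\<close> produces
  sums with all arguments again terms.\<close>

inductive_set inverse_terms :: "('a \<Rightarrow> (nat \<Rightarrow> 'a) \<Rightarrow> 'a) set" where
  zero: "(\<lambda>y v. 0) \<in> inverse_terms"
| add: "h \<in> inverse_terms \<Longrightarrow> h' \<in> inverse_terms \<Longrightarrow> (\<lambda>y v. h y v + h' y v) \<in> inverse_terms"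
| diff: "h \<in> inverse_terms \<Longrightarrow> h' \<in> inverse_terms \<Longrightarrow> (\<lambda>y v. h y v - h' y v) \<in> inverse_terms"
| proj: "(\<lambda>y v. v i) \<in> inverse_terms"
| base: "(\<lambda>y v. G y) \<in> inverse_terms"
| inv: "h \<in> inverse_terms \<Longrightarrow> (\<lambda>y v. A (G y) (h y v)) \<in> inverse_terms"
| deriv: "(\<And>i. w i \<in> inverse_terms) \<Longrightarrow> (\<lambda>y v. D k (G y) (\<lambda>i. w i y v)) \<in> inverse_terms"

lemma inverse_terms_sum:
  assumes "\<And>i. i < (k::nat) \<Longrightarrow> h i \<in> inverse_terms"
  shows "(\<lambda>y v. \<Sum>i<k. h i y v) \<in> inverse_terms"
  using assms
proof (induction k)
  case (Suc k)
  then show ?case using inverse_terms.add[of "\<lambda>y v. \<Sum>i<k. h i y v" "h k"] by simp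
qed (simp add: inverse_terms.zero)

lemma inverse_terms_in:
  assumes "h \<in> inverse_terms" "y \<in> V" "v \<in> UNIV \<rightarrow> X" shows "h y v \<in> X"
  using assms
proof induction
  case (deriv w k)
  then show ?case
    by (intro smooth_family_in[OF smooth_on_iterated_derivative[OF X \<Phi>]] G_in Pi_I) auto
qed (auto intro: zero_in add_in diff_in A_in G_in U_X)

lemma inverse_terms_tendsto:
  assumes "h \<in> inverse_terms" and p0: "p0 \<in> V \<times> (UNIV \<rightarrow> X)"
  shows "((\<lambda>p. h (fst p) (snd p)) \<longlongrightarrow> h (fst p0) (snd p0)) (at p0 within V \<times> (UNIV \<rightarrow> X))"
  using assms(1)
proof induction
  have ev: "\<forall>\<^sub>F p in at p0 within V \<times> (UNIV \<rightarrow> X). fst p \<in> V \<and> snd p \<in> UNIV \<rightarrow> X"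
    unfolding eventually_at_filter by (rule always_eventually) (simp add: mem_Times_iff)
  have p0': "fst p0 \<in> V" "snd p0 \<in> UNIV \<rightarrow> X" using p0 by (simp_all add: mem_Times_iff)
  {
    case (proj i)
    show ?case
      using continuous_on_snd_apply[of "V \<times> (UNIV \<rightarrow> X)" i] p0 unfolding continuous_on_def by blast
  next
    case base
    show ?case
      by (rule G_tendsto[OF _ p0'(1)]) (use ev in \<open>auto intro: tendsto_intros elim: eventually_mono\<close>)
  next
    case (inv h)
    have "((\<lambda>p. G (fst p)) \<longlongrightarrow> G (fst p0)) (at p0 within V \<times> (UNIV \<rightarrow> X))"
      by (rule G_tendsto[OF _ p0'(1)]) (use ev in \<open>auto intro: tendsto_intros elim: eventually_mono\<close>)
    then show ?case
      by (rule A_tendsto[OF _ inv.IH G_in[OF p0'(1)] inverse_terms_in[OF inv.hyps p0']])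
        (use ev in \<open>eventually_elim, auto intro!: G_in inverse_terms_in[OF inv.hyps]\<close>)
  next
    case (deriv w k)
    have "((\<lambda>p. G (fst p)) \<longlongrightarrow> G (fst p0)) (at p0 within V \<times> (UNIV \<rightarrow> X))"
      by (rule G_tendsto[OF _ p0'(1)]) (use ev in \<open>auto intro: tendsto_intros elim: eventually_mono\<close>)
    then show ?case
      by (rule continuous_on_family_tendsto[OF smooth_family_continuous[OF smooth_on_iterated_derivative[OF X \<Phi>]]
            _ deriv.IH G_in[OF p0'(1)]])
        (use inverse_terms_in[OF deriv.hyps] p0' in simp, use ev in \<open>eventually_elim,
          auto intro!: G_in inverse_terms_in[OF deriv.hyps]\<close>)
  }
qed (auto intro: tendsto_intros)

lemma inverse_terms_derivative:
  assumes "h \<in> inverse_terms"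
  shows "\<exists>h'\<in>inverse_terms. \<forall>y\<in>V. \<forall>v\<in>UNIV \<rightarrow> X.
    curve_derivative (\<lambda>t. h (y + t *\<^sub>R v k) v) (h' y v)"
  using assms
proof induction
  case zero
  show ?case by (intro bexI[OF _ inverse_terms.zero]) (simp add: curve_derivative_const)
next
  case (add h h')
  then obtain d d' where d: "d \<in> inverse_terms" "d' \<in> inverse_terms"
    "\<forall>y\<in>V. \<forall>v\<in>UNIV \<rightarrow> X. curve_derivative (\<lambda>t. h (y + t *\<^sub>R v k) v) (d y v)"
    "\<forall>y\<in>V. \<forall>v\<in>UNIV \<rightarrow> X. curve_derivative (\<lambda>t. h' (y + t *\<^sub>R v k) v) (d' y v)" by (elim bexE)
  then show ?case
    by (intro bexI[OF _ inverse_terms.add[OF d(1,2)]] ballI curve_derivative_add) simp_all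
next
  case (diff h h')
  then obtain d d' where d: "d \<in> inverse_terms" "d' \<in> inverse_terms"
    "\<forall>y\<in>V. \<forall>v\<in>UNIV \<rightarrow> X. curve_derivative (\<lambda>t. h (y + t *\<^sub>R v k) v) (d y v)"
    "\<forall>y\<in>V. \<forall>v\<in>UNIV \<rightarrow> X. curve_derivative (\<lambda>t. h' (y + t *\<^sub>R v k) v) (d' y v)" by (elim bexE)
  then show ?case
    by (intro bexI[OF _ inverse_terms.diff[OF d(1,2)]] ballI curve_derivative_diff) simp_all
next
  case (proj i)
  show ?case by (intro bexI[OF _ inverse_terms.zero]) (simp add: curve_derivative_const)
next
  case base
  have "curve_derivative (\<lambda>t. G (y + t *\<^sub>R v k)) (A (G y) (v k))" if "y \<in> V" "v \<in> UNIV \<rightarrow> X" for y v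
    using that by (intro G_derivative) auto
  then show ?case by (intro bexI[OF _ inverse_terms.inv[OF inverse_terms.proj[of k]]]) simp
next
  case (inv h)
  then obtain d where d: "d \<in> inverse_terms"
    "\<forall>y\<in>V. \<forall>v\<in>UNIV \<rightarrow> X. curve_derivative (\<lambda>t. h (y + t *\<^sub>R v k) v) (d y v)" by (elim bexE)
  \<comment> \<open>Slot 0 is the inverted vector and slot 1 the velocity of \<open>G\<close>. With
    these arguments \<open>e\<close> is the rule for an inverse operator: invert h' minus the
    derivative of \<open>L\<close> applied to the inverted vector.\<close>
  define w :: "nat \<Rightarrow> 'a \<Rightarrow> (nat \<Rightarrow> 'a) \<Rightarrow> 'a"
    where "w i y v = (if i = 0 then A (G y) (h y v) else A (G y) (v k))" for i y v
  define e where "e y v = A (G y) (d y v - D 2 (G y) (\<lambda>i. w i y v))" for y v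
  have w: "w i \<in> inverse_terms" for i
  proof (cases "i = 0")
    case True
    then have "w i = (\<lambda>y v. A (G y) (h y v))" by (simp add: w_def fun_eq_iff)
    then show ?thesis using inverse_terms.inv[OF inv.hyps] by simp
  next
    case False
    then have "w i = (\<lambda>y v. A (G y) (v k))" by (simp add: w_def fun_eq_iff)
    then show ?thesis using inverse_terms.inv[OF inverse_terms.proj] by simp
  qed
  have "e \<in> inverse_terms"
    unfolding e_def by (intro inverse_terms.inv inverse_terms.diff d(1) inverse_terms.deriv w)
  moreover have "curve_derivative (\<lambda>t. A (G (y + t *\<^sub>R v k)) (h (y + t *\<^sub>R v k) v)) (e y v)"
    if y: "y \<in> V" and v: "v \<in> UNIV \<rightarrow> X" for y v
  proof -
    have vk: "v k \<in> X" using v by auto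
    let ?y = "\<lambda>t. y + t *\<^sub>R v k"
    let ?a = "A (G y) (h y v)"
    have x: "G y \<in> U" by (rule G_in[OF y])
    have a: "?a \<in> X" using inverse_terms_in[OF inv.hyps y v] by (intro A_in x)
    have ev: "\<forall>\<^sub>F t in at 0. ?y t \<in> V" by (rule line_eventually_in[OF X V y vk])
    have h: "curve_derivative (\<lambda>t. h (?y t) v) (d y v)" using d y v by blast
    have ev': "\<forall>\<^sub>F t in at 0. G (?y t) \<in> U \<and> (\<lambda>_::nat. ?a) \<in> UNIV \<rightarrow> X"
      using ev by eventually_elim (use a G_in in auto)
    \<comment> \<open>The vector \<open>?a\<close> is frozen, so only the moving base point
      contributes; the remaining summand has a zero direction and vanishes.\<close>
    have "curve_derivative (\<lambda>t. D (Suc 0) (G (?y t)) (\<lambda>_. ?a))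
        (D (Suc (Suc 0)) (G (?y 0)) ((\<lambda>_. ?a)(Suc 0 := A (G y) (v k))) +
         (\<Sum>i<Suc 0. D (Suc 0) (G (?y 0)) ((\<lambda>_. ?a)(i := 0))))"
      by (rule curve_derivative_iterated[OF X \<Phi> G_derivative[OF y vk] _ A_in[OF x vk]
            curve_derivative_const _ _ ev'])
        (use x a zero_in in auto)
    moreover have "D (Suc 0) (G y) ((\<lambda>_. ?a)(0 := 0)) = 0"
      using L_0[OF x] by (simp add: iterated_derivative.simps(2))
    moreover have "D (Suc (Suc 0)) (G y) ((\<lambda>_. ?a)(Suc 0 := A (G y) (v k))) = D 2 (G y) (\<lambda>i. w i y v)"
      unfolding numeral_2_eq_2 by (rule iterated_derivative_dirs_cong) (auto simp: w_def less_Suc_eq)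
    ultimately have "curve_derivative (\<lambda>t. L (G (?y t)) ?a) (D 2 (G y) (\<lambda>i. w i y v))"
      by (simp add: directional_derivative_eq_iterated)
    from curve_derivative_diff[OF h this]
    have "((\<lambda>t. (h (?y t) v - L (G (?y t)) ?a) /\<^sub>R t) \<longlongrightarrow> d y v - D 2 (G y) (\<lambda>i. w i y v)) (at 0)"
      using L_A[OF x inverse_terms_in[OF inv.hyps y v]] by (simp add: curve_derivative_def)
    then have "((\<lambda>t. A (G (?y t)) ((h (?y t) v - L (G (?y t)) ?a) /\<^sub>R t)) \<longlongrightarrow> e y v) (at 0)"
      unfolding e_def
    proof (rule A_tendsto[rotated])
      show "((\<lambda>t. G (?y t)) \<longlongrightarrow> G y) (at 0)"
        by (rule G_tendsto[OF line_tendsto y ev])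
      show "d y v - D 2 (G y) (\<lambda>i. w i y v) \<in> X"
        using inverse_terms_in[OF inverse_terms.diff[OF d(1) inverse_terms.deriv[OF w]] y v] .
      show "\<forall>\<^sub>F t in at 0. G (?y t) \<in> U \<and> (h (?y t) v - L (G (?y t)) ?a) /\<^sub>R t \<in> X"
        using ev by eventually_elim
          (intro conjI G_in scale_in diff_in inverse_terms_in[OF inv.hyps _ v] L_in a)
    qed (rule x)
    \<comment> \<open>\<open>A\<close> is linear in its second argument and inverts
      \<open>L\<close>, so the quotient sought is \<open>A\<close> of the quotient just treated.
      Continuity of \<open>A\<close> then suffices for the limit.\<close>
    moreover have "\<forall>\<^sub>F t in at 0. A (G (?y t)) ((h (?y t) v - L (G (?y t)) ?a) /\<^sub>R t) =
        (A (G (?y t)) (h (?y t) v) - ?a) /\<^sub>R t"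
      using ev
    proof eventually_elim
      case (elim t)
      let ?b = "A (G (?y t)) (h (?y t) v)"
      have h: "h (?y t) v \<in> X" using inverse_terms_in[OF inv.hyps elim v] .
      have x: "G (?y t) \<in> U" using G_in elim .
      have b: "?b \<in> X" using A_in h x by blast
      have "L (G (?y t)) ((?b - ?a) /\<^sub>R t) = (h (?y t) v - L (G (?y t)) ?a) /\<^sub>R t"
        using x a b h by (simp add: L_scale L_diff L_A diff_in)
      then show ?case using A_L[OF x scale_in[OF diff_in[OF b a]], of "inverse t"] by simp
    qed
    ultimately show ?thesis
      unfolding curve_derivative_def using Lim_transform_eventually by fastforce
  qed
  ultimately show ?case by blast
next
  case (deriv w j)
  then have "\<forall>i. \<exists>d. d \<in> inverse_terms \<and> (\<forall>y\<in>V. \<forall>v\<in>UNIV \<rightarrow> X.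
      curve_derivative (\<lambda>t. w i (y + t *\<^sub>R v k) v) (d y v))" by blast
  then obtain d where d: "\<And>i. d i \<in> inverse_terms"
    "\<And>i y v. y \<in> V \<Longrightarrow> v \<in> UNIV \<rightarrow> X \<Longrightarrow> curve_derivative (\<lambda>t. w i (y + t *\<^sub>R v k) v) (d i y v)"
    by metis
  \<comment> \<open>The product rule again: the velocity of \<open>G\<close> enters slot
    \<open>j\<close>, and each argument is differentiated in turn.\<close>
  define e where "e y v = D (Suc j) (G y) ((\<lambda>i. w i y v)(j := A (G y) (v k))) +
    (\<Sum>i<j. D j (G y) ((\<lambda>l. w l y v)(i := d i y v)))" for y v
  have "e \<in> inverse_terms"
    unfolding e_def
  proof (intro inverse_terms.add inverse_terms_sum)
    have "(\<lambda>y v. D (Suc j) (G y) (\<lambda>i. (w(j := \<lambda>y v. A (G y) (v k))) i y v)) \<in> inverse_terms"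
      by (rule inverse_terms.deriv) (use deriv.hyps inverse_terms.inv[OF inverse_terms.proj] in auto)
    moreover have "(\<lambda>i. (w(j := \<lambda>y v. A (G y) (v k))) i y v) = (\<lambda>i. w i y v)(j := A (G y) (v k))" for y v
      by (auto simp: fun_eq_iff)
    ultimately show "(\<lambda>y v. D (Suc j) (G y) ((\<lambda>i. w i y v)(j := A (G y) (v k)))) \<in> inverse_terms"
      by (simp only:)
    fix i
    have "(\<lambda>y v. D j (G y) (\<lambda>l. (w(i := d i)) l y v)) \<in> inverse_terms"
      by (rule inverse_terms.deriv) (use deriv.hyps d in auto)
    moreover have "(\<lambda>l. (w(i := d i)) l y v) = (\<lambda>l. w l y v)(i := d i y v)" for y v
      by (auto simp: fun_eq_iff)
    ultimately show "(\<lambda>y v. D j (G y) ((\<lambda>l. w l y v)(i := d i y v))) \<in> inverse_terms"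
      by (simp only:)
  qed
  moreover have "curve_derivative (\<lambda>t. D j (G (y + t *\<^sub>R v k)) (\<lambda>i. w i (y + t *\<^sub>R v k) v)) (e y v)"
    if y: "y \<in> V" and v: "v \<in> UNIV \<rightarrow> X" for y v
  proof -
    have vk: "v k \<in> X" using v by auto
    have "\<forall>\<^sub>F t in at 0. y + t *\<^sub>R v k \<in> V" by (rule line_eventually_in[OF X V y vk])
    then have ev: "\<forall>\<^sub>F t in at 0. G (y + t *\<^sub>R v k) \<in> U \<and> (\<lambda>i. w i (y + t *\<^sub>R v k) v) \<in> UNIV \<rightarrow> X"
      by eventually_elim (intro conjI G_in Pi_I inverse_terms_in[OF deriv.hyps _ v])
    have "curve_derivative (\<lambda>t. D j (G (y + t *\<^sub>R v k)) (\<lambda>i. w i (y + t *\<^sub>R v k) v))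
       (D (Suc j) (G (y + 0 *\<^sub>R v k)) ((\<lambda>i. w i (y + 0 *\<^sub>R v k) v)(j := A (G y) (v k))) +
       (\<Sum>i<j. D j (G (y + 0 *\<^sub>R v k)) ((\<lambda>i. w i (y + 0 *\<^sub>R v k) v)(i := d i y v))))"
      by (rule curve_derivative_iterated[OF X \<Phi> G_derivative[OF y vk] _ A_in[OF G_in[OF y] vk]
            d(2)[OF y v] _ _ ev])
        (use y v in \<open>auto intro: G_in inverse_terms_in[OF deriv.hyps] inverse_terms_in[OF d(1)]\<close>)
    then show ?thesis by (simp add: e_def)
  qed
  ultimately show ?case by blast
qed

theorem smooth_inverse: "smooth_on X V X G"
proof (rule smooth_onI_closed[OF X V, of inverse_terms])
  show "continuous_on (V \<times> (UNIV \<rightarrow> X)) (\<lambda>(x, v). h x v)" if "h \<in> inverse_terms" for h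
    unfolding continuous_on_def case_prod_unfold by (intro ballI inverse_terms_tendsto that)
  show "\<exists>h'\<in>inverse_terms. \<forall>x\<in>V. \<forall>v\<in>UNIV \<rightarrow> X. has_directional_derivative (\<lambda>y. h y v) (h' x v) x (v k)"
    if "h \<in> inverse_terms" for h k
    unfolding has_directional_derivative_iff_curve by (rule inverse_terms_derivative[OF that])
qed (auto intro: inverse_terms_in inverse_terms.base)

end

section \<open>The inverse function theorem\<close>

lemma banach_space_on_iff: "banach_space_on X \<longleftrightarrow> (\<exists>n. banach_subspace X n)"
  unfolding banach_space_on_def banach_subspace_def by blast

theorem inverse_function:
  assumes B: "banach_space_on X" and \<Phi>: "smooth_on X U X \<Phi>" and U: "0 \<in> U" "\<Phi> 0 = 0"
    and d0: "\<And>v. v \<in> X \<Longrightarrow> directional_derivative \<Phi> 0 v = v"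
  shows "\<exists>U' V G. U' \<subseteq> U \<and> openin (top_of_set X) U' \<and> openin (top_of_set X) V \<and> 0 \<in> U' \<and> 0 \<in> V \<and>
    smooth_on X V X G \<and> G ` V \<subseteq> U' \<and> \<Phi> ` U' \<subseteq> V \<and> (\<forall>x\<in>U'. G (\<Phi> x) = x) \<and> (\<forall>y\<in>V. \<Phi> (G y) = y)"
proof -
  obtain n where "banach_subspace X n" using B banach_space_on_iff by blast
  then interpret banach_subspace X n .
  obtain r where r: "r > 0"
    and near: "\<And>x v. x \<in> X \<Longrightarrow> n x < r \<Longrightarrow> v \<in> X \<Longrightarrow> x \<in> U \<and> n (directional_derivative \<Phi> x v - v) \<le> n v / 2"
    using derivative_near_identity[OF \<Phi> U(1) d0] by blast
  define U1 where "U1 = {x \<in> X. n x < r}"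
  have U1: "U1 \<subseteq> U" "openin (top_of_set X) U1"
    using near zero_in openin_norm_ball0 by (auto simp: U1_def)
  have \<Phi>1: "smooth_on X U1 X \<Phi>" by (rule smooth_on_restrict[OF \<Phi> U1(2,1)])
  have lip: "n ((\<Phi> x - x) - (\<Phi> y - y)) \<le> n (x - y) / 2" if "x \<in> U1" "y \<in> U1" for x y
    using perturbation_lipschitz[OF \<Phi> near] that by (simp add: U1_def)
  have \<Phi>X: "\<Phi> x \<in> X" "x \<in> X" if "x \<in> U1" for x
    using smooth_on_range[OF \<Phi>1 that] that by (auto simp: U1_def)
  have expansive: "n (x - y) \<le> 2 * n (\<Phi> x - \<Phi> y)" if "x \<in> U1" "y \<in> U1" for x y
  proof -
    have "x - y = (\<Phi> x - \<Phi> y) - ((\<Phi> x - x) - (\<Phi> y - y))" by simp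
    then have "n (x - y) \<le> n (\<Phi> x - \<Phi> y) + n ((\<Phi> x - x) - (\<Phi> y - y))"
      using n_diff_le[of "\<Phi> x - \<Phi> y" "(\<Phi> x - x) - (\<Phi> y - y)"] \<Phi>X that by (simp add: diff_in)
    then show ?thesis using lip[OF that] by simp
  qed
  \<comment> \<open>For \<open>y\<close> in \<open>V\<close> the solution of \<Phi> x = y has norm
    at most 2 n y < r/2, so it lies in the open ball \<open>U1\<close>, while the contraction lemma
    runs on the closed ball of radius r/2.\<close>
  define V where "V = {y \<in> X. n y < r / 4}"
  have ex: "\<exists>x\<in>U1. \<Phi> x = y" if "y \<in> V" for y
  proof -
    have "\<exists>x\<in>X. n x \<le> 2 * n y \<and> x + (\<Phi> x - x) = y"
    proof (rule contraction_perturbation_solution[where r = "r / 2"])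
      show "\<Phi> x - x \<in> X" if "x \<in> X" "n x \<le> r / 2" for x
        using that r \<Phi>X[of x] by (simp add: U1_def diff_in)
      show "n (\<Phi> x - x - (\<Phi> x' - x')) \<le> n (x - x') / 2"
        if "x \<in> X" "n x \<le> r / 2" "x' \<in> X" "n x' \<le> r / 2" for x x'
        using that r lip[of x x'] by (simp add: U1_def)
    qed (use U that in \<open>auto simp: V_def\<close>)
    then show ?thesis using that r by (auto simp: V_def U1_def)
  qed
  define G where "G y = (SOME x. x \<in> U1 \<and> \<Phi> x = y)" for y
  have G: "G y \<in> U1" "\<Phi> (G y) = y" if "y \<in> V" for y
    using someI_ex[of "\<lambda>x. x \<in> U1 \<and> \<Phi> x = y"] ex[OF that] by (auto simp: G_def)
  have V: "openin (top_of_set X) V" unfolding V_def by (rule openin_norm_ball0)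
  interpret local_inverse X n U1 V \<Phi> G
    by unfold_locales (use \<Phi>1 near expansive V G in \<open>auto simp: U1_def\<close>)
  \<comment> \<open>\<open>\<Phi>\<close> may map \<open>U1\<close> beyond \<open>V\<close>; cutting
    down to the preimage makes \<open>G\<close> a two-sided inverse.\<close>
  define U' where "U' = U1 \<inter> \<Phi> -` V"
  have "openin (top_of_set U1) U'"
    unfolding U'_def
    using continuous_openin_preimage[OF smooth_on_continuous[OF X \<Phi>1] _ V] \<Phi>X by blast
  then have "openin (top_of_set X) U'" using U1(2) openin_trans by blast
  moreover have "0 \<in> V" "0 \<in> U'" using r U zero_in n_zero by (auto simp: V_def U'_def U1_def)
  moreover have "G (\<Phi> x) = x" if "x \<in> U'" for x
  proof -
    have x: "\<Phi> x \<in> V" "x \<in> U1" using that by (auto simp: U'_def)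
    have "n (G (\<Phi> x) - x) \<le> 0" using expansive[OF G(1)[OF x(1)] x(2)] G(2)[OF x(1)] n_zero by simp
    then have "n (G (\<Phi> x) - x) = 0" using n_nonneg[of "G (\<Phi> x) - x"] by simp
    then show ?thesis using n_eq_0[OF diff_in[OF \<Phi>X(2)[OF G(1)[OF x(1)]] \<Phi>X(2)[OF x(2)]]] by simp
  qed
  ultimately show ?thesis
    using U1(1) V smooth_inverse G
    by (intro exI[of _ U'] exI[of _ V] exI[of _ G]) (auto simp: U'_def)
qed

section \<open>The local normal form\<close>

lemma smooth_on_codomain: "smooth_on X U Y f \<Longrightarrow> Y \<subseteq> Z \<Longrightarrow> smooth_on X U Z f"
  unfolding smooth_on_def by (meson order_trans subsetD)

lemma smooth_on_openin_preimage:
  assumes "subspace X" "smooth_on X U Y f" "openin (top_of_set Y) W"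
  shows "openin (top_of_set X) {x \<in> U. f x \<in> W}"
proof -
  have "openin (top_of_set U) (U \<inter> f -` W)"
    using smooth_on_image[OF assms(2)] continuous_openin_preimage[OF smooth_on_continuous[OF assms(1,2)] _ assms(3)]
    by (simp add: image_subset_iff_funcset)
  then have "openin (top_of_set X) (U \<inter> f -` W)"
    using smooth_on_openin[OF assms(2)] openin_trans by blast
  moreover have "U \<inter> f -` W = {x \<in> U. f x \<in> W}" by auto
  ultimately show ?thesis by simp
qed

lemma linear_on_0: "linear_on X T \<Longrightarrow> 0 \<in> X \<Longrightarrow> T 0 = 0"
  unfolding linear_on_def by (metis scaleR_zero_left)

lemma linear_on_add: "linear_on X T \<Longrightarrow> x \<in> X \<Longrightarrow> y \<in> X \<Longrightarrow> T (x + y) = T x + T y"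
  by (simp add: linear_on_def)

lemma linear_on_scale: "linear_on X T \<Longrightarrow> x \<in> X \<Longrightarrow> T (c *\<^sub>R x) = c *\<^sub>R T x"
  by (simp add: linear_on_def)

lemma linear_on_diff:
  assumes "linear_on X T" "subspace X" "x \<in> X" "y \<in> X" shows "T (x - y) = T x - T y"
  using linear_on_add[OF assms(1) subspace_diff[OF assms(2-4)] assms(4)] by simp

lemma linear_on_subset: "linear_on X T \<Longrightarrow> A \<subseteq> X \<Longrightarrow> linear_on A T"
  unfolding linear_on_def by blast

lemma linear_on_compose: "linear_on X T \<Longrightarrow> linear_on Y S \<Longrightarrow> T ` X \<subseteq> Y \<Longrightarrow> linear_on X (\<lambda>x. S (T x))"
  by (simp add: linear_on_def image_subset_iff)

lemma has_directional_derivative_linear: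
  assumes "subspace X" "linear_on X T" "x \<in> X" "v \<in> X"
  shows "has_directional_derivative T (T v) x v"
proof -
  have "T (x + t *\<^sub>R v) = T x + t *\<^sub>R T v" for t
    using assms linear_on_add[OF assms(2,3) subspace_scale[OF assms(1,4)]] linear_on_scale[OF assms(2,4)] by simp
  then show ?thesis
    using curve_derivative_line by (simp add: has_directional_derivative_iff_curve)
qed

text \<open>The projections are the components of the inverse of addition, hence continuous, and
  linear because decompositions are unique. The last clause turns the definite description in
  \<open>normal_form_map\<close> into a linear map.\<close>

lemma topological_direct_sum_projections:
  assumes "topological_direct_sum X A B"
  obtains p q where
    "linear_on X p" "linear_on X q" "continuous_on X p" "continuous_on X q"
    "\<And>x. x \<in> X \<Longrightarrow> p x \<in> A" "\<And>x. x \<in> X \<Longrightarrow> q x \<in> B" "\<And>x. x \<in> X \<Longrightarrow> p x + q x = x"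
    "\<And>a b. a \<in> A \<Longrightarrow> b \<in> B \<Longrightarrow> p (a + b) = a" "\<And>a b. a \<in> A \<Longrightarrow> b \<in> B \<Longrightarrow> q (a + b) = b"
    "A \<subseteq> X" "B \<subseteq> X" "\<And>x. x \<in> X \<Longrightarrow> second_component A B x = q x"
proof -
  have sub: "subspace X" "subspace A" "subspace B" and AB: "A \<subseteq> X" "B \<subseteq> X"
    using assms by (auto simp: topological_direct_sum_def dest: closedin_imp_subset)
  obtain g where g: "homeomorphic_maps (top_of_set (A \<times> B)) (top_of_set X) (\<lambda>(a, b). a + b) g"
    using assms by (auto simp: topological_direct_sum_def homeomorphic_map_maps)
  have gc: "continuous_on X g" and gX: "\<And>x. x \<in> X \<Longrightarrow> g x \<in> A \<times> B"
    using g by (auto simp: homeomorphic_maps_def continuous_map_subtopology_eu)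
  have fg: "(\<lambda>(a, b). a + b) (g x) = x" if "x \<in> X" for x
    using g that by (simp add: homeomorphic_maps_def)
  have gf: "g (a + b) = (a, b)" if "a \<in> A" "b \<in> B" for a b
    using g that by (force simp: homeomorphic_maps_def)
  define p where "p x = fst (g x)" for x
  define q where "q x = snd (g x)" for x
  have pA: "p x \<in> A" and qB: "q x \<in> B" and pq: "p x + q x = x" if "x \<in> X" for x
    using gX[OF that] fg[OF that] by (auto simp: p_def q_def case_prod_unfold)
  have p: "p (a + b) = a" and q: "q (a + b) = b" if "a \<in> A" "b \<in> B" for a b
    using gf[OF that] by (simp_all add: p_def q_def)
  have add: "p (x + y) = p x + p y" "q (x + y) = q x + q y" if "x \<in> X" "y \<in> X" for x y
  proof -
    have "x + y = (p x + p y) + (q x + q y)" using pq[OF that(1)] pq[OF that(2)] by (simp add: ac_simps)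
    then show "p (x + y) = p x + p y" "q (x + y) = q x + q y"
      using p[of "p x + p y" "q x + q y"] q[of "p x + p y" "q x + q y"] pA qB that sub
      by (auto intro: subspace_add)
  qed
  have scale: "p (c *\<^sub>R x) = c *\<^sub>R p x" "q (c *\<^sub>R x) = c *\<^sub>R q x" if "x \<in> X" for c x
  proof -
    have "c *\<^sub>R x = c *\<^sub>R p x + c *\<^sub>R q x" using pq[OF that] by (metis scaleR_add_right)
    then show "p (c *\<^sub>R x) = c *\<^sub>R p x" "q (c *\<^sub>R x) = c *\<^sub>R q x"
      using p[of "c *\<^sub>R p x" "c *\<^sub>R q x"] q[of "c *\<^sub>R p x" "c *\<^sub>R q x"] pA qB that sub
      by (auto intro: subspace_scale)
  qed
  have "second_component A B x = q x" if "x \<in> X" for x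
    unfolding second_component_def
  proof (rule the_equality)
    show "q x \<in> B \<and> (\<exists>a\<in>A. x = a + q x)" using pA qB pq that by metis
    show "b = q x" if "b \<in> B \<and> (\<exists>a\<in>A. x = a + b)" for b using that q by auto
  qed
  moreover have "continuous_on X p" "continuous_on X q"
    unfolding p_def q_def by (intro continuous_on_fst continuous_on_snd gc)+
  ultimately show ?thesis
    using that[of p q] pA qB pq p q add scale AB by (simp add: linear_on_def)
qed

text \<open>One continuous projection suffices: x \<mapsto> (p x, x - p x) inverts addition, and the
  summands are the zero sets of x - p x and p x, closed because {0} is.\<close>

lemma topological_direct_sumI:
  assumes X: "subspace X" "subspace A" "subspace B" "A \<subseteq> X" "B \<subseteq> X"
    and p: "continuous_on X p" "\<And>x. x \<in> X \<Longrightarrow> p x \<in> A" "\<And>x. x \<in> X \<Longrightarrow> x - p x \<in> B"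
    and pab: "\<And>a b. a \<in> A \<Longrightarrow> b \<in> B \<Longrightarrow> p (a + b) = a"
  shows "topological_direct_sum X A B"
proof -
  have d: "continuous_on X (\<lambda>x. x - p x)"
    using p(1) unfolding continuous_on_def by (auto intro!: tendsto_diff tendsto_intros)
  have 0: "0 \<in> A" "0 \<in> B" using X subspace_0 by auto
  have "A = X \<inter> (\<lambda>x. x - p x) -` {0}"
  proof (intro equalityI subsetI)
    fix x assume "x \<in> A"
    then show "x \<in> X \<inter> (\<lambda>x. x - p x) -` {0}" using X(4) pab[OF _ 0(2), of x] by auto
  next
    fix x assume "x \<in> X \<inter> (\<lambda>x. x - p x) -` {0}"
    then show "x \<in> A" using p(2)[of x] by simp
  qed
  moreover have "closedin (top_of_set X) (X \<inter> (\<lambda>x. x - p x) -` {0})"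
    by (rule continuous_closedin_preimage[OF d]) simp
  ultimately have A: "closedin (top_of_set X) A" by simp
  have "B = X \<inter> p -` {0}"
  proof (intro equalityI subsetI)
    fix x assume "x \<in> B"
    then show "x \<in> X \<inter> p -` {0}" using X(5) pab[OF 0(1), of x] by auto
  next
    fix x assume "x \<in> X \<inter> p -` {0}"
    then show "x \<in> B" using p(3)[of x] by simp
  qed
  moreover have "closedin (top_of_set X) (X \<inter> p -` {0})"
    by (rule continuous_closedin_preimage[OF p(1)]) simp
  ultimately have B: "closedin (top_of_set X) B" by simp
  have "homeomorphic_maps (top_of_set (A \<times> B)) (top_of_set X) (\<lambda>(a, b). a + b) (\<lambda>x. (p x, x - p x))"
    unfolding homeomorphic_maps_def
  proof (intro conjI)
    have "continuous_on (A \<times> B) (\<lambda>x. fst x + snd x)"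
      unfolding continuous_on_def by (intro ballI tendsto_add tendsto_fst tendsto_snd tendsto_ident_at)
    then show "continuous_map (top_of_set (A \<times> B)) (top_of_set X) (\<lambda>(a, b). a + b)"
      using subspace_add[OF X(1)] X(4,5)
      by (auto simp: continuous_map_subtopology_eu case_prod_unfold subset_iff)
    show "continuous_map (top_of_set X) (top_of_set (A \<times> B)) (\<lambda>x. (p x, x - p x))"
      using p d by (auto simp: continuous_map_subtopology_eu intro: continuous_on_Pair)
  qed (auto simp: pab)
  then show ?thesis
    using X A B by (auto simp: topological_direct_sum_def homeomorphic_map_maps)
qed

text \<open>The conditions force \<open>K\<close> to be the kernel and \<open>I\<close> the image of
  \<open>T\<close>. The two parts of the theorem meet here: a regular tangent map and a
  finite-dimensional domain each lead to such a splitting.\<close>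

definition split_operator ::
    "'a::locally_convex set \<Rightarrow> 'b::locally_convex set \<Rightarrow> ('a \<Rightarrow> 'b) \<Rightarrow> 'a set \<Rightarrow> 'a set \<Rightarrow> 'b set \<Rightarrow> 'b set \<Rightarrow> bool"
  where "split_operator X Y T K C Q I \<longleftrightarrow>
    topological_direct_sum X K C \<and> topological_direct_sum Y Q I \<and> linear_on X T \<and> (\<forall>x\<in>K. T x = 0) \<and>
    homeomorphic_map (top_of_set C) (top_of_set I) T"

lemma openin_linear_preimage:
  fixes T :: "'a::locally_convex \<Rightarrow> 'b::locally_convex"
  assumes "subspace X" "subspace Y" "linear_on X T" "T ` X \<subseteq> Y" "continuous_on X T" "openin (top_of_set Y) W"
  shows "openin (top_of_set X) {x \<in> X. T x \<in> W}"
  by (rule smooth_on_openin_preimage[OF assms(1) smooth_on_linear[OF assms(1-5)] assms(6)])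

text \<open>Both coordinate changes are delivered with their inverses and with domains on which
  these are smooth, since that is what building charts from them requires.\<close>

proposition local_normal_form:
  assumes B: "banach_space_on X" and F: "smooth_on X \<Omega> Y F" "0 \<in> \<Omega>" "F 0 = 0"
    and T: "split_operator X Y (directional_derivative F 0) K C Q I"
  shows "\<exists>U' U \<Phi> G W \<psi> \<psi>' fsing.
    U' \<subseteq> \<Omega> \<and> 0 \<in> U' \<and> smooth_on X U' X \<Phi> \<and> \<Phi> 0 = 0 \<and> \<Phi> ` U' \<subseteq> U \<and>
    smooth_on X U X G \<and> G ` U \<subseteq> U' \<and> (\<forall>x\<in>U'. G (\<Phi> x) = x) \<and> (\<forall>z\<in>U. \<Phi> (G z) = z) \<and>
    0 \<in> W \<and> smooth_on Y W Y \<psi> \<and> \<psi> ` W \<subseteq> W \<and> smooth_on Y W Y \<psi>' \<and> \<psi>' ` W \<subseteq> W \<and> \<psi> 0 = 0 \<and>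
    (\<forall>y\<in>W. \<psi>' (\<psi> y) = y) \<and> (\<forall>y\<in>W. \<psi> (\<psi>' y) = y) \<and> F ` U' \<subseteq> W \<and>
    abstract_normal_form X K C Y Q I (directional_derivative F 0) U fsing \<and>
    (\<forall>x\<in>U'. \<psi> (F x) = normal_form_map K C (directional_derivative F 0) fsing (\<Phi> x))"
proof -
  define T where "T = directional_derivative F 0"
  have dsX: "topological_direct_sum X K C" and dsY: "topological_direct_sum Y Q I"
    and T0: "\<And>x. x \<in> K \<Longrightarrow> T x = 0" and TC: "homeomorphic_map (top_of_set C) (top_of_set I) T"
    and Tlin: "linear_on X T"
    using T by (simp_all add: split_operator_def T_def)
  have X: "subspace X" and K: "subspace K" and C: "subspace C" and Y: "subspace Y" and Q: "subspace Q" and I: "subspace I"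
    using dsX dsY by (simp_all add: topological_direct_sum_def)
  obtain p1 p2 where p: "linear_on X p1" "linear_on X p2" "continuous_on X p1" "continuous_on X p2"
    "\<And>x. x \<in> X \<Longrightarrow> p1 x \<in> K" "\<And>x. x \<in> X \<Longrightarrow> p2 x \<in> C" "\<And>x. x \<in> X \<Longrightarrow> p1 x + p2 x = x"
    and p': "\<And>a b. a \<in> K \<Longrightarrow> b \<in> C \<Longrightarrow> p1 (a + b) = a" "\<And>a b. a \<in> K \<Longrightarrow> b \<in> C \<Longrightarrow> p2 (a + b) = b"
    and KC: "K \<subseteq> X" "C \<subseteq> X" and sec: "\<And>x. x \<in> X \<Longrightarrow> second_component K C x = p2 x"
    by (rule topological_direct_sum_projections[OF dsX]) (rule that; assumption)
  obtain q1 q2 where q: "linear_on Y q1" "linear_on Y q2" "continuous_on Y q1" "continuous_on Y q2"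
    "\<And>x. x \<in> Y \<Longrightarrow> q1 x \<in> Q" "\<And>x. x \<in> Y \<Longrightarrow> q2 x \<in> I" "\<And>x. x \<in> Y \<Longrightarrow> q1 x + q2 x = x"
    and q': "\<And>a b. a \<in> Q \<Longrightarrow> b \<in> I \<Longrightarrow> q1 (a + b) = a" "\<And>a b. a \<in> Q \<Longrightarrow> b \<in> I \<Longrightarrow> q2 (a + b) = b"
    and QI: "Q \<subseteq> Y" "I \<subseteq> Y" and "\<And>x. x \<in> Y \<Longrightarrow> second_component Q I x = q2 x"
    by (rule topological_direct_sum_projections[OF dsY]) (rule that; assumption)
  obtain S where S: "homeomorphic_maps (top_of_set C) (top_of_set I) T S"
    using TC homeomorphic_map_maps by blast
  have ST: "S (T x) = x" "T x \<in> I" if "x \<in> C" for x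
    using S that by (auto simp: homeomorphic_maps_def continuous_map_subtopology_eu)
  have TS: "T (S y) = y" "S y \<in> C" if "y \<in> I" for y
    using S that by (auto simp: homeomorphic_maps_def continuous_map_subtopology_eu)
  have SX: "S y \<in> X" if "y \<in> I" for y using TS(2)[OF that] KC(2) by auto
  have Scont: "continuous_on I S" using S by (auto simp: homeomorphic_maps_def continuous_map_subtopology_eu)
  have Slin: "linear_on I S"
    unfolding linear_on_def
  proof (intro conjI ballI allI)
    fix x y assume "x \<in> I" "y \<in> I"
    then have "T (S x + S y) = x + y" "S x + S y \<in> C"
      using linear_on_add[OF Tlin SX SX] TS C by (auto intro: subspace_add)
    then show "S (x + y) = S x + S y" using ST by metis
  next
    fix c x assume "x \<in> I"
    then have "T (c *\<^sub>R S x) = c *\<^sub>R x" "c *\<^sub>R S x \<in> C"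
      using linear_on_scale[OF Tlin SX] TS C by (auto intro: subspace_scale)
    then show "S (c *\<^sub>R x) = c *\<^sub>R S x" using ST by metis
  qed
  \<comment> \<open>\<open>R\<close> inverts \<open>T\<close> up to the kernel,
    \<open>R (T x) = p2 x\<close>, and kills \<open>Q\<close>. The first property gives
    \<open>\<Phi>\<close> the identity as derivative, the second makes the shear of \<open>Y\<close>
    invertible.\<close>
  define R where "R y = S (q2 y)" for y
  have R: "linear_on Y R" "R ` Y \<subseteq> C" "continuous_on Y R"
    unfolding R_def using q TS
    by (auto intro!: linear_on_compose[OF q(2) Slin] continuous_on_compose2[OF Scont q(4)])
  have RX: "R ` Y \<subseteq> X" using R KC by auto
  have TR: "T (R y) = q2 y" if "y \<in> Y" for y using TS q(6)[OF that] by (simp add: R_def)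
  have T_p2: "T x = T (p2 x)" if "x \<in> X" for x
  proof -
    have "T (p1 x + p2 x) = T (p1 x) + T (p2 x)"
      using that p KC by (intro linear_on_add[OF Tlin]) auto
    then show ?thesis using p(7)[OF that] T0[OF p(5)[OF that]] by simp
  qed
  have TI: "T x \<in> I" if "x \<in> X" for x using T_p2[OF that] ST(2)[OF p(6)[OF that]] by simp
  have q2I: "q2 y = y" "q1 y = 0" if "y \<in> I" for y
    using q'[OF subspace_0[OF Q] that] by simp_all
  have q2Q: "q2 y = 0" "q1 y = y" if "y \<in> Q" for y
    using q'[OF that subspace_0[OF I]] by simp_all
  have RT: "R (T x) = p2 x" if "x \<in> X" for x
    using q2I[OF TI[OF that]] T_p2[OF that] ST(1)[OF p(6)[OF that]] by (simp add: R_def)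
  have RQ: "R y = 0" if "y \<in> Q" for y
    using q2Q[OF that] linear_on_0[OF Slin subspace_0[OF I]] by (simp add: R_def)
  define \<Phi> where "\<Phi> x = p1 x + R (F x)" for x
  have p1X: "p1 ` X \<subseteq> X" and p2X: "p2 ` X \<subseteq> X" using p KC by auto
  have \<Omega>: "openin (top_of_set X) \<Omega>" "\<Omega> \<subseteq> X" using smooth_on_openin smooth_on_subset_model F by blast+
  have RF: "smooth_on X \<Omega> X (\<lambda>x. R (F x))"
    by (rule smooth_on_compose_linear[OF X Y X F(1) R(1) RX R(3)])
  have p1s: "smooth_on X \<Omega> X p1"
    by (rule smooth_on_restrict[OF smooth_on_linear[OF X X p(1) p1X p(3)] \<Omega>])
  have \<Phi>s: "smooth_on X \<Omega> X \<Phi>"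
    unfolding \<Phi>_def by (rule smooth_on_add[OF X X p1s RF])
  have \<Phi>0: "\<Phi> 0 = 0"
    using linear_on_0[OF p(1) subspace_0[OF X]] linear_on_0[OF R(1) subspace_0[OF Y]] F by (simp add: \<Phi>_def)
  have dF: "has_directional_derivative F (T v) 0 v" "T v \<in> Y" if "v \<in> X" for v
    unfolding T_def using smooth_on_has_directional_derivative[OF X F(1,2) that]
      smooth_on_derivative_range[OF X F(1,2) that] by auto
  have d\<Phi>: "directional_derivative \<Phi> 0 v = v" if v: "v \<in> X" for v
  proof (rule directional_derivative_eq)
    have "has_directional_derivative (\<lambda>x. R (F x)) (directional_derivative R (F 0) (T v)) 0 v"
      by (rule has_directional_derivative_chain[OF X Y \<Omega>(1) F(2) v smooth_on_image[OF F(1)] dF[OF v]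
            smooth_on_linear[OF Y X R(1) RX R(3)]])
    moreover have "directional_derivative R (F 0) (T v) = R (T v)"
      by (rule directional_derivative_eq has_directional_derivative_linear[OF Y R(1)])+
        (use dF(2)[OF v] F subspace_0[OF Y] in auto)
    moreover have "has_directional_derivative p1 (p1 v) 0 v"
      by (rule has_directional_derivative_linear[OF X p(1) subspace_0[OF X] v])
    ultimately have "has_directional_derivative \<Phi> (p1 v + R (T v)) 0 v"
      unfolding \<Phi>_def has_directional_derivative_iff_curve by (simp add: curve_derivative_add)
    then show "has_directional_derivative \<Phi> v 0 v" using RT[OF v] p(7)[OF v] by simp
  qed
  obtain U0 V G where U0: "U0 \<subseteq> \<Omega>" "openin (top_of_set X) U0" "0 \<in> U0"
    and V: "openin (top_of_set X) V" "0 \<in> V"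
    and G: "smooth_on X V X G" "G ` V \<subseteq> U0" "\<Phi> ` U0 \<subseteq> V"
    and inv: "\<And>x. x \<in> U0 \<Longrightarrow> G (\<Phi> x) = x" "\<And>z. z \<in> V \<Longrightarrow> \<Phi> (G z) = z"
    using inverse_function[OF B \<Phi>s F(2) \<Phi>0 d\<Phi>] by blast
  have VX: "V \<subseteq> X" using V openin_imp_subset by blast
  \<comment> \<open>\<open>fsing\<close> evaluates \<open>g\<close> both at \<open>z\<close> and at
    \<open>p2 z\<close>. The condition on \<open>p2 z\<close> is also what places \<open>F x\<close>
    in \<open>W\<close>.\<close>
  define U where "U = V \<inter> {z \<in> X. p2 z \<in> V}"
  have Uo: "openin (top_of_set X) U"
    unfolding U_def
    by (intro openin_Int V openin_linear_preimage[OF X X p(2) p2X p(4) V(1)])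
  have p20: "p2 0 = 0" using linear_on_0[OF p(2) subspace_0[OF X]] .
  have U: "0 \<in> U" "U \<subseteq> V" using V p20 subspace_0[OF X] by (auto simp: U_def)
  have p2C: "p2 c = c" if "c \<in> C" for c using p'(2)[OF subspace_0[OF K] that] by simp
  have p2U: "p2 z \<in> V" "p2 (p2 z) = p2 z" if "z \<in> U" for z
    using that p2C[OF p(6)] by (auto simp: U_def)
  define U' where "U' = {x \<in> U0. \<Phi> x \<in> U}"
  have \<Phi>U0: "smooth_on X U0 X \<Phi>" by (rule smooth_on_restrict[OF \<Phi>s U0(2,1)])
  have U'o: "openin (top_of_set X) U'"
    unfolding U'_def by (rule smooth_on_openin_preimage[OF X \<Phi>U0 Uo])
  have \<Phi>U': "smooth_on X U' X \<Phi>"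
    by (rule smooth_on_restrict[OF \<Phi>U0 U'o]) (auto simp: U'_def)
  have GU: "smooth_on X U X G" by (rule smooth_on_restrict[OF G(1) Uo U(2)])
  have GU': "G ` U \<subseteq> U'" using G(2) inv(2) U(2) by (auto simp: U'_def)
  \<comment> \<open>The \<open>C\<close>-component of \<Phi> (G z) = z: the summand
    \<open>p1\<close> of \<open>\<Phi>\<close> lies in \<open>K\<close>. Hence in the new
    coordinates the \<open>I\<close>-part of \<open>F\<close> is linear.\<close>
  have RFG: "R (F (G z)) = p2 z" "F (G z) \<in> Y" if "z \<in> V" for z
  proof -
    have g: "G z \<in> \<Omega>" using that G U0 by auto
    then show FY: "F (G z) \<in> Y" by (rule smooth_on_range[OF F(1)])
    have "p2 (\<Phi> (G z)) = R (F (G z))"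
      unfolding \<Phi>_def using g \<Omega>(2) R FY by (intro p'(2) p(5)) auto
    then show "R (F (G z)) = p2 z" using inv(2)[OF that] by simp
  qed
  define g where "g z = q1 (F (G z))" for z
  have q1Y: "q1 ` Y \<subseteq> Q" using q by auto
  have FG: "smooth_on X V Y (\<lambda>z. F (G z))"
    by (rule smooth_on_compose[OF X X Y G(1) F(1)]) (use G U0 in auto)
  have gs: "smooth_on X V Q g"
    unfolding g_def by (rule smooth_on_compose_linear[OF X Y Q FG q(1) q1Y q(3)])
  have gQ: "g z \<in> Q" if "z \<in> V" for z by (rule smooth_on_range[OF gs that])
  have G0: "G 0 = 0" using inv(1)[OF U0(3)] \<Phi>0 by simp
  have g0: "g 0 = 0" using G0 F linear_on_0[OF q(1) subspace_0[OF Y]] by (simp add: g_def)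
  \<comment> \<open>The derivative of \<open>F\<close> at 0 takes values in \<open>I\<close>, where
    \<open>q1\<close> vanishes.\<close>
  have dg: "directional_derivative g 0 v = 0" if v: "v \<in> X" for v
  proof (rule directional_derivative_eq)
    let ?w = "directional_derivative G 0 v"
    have w: "has_directional_derivative G ?w 0 v" "?w \<in> X"
      using smooth_on_has_directional_derivative[OF X G(1) V(2) v] smooth_on_derivative_range[OF X G(1) V(2) v] by auto
    have "has_directional_derivative (\<lambda>z. F (G z)) (directional_derivative F (G 0) ?w) 0 v"
      by (rule has_directional_derivative_chain[OF X X V v _ w F(1)]) (use G U0 in auto)
    then have FG': "has_directional_derivative (\<lambda>z. F (G z)) (T ?w) 0 v" by (simp add: G0 T_def)
    have "has_directional_derivative (\<lambda>z. q1 (F (G z))) (directional_derivative q1 (F (G 0)) (T ?w)) 0 v"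
      by (rule has_directional_derivative_chain[OF X Y V v smooth_on_image[OF FG] FG' dF(2)[OF w(2)]
            smooth_on_linear[OF Y Q q(1) q1Y q(3)]])
    moreover have "directional_derivative q1 (F (G 0)) (T ?w) = q1 (T ?w)"
      by (rule directional_derivative_eq has_directional_derivative_linear[OF Y q(1)])+
        (use dF(2)[OF w(2)] F G0 subspace_0[OF Y] in auto)
    moreover have "q1 (T ?w) = 0" by (rule q2I(2)[OF TI[OF w(2)]])
    ultimately show "has_directional_derivative g 0 0 v" unfolding g_def by simp
  qed
  \<comment> \<open>On \<open>W\<close> the shear term \<open>g (R y)\<close> is defined. It lies in
    \<open>Q\<close>, where \<open>R\<close> vanishes, so adding or subtracting it changes neither
    \<open>R y\<close> nor membership in \<open>W\<close>.\<close>
  define W where "W = {y \<in> Y. R y \<in> V}"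
  have Wo: "openin (top_of_set Y) W"
    unfolding W_def by (rule openin_linear_preimage[OF Y X R(1) RX R(3) V(1)])
  have gR: "smooth_on Y W Y (\<lambda>y. g (R y))"
  proof (rule smooth_on_codomain[OF _ QI(1)])
    show "smooth_on Y W Q (\<lambda>y. g (R y))"
      by (rule smooth_on_compose[OF Y X Q smooth_on_restrict[OF smooth_on_linear[OF Y X R(1) RX R(3)] Wo] gs])
        (auto simp: W_def)
  qed
  have idW: "smooth_on Y W Y (\<lambda>y. y)"
    by (rule smooth_on_restrict[OF smooth_on_linear[OF Y Y] Wo]) (auto simp: linear_on_def W_def)
  define \<psi> where "\<psi> y = y - g (R y)" for y
  define \<psi>' where "\<psi>' y = y + g (R y)" for y
  have gRQ: "g (R y) \<in> Q" "g (R y) \<in> Y" if "y \<in> W" for y using gQ that QI by (auto simp: W_def)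
  have R\<psi>: "R (\<psi> y) = R y" "\<psi> y \<in> Y" "R (\<psi>' y) = R y" "\<psi>' y \<in> Y" if "y \<in> W" for y
  proof -
    have y: "y \<in> Y" using that by (simp add: W_def)
    show "R (\<psi> y) = R y" "R (\<psi>' y) = R y"
      using linear_on_diff[OF R(1) Y y gRQ(2)[OF that]] linear_on_add[OF R(1) y gRQ(2)[OF that]] RQ[OF gRQ(1)[OF that]]
      by (simp_all add: \<psi>_def \<psi>'_def)
    show "\<psi> y \<in> Y" "\<psi>' y \<in> Y"
      using y gRQ(2)[OF that] Y by (auto simp: \<psi>_def \<psi>'_def intro: subspace_diff subspace_add)
  qed
  have \<psi>W: "\<psi> ` W \<subseteq> W" "\<psi>' ` W \<subseteq> W" using R\<psi> by (auto simp: W_def)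
  have \<psi>inv: "\<psi>' (\<psi> y) = y" "\<psi> (\<psi>' y) = y" if "y \<in> W" for y
    using R\<psi>[OF that] by (simp_all add: \<psi>'_def[of "\<psi> y"] \<psi>_def[of "\<psi>' y"]) (simp_all add: \<psi>_def \<psi>'_def)
  have \<psi>s: "smooth_on Y W Y \<psi>" "smooth_on Y W Y \<psi>'"
    unfolding \<psi>_def \<psi>'_def by (rule smooth_on_diff[OF Y Y idW gR], rule smooth_on_add[OF Y Y idW gR])
  have R0: "R 0 = 0" using linear_on_0[OF R(1) subspace_0[OF Y]] .
  have W0: "0 \<in> W" "\<psi> 0 = 0" using R0 V subspace_0[OF Y] g0 by (auto simp: W_def \<psi>_def)
  define fsing where "fsing z = g z - g (p2 z)" for z
  have p2s: "smooth_on X U X p2"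
    by (rule smooth_on_restrict[OF smooth_on_linear[OF X X p(2) p2X p(4)] Uo]) (use U VX in auto)
  have gp2: "smooth_on X U Q (\<lambda>z. g (p2 z))"
    by (rule smooth_on_compose[OF X X Q p2s gs]) (use p2U in auto)
  have fs: "smooth_on X U Q fsing"
    unfolding fsing_def by (rule smooth_on_diff[OF X Q smooth_on_restrict[OF gs Uo U(2)] gp2])
  have dfs: "directional_derivative fsing 0 v = 0" if v: "v \<in> X" for v
  proof (rule directional_derivative_eq)
    have "has_directional_derivative g 0 0 v"
      using smooth_on_has_directional_derivative[OF X gs V(2) v] dg[OF v] by simp
    moreover have "has_directional_derivative (\<lambda>z. g (p2 z)) (directional_derivative g (p2 0) (p2 v)) 0 v"
      by (rule has_directional_derivative_chain[OF X X Uo U(1) v _ has_directional_derivative_linear[OF X p(2) subspace_0[OF X] v] _ gs])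
        (use p2U p2X v in auto)
    then have "has_directional_derivative (\<lambda>z. g (p2 z)) 0 0 v"
      using dg[of "p2 v"] p2X v p20 by auto
    ultimately have "has_directional_derivative fsing (0 - 0) 0 v"
      unfolding fsing_def by (rule has_directional_derivative_diff)
    then show "has_directional_derivative fsing 0 0 v" by simp
  qed
  have "abstract_normal_form X K C Y Q I T U fsing"
    unfolding abstract_normal_form_def
    using dsX dsY linear_on_subset[OF Tlin KC(2)] TC Uo U(1) fs dfs
    by (simp add: fsing_def p2C)
  moreover have "\<psi> (F x) = normal_form_map K C T fsing (\<Phi> x)" if x: "x \<in> U'" for x
  proof -
    let ?z = "\<Phi> x"
    have z: "?z \<in> V" "?z \<in> U" "G ?z = x" "?z \<in> X" using x inv(1) U VX by (auto simp: U'_def)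
    have RF': "R (F x) = p2 ?z" "F x \<in> Y" using RFG[OF z(1)] z(3) by simp_all
    \<comment> \<open>The \<open>I\<close>-part of \<open>F x\<close> is T (R (F x)) = T (p2 z) and
      its \<open>Q\<close>-part is g z; then \<open>\<psi>\<close> subtracts g (R (F x)) = g (p2
      z).\<close>
    have Fx: "T (p2 ?z) + q1 (F x) = F x"
      using q(7)[OF RF'(2)] TR[OF RF'(2)] RF'(1) by (simp add: add.commute)
    have gz: "g ?z = q1 (F x)" using z(3) by (simp add: g_def)
    show ?thesis
      unfolding normal_form_map_def sec[OF z(4)] \<psi>_def fsing_def RF'(1) gz
      by (simp add: add_diff_eq Fx)
  qed
  moreover have "F ` U' \<subseteq> W"
  proof
    fix y assume "y \<in> F ` U'"
    then obtain x where x: "x \<in> U'" "y = F x" by auto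
    then have z: "\<Phi> x \<in> U" "\<Phi> x \<in> V" "G (\<Phi> x) = x" using inv(1) U by (auto simp: U'_def)
    then show "y \<in> W" using RFG[OF z(2)] p2U(1)[OF z(1)] x by (simp add: W_def)
  qed
  moreover have "U' \<subseteq> \<Omega>" "0 \<in> U'" "\<Phi> ` U' \<subseteq> U" "\<forall>x\<in>U'. G (\<Phi> x) = x" "\<forall>z\<in>U. \<Phi> (G z) = z"
    using U0 U \<Phi>0 inv by (auto simp: U'_def)
  ultimately show ?thesis
    unfolding T_def[symmetric]
    using \<Phi>U' \<Phi>0 GU GU' W0 \<psi>s \<psi>W \<psi>inv
    by (intro exI[of _ U'] exI[of _ U] exI[of _ \<Phi>] exI[of _ G] exI[of _ W] exI[of _ \<psi>] exI[of _ \<psi>'] exI[of _ fsing] conjI ballI)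
      simp_all
qed

section \<open>Changing charts\<close>

lemma is_chartD:
  assumes "is_chart T c"
  shows chart_openin: "openin T (chart_dom c)"
    and chart_subspace: "subspace (chart_model c)"
    and chart_img_openin: "openin (top_of_set (chart_model c)) (chart_img c)"
    and chart_inv_map: "\<And>p. p \<in> chart_dom c \<Longrightarrow> chart_inv c (chart_map c p) = p"
    and chart_map_inv: "\<And>x. x \<in> chart_img c \<Longrightarrow> chart_map c (chart_inv c x) = x"
    and chart_inv_in: "\<And>x. x \<in> chart_img c \<Longrightarrow> chart_inv c x \<in> chart_dom c"
    and chart_inj: "inj_on (chart_map c) (chart_dom c)"
    and chart_continuous: "continuous_map (subtopology T (chart_dom c)) euclidean (chart_map c)"
    and chart_inv_continuous: "continuous_map (top_of_set (chart_img c)) (subtopology T (chart_dom c)) (chart_inv c)"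
proof -
  show o: "openin T (chart_dom c)" and "subspace (chart_model c)"
    and "openin (top_of_set (chart_model c)) (chart_img c)"
    using assms by (simp_all add: is_chart_def)
  have h: "homeomorphic_map (subtopology T (chart_dom c)) (top_of_set (chart_img c)) (chart_map c)"
    using assms by (simp add: is_chart_def)
  have top: "topspace (subtopology T (chart_dom c)) = chart_dom c"
    using o openin_subset by fastforce
  show inj: "inj_on (chart_map c) (chart_dom c)"
    using homeomorphic_imp_injective_map[OF h] top by simp
  then show inv1: "chart_inv c (chart_map c p) = p" if "p \<in> chart_dom c" for p
    using that by (simp add: chart_inv_def)
  show "chart_map c (chart_inv c x) = x" if "x \<in> chart_img c" for x
    using that by (simp add: chart_inv_def f_inv_into_f)
  show "chart_inv c x \<in> chart_dom c" if "x \<in> chart_img c" for x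
    using that by (simp add: chart_inv_def inv_into_into)
  show "continuous_map (subtopology T (chart_dom c)) euclidean (chart_map c)"
    by (rule continuous_map_into_fulltopology[OF homeomorphic_imp_continuous_map[OF h]])
  obtain g where g: "homeomorphic_maps (subtopology T (chart_dom c)) (top_of_set (chart_img c)) (chart_map c) g"
    using h unfolding homeomorphic_map_maps by (rule exE)
  then have "continuous_map (top_of_set (chart_img c)) (subtopology T (chart_dom c)) g"
    by (simp add: homeomorphic_maps_def)
  moreover have "g x = chart_inv c x" if "x \<in> topspace (top_of_set (chart_img c))" for x
  proof -
    have "g x \<in> topspace (subtopology T (chart_dom c))" "chart_map c (g x) = x"
      using g that unfolding homeomorphic_maps_def continuous_map_def by (elim conjE, blast, blast)
    then show ?thesis using inv1[of "g x"] top by simp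
  qed
  ultimately show "continuous_map (top_of_set (chart_img c)) (subtopology T (chart_dom c)) (chart_inv c)"
    by (rule continuous_map_eq)
qed

lemma smooth_manifold_is_chart: "smooth_manifold M \<Longrightarrow> c \<in> charts M \<Longrightarrow> is_chart (mtop M) c"
  unfolding smooth_manifold_def by (elim conjE) (rule bspec)

lemma smooth_manifold_transition:
  "smooth_manifold M \<Longrightarrow> c \<in> charts M \<Longrightarrow> d \<in> charts M \<Longrightarrow> smooth_transition c d"
  unfolding smooth_manifold_def by (elim conjE) (drule bspec, assumption, rule bspec)

definition recharted ::
    "('m, 'e) chart \<Rightarrow> 'e set \<Rightarrow> ('e \<Rightarrow> 'e) \<Rightarrow> ('m, 'e) chart" where
  "recharted c W \<theta> = \<lparr>chart_dom = {p \<in> chart_dom c. chart_map c p \<in> W},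
     chart_map = (\<lambda>p. \<theta> (chart_map c p)), chart_model = chart_model c\<rparr>"

lemma recharted_simps [simp]:
  "chart_dom (recharted c W \<theta>) = {p \<in> chart_dom c. chart_map c p \<in> W}"
  "chart_map (recharted c W \<theta>) = (\<lambda>p. \<theta> (chart_map c p))"
  "chart_model (recharted c W \<theta>) = chart_model c"
  by (simp_all add: recharted_def)

text \<open>By maximality of the atlas only smooth transitions have to be checked, and these are
  transitions of \<open>c\<close> composed with \<open>\<theta>\<close> or
  \<open>\<theta>'\<close>.\<close>

proposition recharted_in_atlas:
  fixes M :: "('m, 'e::locally_convex) manifold"
  assumes M: "smooth_manifold M" and c: "c \<in> charts M"
    and W: "W \<subseteq> chart_img c"
    and \<theta>: "smooth_on (chart_model c) W (chart_model c) \<theta>" "\<theta> ` W \<subseteq> W'"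
    and \<theta>': "smooth_on (chart_model c) W' (chart_model c) \<theta>'" "\<theta>' ` W' \<subseteq> W"
    and inv: "\<And>x. x \<in> W \<Longrightarrow> \<theta>' (\<theta> x) = x" "\<And>y. y \<in> W' \<Longrightarrow> \<theta> (\<theta>' y) = y"
  shows "recharted c W \<theta> \<in> charts M" and "chart_img (recharted c W \<theta>) = W'"
proof -
  let ?k = "recharted c W \<theta>" and ?X = "chart_model c" and ?T = "mtop M"
  have C: "is_chart ?T c" by (rule smooth_manifold_is_chart[OF M c])
  note X = chart_subspace[OF C]
  have Wo: "openin (top_of_set ?X) W" and W'o: "openin (top_of_set ?X) W'"
    by (rule smooth_on_openin[OF \<theta>(1)], rule smooth_on_openin[OF \<theta>'(1)])
  have "\<theta> (chart_map c (chart_inv c (\<theta>' y))) = y" "chart_inv c (\<theta>' y) \<in> chart_dom ?k" if "y \<in> W'" for y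
    using that \<theta>'(2) W chart_map_inv[OF C, of "\<theta>' y"] chart_inv_in[OF C, of "\<theta>' y"] inv(2)[OF that]
    by (auto simp: image_subset_iff subset_iff)
  then have kinv: "chart_map ?k (chart_inv c (\<theta>' y)) = y" "chart_inv c (\<theta>' y) \<in> chart_dom ?k" if "y \<in> W'" for y
    using that by simp_all
  show img: "chart_img ?k = W'"
  proof
    show "chart_img ?k \<subseteq> W'" using \<theta>(2) by auto
    show "W' \<subseteq> chart_img ?k" using kinv by (metis image_eqI subsetI)
  qed
  have kinj: "inj_on (chart_map ?k) (chart_dom ?k)"
  proof (rule inj_onI)
    fix p q assume pq: "p \<in> chart_dom ?k" "q \<in> chart_dom ?k" "chart_map ?k p = chart_map ?k q"
    then have p: "chart_map c p \<in> W" "chart_map c q \<in> W" "p \<in> chart_dom c" "q \<in> chart_dom c"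
      and e: "\<theta> (chart_map c p) = \<theta> (chart_map c q)" by simp_all
    have "chart_map c p = \<theta>' (\<theta> (chart_map c p))" using inv(1)[OF p(1)] by (rule sym)
    also have "\<dots> = chart_map c q" unfolding e by (rule inv(1)[OF p(2)])
    finally show "p = q" by (rule inj_onD[OF chart_inj[OF C] _ p(3,4)])
  qed
  \<comment> \<open>The inverse of the new chart is defined by choice; injectivity identifies it
    with the explicit formula.\<close>
  have kinv_eq: "chart_inv ?k y = chart_inv c (\<theta>' y)" if "y \<in> W'" for y
    unfolding chart_inv_def[of ?k] by (rule inv_into_f_eq[OF kinj kinv(2)[OF that] kinv(1)[OF that]])
  have Wimg: "openin (top_of_set (chart_img c)) W"
    using openin_subset_trans[OF Wo W openin_imp_subset[OF chart_img_openin[OF C]]] .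
  have dom_eq: "chart_dom ?k = {p \<in> topspace (subtopology ?T (chart_dom c)). chart_map c p \<in> W}"
    using openin_subset[OF chart_openin[OF C]] by auto
  have cm: "continuous_map (subtopology ?T (chart_dom c)) (top_of_set (chart_img c)) (chart_map c)"
    using chart_continuous[OF C] openin_subset[OF chart_openin[OF C]]
    by (auto simp: continuous_map_in_subtopology)
  have "openin (subtopology ?T (chart_dom c)) (chart_dom ?k)"
    unfolding dom_eq by (rule openin_continuous_map_preimage[OF cm Wimg])
  then have domo: "openin ?T (chart_dom ?k)" using openin_trans_full chart_openin[OF C] by blast
  have "homeomorphic_maps (subtopology ?T (chart_dom ?k)) (top_of_set W') (chart_map ?k) (\<lambda>y. chart_inv c (\<theta>' y))"
    unfolding homeomorphic_maps_def
  proof (intro conjI ballI)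
    have "continuous_map (subtopology ?T (chart_dom ?k)) (top_of_set (chart_img c)) (chart_map c)"
      by (rule continuous_map_from_subtopology_mono[OF cm]) auto
    then have 1: "continuous_map (subtopology ?T (chart_dom ?k)) (top_of_set W) (chart_map c)"
      by (auto simp: continuous_map_in_subtopology)
    have 2: "continuous_map (top_of_set W) (top_of_set W') \<theta>"
      using smooth_on_continuous[OF X \<theta>(1)] \<theta>(2) by (auto simp: continuous_map_subtopology_eu)
    show "continuous_map (subtopology ?T (chart_dom ?k)) (top_of_set W') (chart_map ?k)"
      using continuous_map_compose[OF 1 2] by (simp add: o_def)
    have 3: "continuous_map (top_of_set W') (top_of_set (chart_img c)) \<theta>'"
      using smooth_on_continuous[OF X \<theta>'(1)] \<theta>'(2) W by (auto simp: continuous_map_subtopology_eu)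
    have "continuous_map (top_of_set W') (subtopology ?T (chart_dom c)) (\<lambda>y. chart_inv c (\<theta>' y))"
      using continuous_map_compose[OF 3 chart_inv_continuous[OF C]] by (simp add: o_def)
    then have "continuous_map (top_of_set W') ?T (\<lambda>y. chart_inv c (\<theta>' y))"
      by (simp add: continuous_map_in_subtopology)
    then show "continuous_map (top_of_set W') (subtopology ?T (chart_dom ?k)) (\<lambda>y. chart_inv c (\<theta>' y))"
      using kinv(2) by (auto simp: continuous_map_in_subtopology)
    show "chart_inv c (\<theta>' (chart_map ?k p)) = p" if "p \<in> topspace (subtopology ?T (chart_dom ?k))" for p
      using that inv(1) chart_inv_map[OF C] by auto
    show "chart_map ?k (chart_inv c (\<theta>' y)) = y" if "y \<in> topspace (top_of_set W')" for y
      using kinv(1) that by simp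
  qed
  then have hom: "homeomorphic_map (subtopology ?T (chart_dom ?k)) (top_of_set (chart_img ?k)) (chart_map ?k)"
    unfolding img homeomorphic_map_maps by blast
  have chart: "is_chart ?T ?k"
  proof -
    have "subspace (chart_model ?k)" using X by simp
    moreover have "openin (top_of_set (chart_model ?k)) (chart_img ?k)" unfolding img using W'o by simp
    ultimately show ?thesis unfolding is_chart_def using domo hom by (intro conjI)
  qed
  have tr: "smooth_transition ?k e \<and> smooth_transition e ?k" if e: "e \<in> charts M" for e
  proof
    have E: "is_chart ?T e" by (rule smooth_manifold_is_chart[OF M e])
    have ce: "smooth_on ?X (chart_map c ` (chart_dom c \<inter> chart_dom e)) (chart_model e) (chart_map e \<circ> chart_inv c)"
      using smooth_manifold_transition[OF M c e] by (simp add: smooth_transition_def)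
    have ec: "smooth_on (chart_model e) (chart_map e ` (chart_dom e \<inter> chart_dom c)) ?X (chart_map c \<circ> chart_inv e)"
      using smooth_manifold_transition[OF M e c] by (simp add: smooth_transition_def)
    \<comment> \<open>The overlap expressed through \<open>\<theta>'\<close>: in this form it is a
      preimage, hence open.\<close>
    let ?Z = "{y \<in> W'. \<theta>' y \<in> chart_map c ` (chart_dom c \<inter> chart_dom e)}"
    have Zo: "openin (top_of_set ?X) ?Z"
      by (rule smooth_on_openin_preimage[OF X \<theta>'(1) smooth_on_openin[OF ce]])
    have Z: "chart_map ?k ` (chart_dom ?k \<inter> chart_dom e) = ?Z"
    proof
      show "chart_map ?k ` (chart_dom ?k \<inter> chart_dom e) \<subseteq> ?Z"
        using \<theta>(2) inv(1) by auto
      show "?Z \<subseteq> chart_map ?k ` (chart_dom ?k \<inter> chart_dom e)"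
      proof
        fix y assume "y \<in> ?Z"
        then obtain p where p: "y \<in> W'" "p \<in> chart_dom c" "p \<in> chart_dom e" "\<theta>' y = chart_map c p" by auto
        then have "chart_map c p \<in> W" "\<theta> (chart_map c p) = y" using \<theta>'(2) inv(2)[OF p(1)] by auto
        then show "y \<in> chart_map ?k ` (chart_dom ?k \<inter> chart_dom e)"
          using p by (auto intro!: image_eqI[of _ _ p])
      qed
    qed
    have "smooth_on ?X ?Z (chart_model e) (\<lambda>y. (chart_map e \<circ> chart_inv c) (\<theta>' y))"
      by (rule smooth_on_compose[OF X X chart_subspace[OF E] smooth_on_restrict[OF \<theta>'(1) Zo] ce]) auto
    then have "smooth_on ?X ?Z (chart_model e) (chart_map e \<circ> chart_inv ?k)"
      by (rule smooth_on_cong[OF X]) (simp add: kinv_eq)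
    then show "smooth_transition ?k e" unfolding smooth_transition_def Z by simp
    let ?O = "chart_map e ` (chart_dom e \<inter> chart_dom c)"
    let ?Z2 = "{y \<in> ?O. (chart_map c \<circ> chart_inv e) y \<in> W}"
    have Z2o: "openin (top_of_set (chart_model e)) ?Z2"
      by (rule smooth_on_openin_preimage[OF chart_subspace[OF E] ec Wo])
    have Z2: "chart_map e ` (chart_dom e \<inter> chart_dom ?k) = ?Z2"
      using chart_inv_map[OF E] by auto
    have "smooth_on (chart_model e) ?Z2 ?X (\<lambda>y. \<theta> ((chart_map c \<circ> chart_inv e) y))"
      by (rule smooth_on_compose[OF chart_subspace[OF E] X X smooth_on_restrict[OF ec Z2o] \<theta>(1)]) auto
    moreover have "(\<lambda>y. \<theta> ((chart_map c \<circ> chart_inv e) y)) = chart_map ?k \<circ> chart_inv e" by auto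
    ultimately show "smooth_transition e ?k" unfolding smooth_transition_def Z2 by simp
  qed
  show "?k \<in> charts M"
  proof -
    have "\<forall>c. is_chart ?T c \<and> (\<forall>d\<in>charts M. smooth_transition c d \<and> smooth_transition d c) \<longrightarrow> c \<in> charts M"
      using M unfolding smooth_manifold_def by (elim conjE)
    from spec[OF this, of ?k] show ?thesis
      by (rule mp) (intro conjI ballI chart, simp_all only: tr)
  qed
qed

lemma smooth_map_local_rep:
  assumes "smooth_map M N f" "c \<in> charts M" "d \<in> charts N"
  shows "smooth_on (chart_model c) (chart_map c ` (chart_dom c \<inter> f -` chart_dom d)) (chart_model d) (local_rep c d f)"
  using assms by (simp add: smooth_map_def)

text \<open>The given charts need not be centred, so the local representative is translated to the
  origin; the new charts translate first and then apply \<open>\<Phi>\<close> or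
  \<open>\<psi>\<close>.\<close>

theorem normal_form_in_charts:
  fixes M :: "('m, 'e::locally_convex) manifold" and N :: "('n, 'f::locally_convex) manifold"
  assumes M: "smooth_manifold M" and N: "smooth_manifold N" and f: "smooth_map M N f"
    and c: "c \<in> charts_around M m" and d: "d \<in> charts_around N (f m)"
    and B: "banach_space_on (chart_model c)"
    and T: "split_operator (chart_model c) (chart_model d)
      (directional_derivative (local_rep c d f) (chart_map c m)) K C Q I"
  shows "has_normal_form_at M N f m"
proof -
  let ?X = "chart_model c" and ?Y = "chart_model d"
  have c': "c \<in> charts M" "m \<in> chart_dom c" and d': "d \<in> charts N" "f m \<in> chart_dom d"
    using c d by (auto simp: charts_around_def)
  note Cc = smooth_manifold_is_chart[OF M c'(1)] and Cd = smooth_manifold_is_chart[OF N d'(1)]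
  note X = chart_subspace[OF Cc] and Y = chart_subspace[OF Cd]
  define x0 where "x0 = chart_map c m"
  define y0 where "y0 = chart_map d (f m)"
  define F0 where "F0 = local_rep c d f"
  define \<Omega>0 where "\<Omega>0 = chart_map c ` (chart_dom c \<inter> f -` chart_dom d)"
  have imgX: "chart_img c \<subseteq> ?X" "chart_img d \<subseteq> ?Y"
    using chart_img_openin[OF Cc] chart_img_openin[OF Cd] openin_imp_subset by blast+
  have x0: "x0 \<in> \<Omega>0" "x0 \<in> ?X" "- x0 \<in> ?X" and y0: "y0 \<in> ?Y" "- y0 \<in> ?Y"
    using c' d' imgX X Y by (auto simp: x0_def y0_def \<Omega>0_def intro: subspace_neg)
  have F0: "smooth_on ?X \<Omega>0 ?Y F0"
    unfolding F0_def \<Omega>0_def by (rule smooth_map_local_rep[OF f c'(1) d'(1)])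
  have F0x0: "F0 x0 = y0"
    using chart_inv_map[OF Cc c'(2)] by (simp add: F0_def local_rep_def x0_def y0_def)
  define \<Omega> where "\<Omega> = {x \<in> ?X. x + x0 \<in> \<Omega>0}"
  have \<Omega>o: "openin (top_of_set ?X) \<Omega>"
    unfolding \<Omega>_def by (rule smooth_on_openin_preimage[OF X smooth_on_translation[OF X x0(2)] smooth_on_openin[OF F0]])
  have \<Omega>0: "0 \<in> \<Omega>" using x0 subspace_0[OF X] by (simp add: \<Omega>_def)
  have sh: "smooth_on ?X \<Omega> ?X (\<lambda>x. x + x0)"
    by (rule smooth_on_restrict[OF smooth_on_translation[OF X x0(2)] \<Omega>o]) (auto simp: \<Omega>_def)
  have F0sh: "smooth_on ?X \<Omega> ?Y (\<lambda>x. F0 (x + x0))"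
    by (rule smooth_on_compose[OF X X Y sh F0]) (auto simp: \<Omega>_def)
  define F where "F x = F0 (x + x0) + - y0" for x
  have F: "smooth_on ?X \<Omega> ?Y F"
    unfolding F_def
    by (rule smooth_on_compose[OF X Y Y F0sh smooth_on_translation[OF Y y0(2)] smooth_on_image[OF F0sh]])
  have F00: "F 0 = 0" using F0x0 by (simp add: F_def)
  have dF: "directional_derivative F 0 = directional_derivative F0 x0"
    unfolding directional_derivative_def F_def by (simp add: add.commute)
  have T': "split_operator ?X ?Y (directional_derivative F 0) K C Q I"
    using T by (simp add: dF F0_def x0_def)
  from local_normal_form[OF B F \<Omega>0 F00 T']
  obtain U' U \<Phi> G W \<psi> \<psi>' fsing where *: "U' \<subseteq> \<Omega>" "0 \<in> U'" "smooth_on ?X U' ?X \<Phi>" "\<Phi> 0 = 0" "\<Phi> ` U' \<subseteq> U"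
    "smooth_on ?X U ?X G" "G ` U \<subseteq> U'" "\<forall>x\<in>U'. G (\<Phi> x) = x" "\<forall>z\<in>U. \<Phi> (G z) = z"
    "0 \<in> W" "smooth_on ?Y W ?Y \<psi>" "\<psi> ` W \<subseteq> W" "smooth_on ?Y W ?Y \<psi>'" "\<psi>' ` W \<subseteq> W" "\<psi> 0 = 0"
    "\<forall>y\<in>W. \<psi>' (\<psi> y) = y" "\<forall>y\<in>W. \<psi> (\<psi>' y) = y" "F ` U' \<subseteq> W"
    and nf: "abstract_normal_form ?X K C ?Y Q I (directional_derivative F 0) U fsing"
    and eq: "\<forall>x\<in>U'. \<psi> (F x) = normal_form_map K C (directional_derivative F 0) fsing (\<Phi> x)"
    by (elim exE conjE) (rule that; assumption)
  define W1 where "W1 = {x \<in> ?X. x + - x0 \<in> U'}"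
  have W1o: "openin (top_of_set ?X) W1"
    unfolding W1_def by (rule smooth_on_openin_preimage[OF X smooth_on_translation[OF X x0(3)] smooth_on_openin[OF *(3)]])
  have W1\<Omega>: "W1 \<subseteq> \<Omega>0" using *(1) by (auto simp: W1_def \<Omega>_def)
  have \<Omega>0img: "\<Omega>0 \<subseteq> chart_img c" by (auto simp: \<Omega>0_def)
  have \<theta>: "smooth_on ?X W1 ?X (\<lambda>x. \<Phi> (x + - x0))"
    by (rule smooth_on_compose[OF X X X smooth_on_restrict[OF smooth_on_translation[OF X x0(3)] W1o] *(3)])
      (auto simp: W1_def)
  have \<theta>': "smooth_on ?X U ?X (\<lambda>z. G z + x0)"
    by (rule smooth_on_compose[OF X X X *(6) smooth_on_translation[OF X x0(2)] smooth_on_image[OF *(6)]])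
  have \<theta>'W: "(\<lambda>z. G z + x0) ` U \<subseteq> W1"
    using *(7) smooth_on_image[OF *(6)] x0 X by (auto simp: W1_def intro: subspace_add)
  define \<kappa> where "\<kappa> = recharted c W1 (\<lambda>x. \<Phi> (x + - x0))"
  have W1c: "W1 \<subseteq> chart_img c" using W1\<Omega> \<Omega>0img by (rule order_trans)
  have W1U: "(\<lambda>x. \<Phi> (x + - x0)) ` W1 \<subseteq> U" using *(5) by (auto simp: W1_def)
  have inv1: "G (\<Phi> (x + - x0)) + x0 = x" if "x \<in> W1" for x
  proof -
    have "x + - x0 \<in> U'" using that by (simp add: W1_def)
    then have "G (\<Phi> (x + - x0)) = x + - x0" by (rule bspec[OF *(8)])
    then show ?thesis by simp
  qed
  have inv2: "\<Phi> (G z + x0 + - x0) = z" if "z \<in> U" for z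
    using bspec[OF *(9) that] by simp
  note \<kappa> = recharted_in_atlas[OF M c'(1) W1c \<theta> W1U \<theta>' \<theta>'W inv1 inv2, folded \<kappa>_def]
  have m\<kappa>: "m \<in> chart_dom \<kappa>" "chart_map \<kappa> m = 0"
    using c'(2) x0 *(2,4) by (simp_all add: \<kappa>_def W1_def x0_def)
  \<comment> \<open>\<open>W1\<close> lies in the chart image of \<open>c\<close> because
    \<open>U' \<subseteq> \<Omega>\<close>, but \<open>W\<close> is not confined to the chart image
    of \<open>d\<close>. Hence the intersection here, and \<open>V\<close> is the image of what
    remains.\<close>
  define W2 where "W2 = {y \<in> chart_img d. y + - y0 \<in> W}"
  have W2': "W2 = chart_img d \<inter> {y \<in> ?Y. y + - y0 \<in> W}" using imgX by (auto simp: W2_def)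
  have W2o: "openin (top_of_set ?Y) W2"
    unfolding W2' by (intro openin_Int chart_img_openin[OF Cd]
        smooth_on_openin_preimage[OF Y smooth_on_translation[OF Y y0(2)] smooth_on_openin[OF *(11)]])
  have \<eta>: "smooth_on ?Y W2 ?Y (\<lambda>y. \<psi> (y + - y0))"
    by (rule smooth_on_compose[OF Y Y Y smooth_on_restrict[OF smooth_on_translation[OF Y y0(2)] W2o] *(11)])
      (use imgX in \<open>auto simp: W2_def\<close>)
  define V where "V = {z \<in> W. \<psi>' z + y0 \<in> chart_img d}"
  have s': "smooth_on ?Y W ?Y (\<lambda>z. \<psi>' z + y0)"
    by (rule smooth_on_compose[OF Y Y Y *(13) smooth_on_translation[OF Y y0(1)] smooth_on_image[OF *(13)]])
  have Vo: "openin (top_of_set ?Y) V"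
    unfolding V_def by (rule smooth_on_openin_preimage[OF Y s' chart_img_openin[OF Cd]])
  have \<eta>': "smooth_on ?Y V ?Y (\<lambda>z. \<psi>' z + y0)"
    by (rule smooth_on_restrict[OF s' Vo]) (auto simp: V_def)
  define \<rho> where "\<rho> = recharted d W2 (\<lambda>y. \<psi> (y + - y0))"
  have \<rho>: "\<rho> \<in> charts N"
    unfolding \<rho>_def
    by (rule recharted_in_atlas(1)[OF N d'(1) _ \<eta> _ \<eta>'])
      (use *(12,14,16,17) in \<open>auto simp: W2_def V_def image_subset_iff\<close>)
  have m\<rho>: "f m \<in> chart_dom \<rho>" "chart_map \<rho> (f m) = 0"
    using d'(2) *(10,15) by (simp_all add: \<rho>_def W2_def y0_def)
  have dom: "f p \<in> chart_dom \<rho> \<and> chart_map \<rho> (f p) = normal_form_map K C (directional_derivative F 0) fsing (chart_map \<kappa> p)"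
    if p: "p \<in> chart_dom \<kappa>" for p
  proof -
    have p': "p \<in> chart_dom c" "chart_map c p \<in> W1" using p by (simp_all add: \<kappa>_def)
    let ?x = "chart_map c p + - x0"
    have x: "?x \<in> U'" using p' by (simp add: W1_def)
    \<comment> \<open>\<open>\<Omega>0\<close> is a chart image and only yields some point
      \<open>q\<close> with \<open>f q\<close> in the domain of \<open>d\<close>; injectivity of the
      chart identifies it with \<open>p\<close>.\<close>
    obtain q where q: "q \<in> chart_dom c" "f q \<in> chart_dom d" "chart_map c p = chart_map c q"
      using W1\<Omega> p' by (auto simp: \<Omega>0_def)
    then have fp: "f p \<in> chart_dom d" using inj_onD[OF chart_inj[OF Cc] q(3)] p' by simp
    have F: "F ?x = chart_map d (f p) + - y0"
      using chart_inv_map[OF Cc p'(1)] by (simp add: F_def F0_def local_rep_def)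
    then have "chart_map d (f p) \<in> W2" using *(18) x fp by (auto simp: W2_def)
    then show ?thesis
      using fp eq x F by (auto simp: \<rho>_def \<kappa>_def)
  qed
  show ?thesis
    unfolding has_normal_form_at_def
  proof (intro exI conjI)
    show "abstract_normal_form ?X K C ?Y Q I (directional_derivative F 0) U fsing" by (rule nf)
    show "chart_at M m \<kappa>" "chart_at N (f m) \<rho>"
      using \<kappa> \<rho> m\<kappa> m\<rho> by (simp_all add: chart_at_def charts_around_def)
    show "chart_model \<kappa> = ?X" "chart_model \<rho> = ?Y" by (simp_all add: \<kappa>_def \<rho>_def)
    show "chart_img \<kappa> = U" by (rule \<kappa>(2))
  qed (use dom in auto)
qed

section \<open>Regular tangent maps\<close>

text \<open>The inverse is part of the data because transported projections and inverses are
  formulas in it.\<close>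

definition linear_homeomorphism ::
    "'a::locally_convex set \<Rightarrow> 'b::locally_convex set \<Rightarrow> ('a \<Rightarrow> 'b) \<Rightarrow> ('b \<Rightarrow> 'a) \<Rightarrow> bool" where
  "linear_homeomorphism X Y \<phi> j \<longleftrightarrow>
     subspace X \<and> subspace Y \<and> linear_on X \<phi> \<and> linear_on Y j \<and> continuous_on X \<phi> \<and> continuous_on Y j \<and>
     (\<forall>x\<in>X. \<phi> x \<in> Y \<and> j (\<phi> x) = x) \<and> (\<forall>y\<in>Y. j y \<in> X \<and> \<phi> (j y) = y)"

lemma linear_homeomorphismD:
  assumes "linear_homeomorphism X Y \<phi> j"
  shows "subspace X" "subspace Y" "linear_on X \<phi>" "linear_on Y j" "continuous_on X \<phi>" "continuous_on Y j"
    "\<And>x. x \<in> X \<Longrightarrow> \<phi> x \<in> Y" "\<And>x. x \<in> X \<Longrightarrow> j (\<phi> x) = x" "\<And>y. y \<in> Y \<Longrightarrow> j y \<in> X" "\<And>y. y \<in> Y \<Longrightarrow> \<phi> (j y) = y"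
  using assms by (simp_all add: linear_homeomorphism_def)

lemma subspace_linear_image:
  assumes T: "linear_on X T" and A: "subspace A" "A \<subseteq> X"
  shows "subspace (T ` A)"
proof (rule subspaceI)
  have "0 \<in> A" using A subspace_0 by auto
  then show "0 \<in> T ` A" using linear_on_0[OF T, symmetric] A by blast
  show "x + y \<in> T ` A" if "x \<in> T ` A" "y \<in> T ` A" for x y
  proof -
    obtain a b where ab: "a \<in> A" "b \<in> A" "x = T a" "y = T b" using \<open>x \<in> T ` A\<close> \<open>y \<in> T ` A\<close> by blast
    then have "x + y = T (a + b)"
      using linear_on_add[OF T subsetD[OF A(2) ab(1)] subsetD[OF A(2) ab(2)]] by simp
    then show ?thesis using subspace_add[OF A(1) ab(1,2)] by blast
  qed
  show "c *\<^sub>R x \<in> T ` A" if "x \<in> T ` A" for c x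
  proof -
    obtain a where a: "a \<in> A" "x = T a" using \<open>x \<in> T ` A\<close> by blast
    then have "c *\<^sub>R x = T (c *\<^sub>R a)" using linear_on_scale[OF T subsetD[OF A(2) a(1)]] by simp
    then show ?thesis using subspace_scale[OF A(1) a(1)] by blast
  qed
qed

text \<open>Conjugating the projection onto \<open>A\<close> by \<open>\<phi>\<close> gives the
  continuous projection that \<open>topological_direct_sumI\<close> asks for.\<close>

lemma topological_direct_sum_image:
  assumes \<phi>: "linear_homeomorphism X Y \<phi> j" and AB: "topological_direct_sum X A B"
  shows "topological_direct_sum Y (\<phi> ` A) (\<phi> ` B)"
proof -
  note h = linear_homeomorphismD[OF \<phi>]
  have sub: "subspace A" "subspace B" using AB by (simp_all add: topological_direct_sum_def)
  obtain p q where p: "linear_on X p" "linear_on X q" "continuous_on X p" "continuous_on X q"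
    "\<And>x. x \<in> X \<Longrightarrow> p x \<in> A" "\<And>x. x \<in> X \<Longrightarrow> q x \<in> B" "\<And>x. x \<in> X \<Longrightarrow> p x + q x = x"
    "\<And>a b. a \<in> A \<Longrightarrow> b \<in> B \<Longrightarrow> p (a + b) = a" "\<And>a b. a \<in> A \<Longrightarrow> b \<in> B \<Longrightarrow> q (a + b) = b"
    and AX: "A \<subseteq> X" "B \<subseteq> X" and "\<And>x. x \<in> X \<Longrightarrow> second_component A B x = q x"
    by (rule topological_direct_sum_projections[OF AB]) (rule that; assumption)
  show ?thesis
  proof (rule topological_direct_sumI[where p = "\<lambda>y. \<phi> (p (j y))"])
    show "subspace (\<phi> ` A)" "subspace (\<phi> ` B)" by (rule subspace_linear_image[OF h(3)] sub AX)+
    have "continuous_on Y (\<lambda>y. p (j y))"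
      by (rule continuous_on_compose2[OF p(3) h(6)]) (use h(9) in auto)
    then show "continuous_on Y (\<lambda>y. \<phi> (p (j y)))"
      by (rule continuous_on_compose2[OF h(5)]) (use h(9) p(5) AX in auto)
    show "\<phi> (p (j (a + b))) = a" if ab: "a \<in> \<phi> ` A" "b \<in> \<phi> ` B" for a b
    proof -
      obtain x y where xy: "x \<in> A" "a = \<phi> x" "y \<in> B" "b = \<phi> y" using ab by blast
      then have X: "x \<in> X" "y \<in> X" using AX by auto
      have "j (a + b) = x + y"
        using xy h(8)[OF X(1)] h(8)[OF X(2)] linear_on_add[OF h(4) h(7)[OF X(1)] h(7)[OF X(2)]] by simp
      then show ?thesis using p(8) xy by simp
    qed
    show "y - \<phi> (p (j y)) \<in> \<phi> ` B" if y: "y \<in> Y" for y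
    proof -
      have jy: "j y \<in> X" by (rule h(9)[OF y])
      have "y = \<phi> (p (j y) + q (j y))" using p(7)[OF jy] h(10)[OF y] by simp
      also have "\<dots> = \<phi> (p (j y)) + \<phi> (q (j y))"
        using p(5,6)[OF jy] AX by (intro linear_on_add[OF h(3)]) auto
      finally have "y - \<phi> (p (j y)) = \<phi> (q (j y))" by (simp add: diff_eq_eq add.commute)
      then show ?thesis using p(6)[OF jy] by blast
    qed
  qed (use h p AX in auto)
qed

lemma topological_direct_sum_commute:
  assumes "topological_direct_sum X A B" shows "topological_direct_sum X B A"
proof -
  have sub: "subspace X" "subspace A" "subspace B" using assms by (simp_all add: topological_direct_sum_def)
  obtain p q where p: "linear_on X p" "linear_on X q" "continuous_on X p" "continuous_on X q"
    "\<And>x. x \<in> X \<Longrightarrow> p x \<in> A" "\<And>x. x \<in> X \<Longrightarrow> q x \<in> B" "\<And>x. x \<in> X \<Longrightarrow> p x + q x = x"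
    "\<And>a b. a \<in> A \<Longrightarrow> b \<in> B \<Longrightarrow> p (a + b) = a" "\<And>a b. a \<in> A \<Longrightarrow> b \<in> B \<Longrightarrow> q (a + b) = b"
    and AX: "A \<subseteq> X" "B \<subseteq> X" and "\<And>x. x \<in> X \<Longrightarrow> second_component A B x = q x"
    by (rule topological_direct_sum_projections[OF assms]) (rule that; assumption)
  show ?thesis
  proof (rule topological_direct_sumI[OF sub(1,3,2) AX(2,1) p(4,6)])
    show "x - q x \<in> A" if "x \<in> X" for x using p(5,7)[OF that] by (metis add_diff_cancel_right')
    show "q (b + a) = b" if "b \<in> B" "a \<in> A" for a b using p(9)[OF that(2,1)] by (simp add: add.commute)
  qed
qed

text \<open>Serves to pass from the tangent map to its expression in charts; the inverse on the
  image is conjugated along with everything else.\<close>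

lemma split_operator_image:
  assumes \<phi>: "linear_homeomorphism X' X \<phi> j" and \<psi>: "linear_homeomorphism Y' Y \<psi> k"
    and T': "split_operator X' Y' T' K C Q I"
    and T: "linear_on X T" "\<And>x. x \<in> X \<Longrightarrow> T x = \<psi> (T' (j x))"
  shows "split_operator X Y T (\<phi> ` K) (\<phi> ` C) (\<psi> ` Q) (\<psi> ` I)"
proof -
  note h = linear_homeomorphismD[OF \<phi>] and g = linear_homeomorphismD[OF \<psi>]
  have ds: "topological_direct_sum X' K C" "topological_direct_sum Y' Q I"
    and K0: "\<And>x. x \<in> K \<Longrightarrow> T' x = 0"
    and hom: "homeomorphic_map (top_of_set C) (top_of_set I) T'"
    using T' by (simp_all add: split_operator_def)
  have sub: "K \<subseteq> X'" "C \<subseteq> X'" "I \<subseteq> Y'"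
    using ds by (auto simp: topological_direct_sum_def dest: closedin_imp_subset)
  obtain S where S: "homeomorphic_maps (top_of_set C) (top_of_set I) T' S"
    using hom unfolding homeomorphic_map_maps by (rule exE)
  have T'c: "continuous_on C T'" "\<And>x. x \<in> C \<Longrightarrow> T' x \<in> I" "\<And>x. x \<in> C \<Longrightarrow> S (T' x) = x"
    and Sc: "continuous_on I S" "\<And>y. y \<in> I \<Longrightarrow> S y \<in> C" "\<And>y. y \<in> I \<Longrightarrow> T' (S y) = y"
    using S by (auto simp: homeomorphic_maps_def continuous_map_subtopology_eu)
  have "homeomorphic_maps (top_of_set (\<phi> ` C)) (top_of_set (\<psi> ` I)) T (\<lambda>y. \<phi> (S (k y)))"
    unfolding homeomorphic_maps_def
  proof (intro conjI ballI)
    have T\<phi>: "T (\<phi> x) = \<psi> (T' x)" if "x \<in> C" for x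
      using T(2)[OF h(7)] h(8) that sub by auto
    have CX: "\<phi> ` C \<subseteq> X" "\<psi> ` I \<subseteq> Y" using h(7) g(7) sub by auto
    have jC: "j ` \<phi> ` C \<subseteq> C" using h(8) sub by auto
    have kI: "k ` \<psi> ` I \<subseteq> I" using g(8) sub by auto
    have "continuous_on (\<phi> ` C) (\<lambda>x. T' (j x))"
      by (rule continuous_on_compose2[OF T'c(1) continuous_on_subset[OF h(6) CX(1)] jC])
    then have "continuous_on (\<phi> ` C) (\<lambda>x. \<psi> (T' (j x)))"
      by (rule continuous_on_compose2[OF g(5)])
        (rule image_subsetI, rule subsetD[OF sub(3)], rule T'c(2), rule subsetD[OF jC], rule imageI)
    then have "continuous_on (\<phi> ` C) T"
      by (rule continuous_on_eq) (use T(2) CX in auto)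
    then show "continuous_map (top_of_set (\<phi> ` C)) (top_of_set (\<psi> ` I)) T"
      using T\<phi> T'c(2) by (auto simp: continuous_map_subtopology_eu)
    have "continuous_on (\<psi> ` I) (\<lambda>y. S (k y))"
      by (rule continuous_on_compose2[OF Sc(1) continuous_on_subset[OF g(6) CX(2)] kI])
    then have "continuous_on (\<psi> ` I) (\<lambda>y. \<phi> (S (k y)))"
      by (rule continuous_on_compose2[OF h(5)])
        (rule image_subsetI, rule subsetD[OF sub(2)], rule Sc(2), rule subsetD[OF kI], rule imageI)
    then show "continuous_map (top_of_set (\<psi> ` I)) (top_of_set (\<phi> ` C)) (\<lambda>y. \<phi> (S (k y)))"
      using kI Sc(2) by (auto simp: continuous_map_subtopology_eu)
    show "\<phi> (S (k (T x))) = x" if x: "x \<in> topspace (top_of_set (\<phi> ` C))" for x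
    proof -
      obtain u where u: "u \<in> C" "x = \<phi> u" using x by auto
      then have "k (T x) = T' u" using T\<phi>[OF u(1)] g(8)[of "T' u"] T'c(2)[OF u(1)] sub by auto
      then show ?thesis using T'c(3)[OF u(1)] u by simp
    qed
    show "T (\<phi> (S (k y))) = y" if y: "y \<in> topspace (top_of_set (\<psi> ` I))" for y
    proof -
      obtain u where u: "u \<in> I" "y = \<psi> u" using y by auto
      then have "k y = u" using g(8)[of u] sub by auto
      then show ?thesis using T\<phi>[OF Sc(2)[OF u(1)]] Sc(3)[OF u(1)] u by simp
    qed
  qed
  moreover have "T x = 0" if x: "x \<in> \<phi> ` K" for x
  proof -
    obtain u where u: "u \<in> K" "x = \<phi> u" using x by auto
    then have "x \<in> X" "j x = u" using h(7,8) sub by auto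
    then have "T x = \<psi> 0" using T(2) K0[OF u(1)] by simp
    then show ?thesis using linear_on_0[OF g(3) subspace_0[OF g(1)]] by simp
  qed
  ultimately show ?thesis
    using T(1) topological_direct_sum_image[OF \<phi> ds(1)] topological_direct_sum_image[OF \<psi> ds(2)]
    by (auto simp: split_operator_def homeomorphic_map_maps)
qed

lemma kernel_complement:
  assumes T: "linear_on X T" and C: "topological_direct_sum X {x \<in> X. T x = 0} C"
  shows "x \<in> X \<Longrightarrow> T (second_component {x \<in> X. T x = 0} C x) = T x"
    and "inj_on T C" and "T ` C = T ` X"
proof -
  let ?K = "{x \<in> X. T x = 0}"
  have sub: "subspace X" "subspace ?K" "subspace C" using C by (simp_all add: topological_direct_sum_def)
  obtain p q where "linear_on X p" "linear_on X q" "continuous_on X p" "continuous_on X q"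
    and p: "\<And>x. x \<in> X \<Longrightarrow> p x \<in> ?K" "\<And>x. x \<in> X \<Longrightarrow> q x \<in> C" "\<And>x. x \<in> X \<Longrightarrow> p x + q x = x"
    "\<And>a b. a \<in> ?K \<Longrightarrow> b \<in> C \<Longrightarrow> p (a + b) = a" "\<And>a b. a \<in> ?K \<Longrightarrow> b \<in> C \<Longrightarrow> q (a + b) = b"
    and KC: "?K \<subseteq> X" "C \<subseteq> X" and sec: "\<And>x. x \<in> X \<Longrightarrow> second_component ?K C x = q x"
    by (rule topological_direct_sum_projections[OF C]) (rule that; assumption)
  have Tq: "T (q x) = T x" if "x \<in> X" for x
  proof -
    have "T (p x + q x) = T (p x) + T (q x)"
      using p(1,2)[OF that] KC by (intro linear_on_add[OF T]) auto
    then show ?thesis using p(1,3)[OF that] by simp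
  qed
  then show "x \<in> X \<Longrightarrow> T (second_component ?K C x) = T x" by (simp add: sec)
  show "inj_on T C"
  proof (rule inj_onI)
    fix x y assume xy: "x \<in> C" "y \<in> C" "T x = T y"
    then have X: "x \<in> X" "y \<in> X" using KC by auto
    have d: "x - y \<in> ?K" "x - y \<in> C"
      using xy linear_on_diff[OF T sub(1) X] subspace_diff[OF sub(1) X] subspace_diff[OF sub(3) xy(1,2)] by simp_all
    have "q (x - y) = x - y" using p(5)[OF subspace_0[OF sub(2)] d(2)] by simp
    moreover have "q (x - y) = 0" using p(5)[OF d(1) subspace_0[OF sub(3)]] by simp
    ultimately show "x = y" by simp
  qed
  show "T ` C = T ` X"
  proof
    show "T ` C \<subseteq> T ` X" using KC(2) by (rule image_mono)
    show "T ` X \<subseteq> T ` C"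
    proof (rule image_subsetI)
      fix x assume "x \<in> X"
      then show "T x \<in> T ` C" using Tq p(2) by (intro image_eqI[of _ _ "q x"]) simp_all
    qed
  qed
qed

text \<open>Relative openness makes the algebraic inverse on the image continuous: for
  \<open>U\<close> open in \<open>C\<close>, T U is also the image of the open set of points with
  \<open>C\<close>-component in \<open>U\<close>, since \<open>T\<close> ignores the kernel
  component.\<close>

lemma regular_operator_split:
  assumes "regular_operator X Y T"
  shows "\<exists>K C Q I. split_operator X Y T K C Q I"
proof -
  define K where "K = {x \<in> X. T x = 0}"
  have T: "linear_on X T" "continuous_on X T" "open_map (top_of_set X) (top_of_set (T ` X)) T"
    and "complemented_in X K" "complemented_in Y (T ` X)"
    using assms by (simp_all add: regular_operator_def K_def)
  then obtain C Q where C: "topological_direct_sum X K C" and Q: "topological_direct_sum Y (T ` X) Q"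
    by (auto simp: complemented_in_def)
  have X: "subspace X" "subspace C" using C by (simp_all add: topological_direct_sum_def)
  obtain p q where p: "linear_on X p" "linear_on X q" "continuous_on X p" "continuous_on X q"
    "\<And>x. x \<in> X \<Longrightarrow> p x \<in> K" "\<And>x. x \<in> X \<Longrightarrow> q x \<in> C" "\<And>x. x \<in> X \<Longrightarrow> p x + q x = x"
    "\<And>a b. a \<in> K \<Longrightarrow> b \<in> C \<Longrightarrow> p (a + b) = a" "\<And>a b. a \<in> K \<Longrightarrow> b \<in> C \<Longrightarrow> q (a + b) = b"
    and KC: "K \<subseteq> X" "C \<subseteq> X" and sec: "\<And>x. x \<in> X \<Longrightarrow> second_component K C x = q x"
    by (rule topological_direct_sum_projections[OF C]) (rule that; assumption)
  note ker = kernel_complement[OF T(1) C[unfolded K_def], folded K_def]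
  have Tq: "T (q x) = T x" if "x \<in> X" for x using ker(1)[OF that] sec[OF that] by simp
  have K0: "0 \<in> K" using X linear_on_0[OF T(1)] subspace_0 by (auto simp: K_def)
  have qC: "q x = x" if "x \<in> C" for x using p(9)[OF K0 that] by simp
  have "homeomorphic_map (top_of_set C) (top_of_set (T ` X)) T"
  proof (rule bijective_open_imp_homeomorphic_map)
    show "continuous_map (top_of_set C) (top_of_set (T ` X)) T"
      using continuous_on_subset[OF T(2) KC(2)] KC by (auto simp: continuous_map_subtopology_eu)
    show "T ` topspace (top_of_set C) = topspace (top_of_set (T ` X))" using ker(3) by simp
    show "inj_on T (topspace (top_of_set C))" using ker(2) by simp
    show "open_map (top_of_set C) (top_of_set (T ` X)) T"
      unfolding open_map_def
    proof (intro allI impI)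
      fix U assume U: "openin (top_of_set C) U"
      have "openin (top_of_set X) (X \<inter> q -` U)"
        by (rule continuous_openin_preimage[OF p(4) _ U]) (use p(6) in auto)
      then have "openin (top_of_set (T ` X)) (T ` (X \<inter> q -` U))"
        using T(3) by (simp add: open_map_def)
      moreover have "T ` (X \<inter> q -` U) = T ` U"
      proof (intro equalityI subsetI)
        fix y assume "y \<in> T ` (X \<inter> q -` U)"
        then obtain x where x: "x \<in> X" "q x \<in> U" "y = T x" by blast
        then show "y \<in> T ` U" using Tq[OF x(1)] by (intro image_eqI[of _ _ "q x"]) simp_all
      next
        fix y assume "y \<in> T ` U"
        then obtain x where x: "x \<in> U" "y = T x" by blast
        then have "x \<in> C" using openin_imp_subset[OF U] by blast
        then show "y \<in> T ` (X \<inter> q -` U)" using x qC KC by (intro image_eqI[of _ _ x]) auto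
      qed
      ultimately show "openin (top_of_set (T ` X)) (T ` U)" by simp
    qed
  qed
  moreover have "\<forall>x\<in>K. T x = 0" by (simp add: K_def)
  ultimately show ?thesis
    using C topological_direct_sum_commute[OF Q] T(1) unfolding split_operator_def by blast
qed

section \<open>Tangent spaces and tangent maps in charts\<close>

lemma smooth_on_transition:
  assumes "smooth_manifold M" "c \<in> charts M" "d \<in> charts M"
  shows "smooth_on (chart_model c) (chart_map c ` (chart_dom c \<inter> chart_dom d)) (chart_model d) (chart_map d \<circ> chart_inv c)"
  using smooth_manifold_transition[OF assms] by (simp add: smooth_transition_def)

lemma charts_aroundD:
  assumes "smooth_manifold M" "c \<in> charts_around M m"
  shows "c \<in> charts M" "m \<in> chart_dom c" "is_chart (mtop M) c" "subspace (chart_model c)"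
    "chart_inv c (chart_map c m) = m"
proof -
  show c: "c \<in> charts M" "m \<in> chart_dom c" using assms by (simp_all add: charts_around_def)
  show C: "is_chart (mtop M) c" by (rule smooth_manifold_is_chart[OF assms(1) c(1)])
  show "subspace (chart_model c)" "chart_inv c (chart_map c m) = m"
    by (rule chart_subspace[OF C], rule chart_inv_map[OF C c(2)])
qed

text \<open>The chain rule for factoring through the transition from \<open>c\<close> to
  \<open>e\<close>. With \<open>g\<close> a chart map it gives the cocycle relation of tangent
  vectors, with \<open>g\<close> a chart map after \<open>f\<close> the independence of the tangent
  map from the chart.\<close>

lemma derivative_change_of_chart:
  assumes M: "smooth_manifold M" and c: "c \<in> charts_around M m" and e: "e \<in> charts_around M m"
    and Z: "subspace Z" and D: "m \<in> D"
    and g: "smooth_on (chart_model e) (chart_map e ` (chart_dom e \<inter> D)) Z (g \<circ> chart_inv e)"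
    and u: "u \<in> chart_model c"
  shows "directional_derivative (g \<circ> chart_inv c) (chart_map c m) u =
    directional_derivative (g \<circ> chart_inv e) (chart_map e m)
      (directional_derivative (chart_map e \<circ> chart_inv c) (chart_map c m) u)"
proof -
  note c' = charts_aroundD[OF M c] and e' = charts_aroundD[OF M e]
  let ?t = "chart_map e \<circ> chart_inv c"
  let ?V = "chart_map e ` (chart_dom e \<inter> D)"
  note t = smooth_on_transition[OF M c'(1) e'(1)]
  define U where "U = {x \<in> chart_map c ` (chart_dom c \<inter> chart_dom e). ?t x \<in> ?V}"
  have Uo: "openin (top_of_set (chart_model c)) U"
    unfolding U_def by (rule smooth_on_openin_preimage[OF c'(4) t smooth_on_openin[OF g]])
  have tU: "smooth_on (chart_model c) U (chart_model e) ?t"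
    by (rule smooth_on_restrict[OF t Uo]) (auto simp: U_def)
  have m: "chart_map c m \<in> U" using c' e' D by (auto simp: U_def)
  have sub: "?t ` U \<subseteq> ?V" by (auto simp: U_def)
  have eq: "(g \<circ> chart_inv e) (?t x) = (g \<circ> chart_inv c) x" if x: "x \<in> U" for x
  proof -
    obtain p where p: "p \<in> chart_dom c" "p \<in> chart_dom e" "x = chart_map c p"
      using x unfolding U_def by blast
    then show ?thesis by (simp add: chart_inv_map[OF c'(3)] chart_inv_map[OF e'(3)])
  qed
  have comp: "smooth_on (chart_model c) U Z (\<lambda>x. (g \<circ> chart_inv e) (?t x))"
    by (rule smooth_on_compose[OF c'(4) e'(4) Z tU g sub])
  have "directional_derivative (g \<circ> chart_inv c) (chart_map c m) u =
      directional_derivative (\<lambda>x. (g \<circ> chart_inv e) (?t x)) (chart_map c m) u"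
    by (rule directional_derivative_cong[OF c'(4) Uo m u eq comp])
  also have "\<dots> = directional_derivative (g \<circ> chart_inv e) (?t (chart_map c m))
      (directional_derivative ?t (chart_map c m) u)"
    by (rule directional_derivative_chain[OF c'(4) e'(4) tU g sub m u])
  finally show ?thesis using c'(5) by simp
qed

text \<open>One coordinate vector determines all others through transition derivatives, and the
  cocycle relation makes this extension a tangent vector. Its continuity is checked coordinatewise,
  as the topology is that of pointwise convergence.\<close>

lemma tangent_space_chart:
  fixes M :: "('m, 'e::locally_convex) manifold"
  assumes M: "smooth_manifold M" and c: "c \<in> charts_around M m"
  shows "linear_homeomorphism (tangent_space M m) (chart_model c) (\<lambda>v. v c)
    (\<lambda>u e. if e \<in> charts_around M m
        then directional_derivative (chart_map e \<circ> chart_inv c) (chart_map c m) u else 0)"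
    (is "linear_homeomorphism ?T ?X _ ?j")
proof -
  note c' = charts_aroundD[OF M c]
  let ?d = "\<lambda>c e. directional_derivative (chart_map e \<circ> chart_inv c) (chart_map c m)"
  have tr: "smooth_on (chart_model a) (chart_map a ` (chart_dom a \<inter> chart_dom b)) (chart_model b) (chart_map b \<circ> chart_inv a)"
    and am: "chart_map a m \<in> chart_map a ` (chart_dom a \<inter> chart_dom b)" and a: "subspace (chart_model a)"
    if "a \<in> charts_around M m" "b \<in> charts_around M m" for a b
    using smooth_on_transition[OF M] charts_aroundD[OF M that(1)] charts_aroundD[OF M that(2)] by auto
  have lin: "linear_on (chart_model a) (?d a b)" and cont: "continuous_on (chart_model a) (?d a b)"
    and rng: "\<And>u. u \<in> chart_model a \<Longrightarrow> ?d a b u \<in> chart_model b"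
    if "a \<in> charts_around M m" "b \<in> charts_around M m" for a b
    using smooth_on_derivative_linear[OF a[OF that] tr[OF that] am[OF that]]
      smooth_on_derivative_continuous[OF a[OF that] tr[OF that] am[OF that]]
      smooth_on_derivative_range[OF a[OF that] tr[OF that] am[OF that]] by auto
  have cocycle: "?d c b u = ?d a b (?d c a u)"
    if ab: "a \<in> charts_around M m" "b \<in> charts_around M m" and u: "u \<in> ?X" for a b u
    by (rule derivative_change_of_chart[OF M c ab(1) charts_aroundD(4)[OF M ab(2)] charts_aroundD(2)[OF M ab(2)]
          tr[OF ab] u])
  have dcc: "?d c c u = u" if u: "u \<in> ?X" for u
  proof (rule directional_derivative_eq)
    have "has_directional_derivative (\<lambda>x. x) u (chart_map c m) u"
      using curve_derivative_line by (simp add: has_directional_derivative_iff_curve)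
    then show "has_directional_derivative (chart_map c \<circ> chart_inv c) u (chart_map c m) u"
      by (rule has_directional_derivative_cong[OF c'(4) chart_img_openin[OF c'(3)] _ u, rotated 2])
        (use c'(2) chart_map_inv[OF c'(3)] in auto)
  qed
  have TI: "v \<in> ?T" if "\<And>a. a \<in> charts_around M m \<Longrightarrow> v a \<in> chart_model a"
      "\<And>a. a \<notin> charts_around M m \<Longrightarrow> v a = 0"
      "\<And>a b. a \<in> charts_around M m \<Longrightarrow> b \<in> charts_around M m \<Longrightarrow> v b = ?d a b (v a)" for v
    unfolding tangent_space_def mem_Collect_eq by (intro conjI ballI allI impI that)
  have TD: "\<And>a. a \<in> charts_around M m \<Longrightarrow> v a \<in> chart_model a"
      "\<And>a. a \<notin> charts_around M m \<Longrightarrow> v a = 0"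
      "\<And>a b. a \<in> charts_around M m \<Longrightarrow> b \<in> charts_around M m \<Longrightarrow> v b = ?d a b (v a)" if "v \<in> ?T" for v
    using that unfolding tangent_space_def mem_Collect_eq by blast+
  have T: "subspace ?T"
  proof (rule subspaceI)
    show "0 \<in> ?T"
      by (rule TI) (simp_all add: linear_on_0[OF lin] subspace_0[OF a])
    show "x + y \<in> ?T" if x: "x \<in> ?T" and y: "y \<in> ?T" for x y
    proof (rule TI)
      fix a' b assume ab: "a' \<in> charts_around M m" "b \<in> charts_around M m"
      show "(x + y) b = ?d a' b ((x + y) a')"
        using linear_on_add[OF lin[OF ab] TD(1)[OF x ab(1)] TD(1)[OF y ab(1)]] TD(3)[OF x ab] TD(3)[OF y ab] by simp
    next
      fix a' assume a': "a' \<in> charts_around M m"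
      show "(x + y) a' \<in> chart_model a'"
        using subspace_add[OF a[OF a' a'] TD(1)[OF x a'] TD(1)[OF y a']] by simp
    qed (simp add: TD(2)[OF x] TD(2)[OF y])
    show "r *\<^sub>R x \<in> ?T" if x: "x \<in> ?T" for r x
    proof (rule TI)
      fix a' b assume ab: "a' \<in> charts_around M m" "b \<in> charts_around M m"
      show "(r *\<^sub>R x) b = ?d a' b ((r *\<^sub>R x) a')"
        using linear_on_scale[OF lin[OF ab] TD(1)[OF x ab(1)]] TD(3)[OF x ab] by (simp add: scaleR_fun_def)
    next
      fix a' assume a': "a' \<in> charts_around M m"
      show "(r *\<^sub>R x) a' \<in> chart_model a'"
        using subspace_scale[OF a[OF a' a'] TD(1)[OF x a']] by (simp add: scaleR_fun_def)
    qed (simp add: TD(2)[OF x] scaleR_fun_def)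
  qed
  have jT: "?j u \<in> ?T" if u: "u \<in> ?X" for u
  proof (rule TI)
    fix a' b assume ab: "a' \<in> charts_around M m" "b \<in> charts_around M m"
    show "?j u b = ?d a' b (?j u a')" using cocycle[OF ab u] ab by simp
  next
    fix a' assume a': "a' \<in> charts_around M m"
    show "?j u a' \<in> chart_model a'" using rng[OF c a' u] a' by simp
  qed simp
  have jv: "?j (v c) = v" if v: "v \<in> ?T" for v
  proof
    fix e show "?j (v c) e = v e"
      using TD(3)[OF v c, of e] TD(2)[OF v, of e] by (cases "e \<in> charts_around M m") simp_all
  qed
  have "linear_on ?X ?j"
    using linear_on_add[OF lin[OF c]] linear_on_scale[OF lin[OF c]]
    by (auto simp: linear_on_def fun_eq_iff scaleR_fun_def)
  moreover have "continuous_on ?X ?j"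
  proof (rule continuous_on_coordinatewise_then_product)
    fix e show "continuous_on ?X (\<lambda>u. ?j u e)"
      using cont[OF c] by (cases "e \<in> charts_around M m") auto
  qed
  moreover have "continuous_on ?T (\<lambda>v. v c)"
    by (rule continuous_on_product_then_coordinatewise[OF continuous_on_id])
  moreover have "linear_on ?T (\<lambda>v. v c)" by (simp add: linear_on_def scaleR_fun_def)
  moreover have "v c \<in> ?X" if "v \<in> ?T" for v by (rule TD(1)[OF that c])
  moreover have "?j u c = u" if "u \<in> ?X" for u using dcc[OF that] c by simp
  ultimately show ?thesis
    unfolding linear_homeomorphism_def using T c'(4) jT jv by (intro conjI ballI)
qed

text \<open>\<open>tangent_map\<close> is computed in an arbitrarily chosen chart at
  \<open>m\<close>. After a change of chart to \<open>c\<close>, the derivative in charts is the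
  tangent map conjugated by the evaluations at \<open>c\<close> and \<open>d\<close>, and the
  splitting is carried over.\<close>

theorem regular_tangent_map_split:
  fixes M :: "('m, 'e::locally_convex) manifold" and N :: "('n, 'f::locally_convex) manifold"
  assumes M: "smooth_manifold M" and N: "smooth_manifold N" and f: "smooth_map M N f"
    and c: "c \<in> charts_around M m" and d: "d \<in> charts_around N (f m)"
    and reg: "regular_operator (tangent_space M m) (tangent_space N (f m)) (tangent_map M N f m)"
  shows "\<exists>K C Q I. split_operator (chart_model c) (chart_model d)
      (directional_derivative (local_rep c d f) (chart_map c m)) K C Q I"
proof -
  define c0 where "c0 = (SOME c. c \<in> charts_around M m)"
  have c0: "c0 \<in> charts_around M m" unfolding c0_def using c by (rule someI)
  note c' = charts_aroundD[OF M c] and c0' = charts_aroundD[OF M c0] and d' = charts_aroundD[OF N d]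
  have rep: "smooth_on (chart_model b) (chart_map b ` (chart_dom b \<inter> f -` chart_dom d)) (chart_model d) ((chart_map d \<circ> f) \<circ> chart_inv b)"
    if "b \<in> charts M" for b
    using smooth_map_local_rep[OF f that d'(1)] by (simp add: local_rep_def)
  let ?j = "\<lambda>u e. if e \<in> charts_around M m
        then directional_derivative (chart_map e \<circ> chart_inv c) (chart_map c m) u else 0"
  have lin: "linear_on (chart_model c) (directional_derivative (local_rep c d f) (chart_map c m))"
    unfolding local_rep_def
    by (rule smooth_on_derivative_linear[OF c'(4) rep[OF c'(1)]]) (use c'(2) d'(2) in auto)
  have eq: "directional_derivative (local_rep c d f) (chart_map c m) u = (tangent_map M N f m (?j u)) d"
    if u: "u \<in> chart_model c" for u
  proof -
    have "(tangent_map M N f m (?j u)) d = directional_derivative (local_rep c0 d f) (chart_map c0 m)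
        (directional_derivative (chart_map c0 \<circ> chart_inv c) (chart_map c m) u)"
      using d c0 by (simp add: tangent_map_def c0_def[symmetric])
    moreover have "directional_derivative (local_rep c d f) (chart_map c m) u = \<dots>"
      unfolding local_rep_def
      by (rule derivative_change_of_chart[OF M c c0 d'(4) _ rep[OF c0'(1)] u]) (use d'(2) in simp)
    ultimately show ?thesis by simp
  qed
  obtain K C Q I
    where S: "split_operator (tangent_space M m) (tangent_space N (f m)) (tangent_map M N f m) K C Q I"
    using regular_operator_split[OF reg] by (elim exE)
  have "split_operator (chart_model c) (chart_model d) (directional_derivative (local_rep c d f) (chart_map c m))
      ((\<lambda>v. v c) ` K) ((\<lambda>v. v c) ` C) ((\<lambda>v. v d) ` Q) ((\<lambda>v. v d) ` I)"
    by (rule split_operator_image[OF tangent_space_chart[OF M c] tangent_space_chart[OF N d] S lin]) (rule eq)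
  then show ?thesis by (intro exI)
qed

section \<open>Continuous functionals and finite dimension\<close>

definition sublinear :: "('a::real_vector \<Rightarrow> real) \<Rightarrow> bool" where
  "sublinear q \<longleftrightarrow> q 0 = 0 \<and> (\<forall>x y. q (x + y) \<le> q x + q y) \<and> (\<forall>c>0. \<forall>x. q (c *\<^sub>R x) \<le> c * q x)"

lemma sublinearD:
  assumes "sublinear q"
  shows "q 0 = 0" "q (x + y) \<le> q x + q y" "c > 0 \<Longrightarrow> q (c *\<^sub>R x) \<le> c * q x"
  using assms by (simp_all add: sublinear_def)

lemma sublinear_scale: "sublinear q \<Longrightarrow> c \<ge> 0 \<Longrightarrow> q (c *\<^sub>R x) = c * q x"
proof (cases "c = 0")
  case False
  assume q: "sublinear q" and "c \<ge> 0"
  with False have c: "c > 0" "inverse c > 0" by auto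
  have "q x \<le> inverse c * q (c *\<^sub>R x)"
    using sublinearD(3)[OF q c(2), of "c *\<^sub>R x"] c by simp
  then have "c * q x \<le> q (c *\<^sub>R x)" using c by (simp add: field_simps)
  then show ?thesis using sublinearD(3)[OF q c(1), of x] by simp
qed (simp add: sublinearD)

lemma sublinear_lower: "sublinear q \<Longrightarrow> - q (- x) \<le> q x"
  using sublinearD(1,2)[of q] by (metis add.right_inverse add.commute diff_0 diff_le_eq)

text \<open>A minimal sublinear functional equals all of its shifts, and this makes it additive.\<close>

definition sublinear_shift :: "('a::real_vector \<Rightarrow> real) \<Rightarrow> 'a \<Rightarrow> 'a \<Rightarrow> real" where
  "sublinear_shift q y x = (INF t\<in>{0..}. q (x + t *\<^sub>R y) - t * q y)"

text \<open>Subadditivity bounds the family below by \<open>- q (- x)\<close>; this makes the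
  infimum over the reals a genuine lower bound.\<close>

lemma sublinear_shift_le:
  assumes q: "sublinear q" and t: "t \<ge> 0"
  shows "sublinear_shift q y x \<le> q (x + t *\<^sub>R y) - t * q y"
  unfolding sublinear_shift_def
proof (rule cINF_lower[OF bdd_belowI2[where m = "- q (- x)"]])
  fix t :: real assume "t \<in> {0..}"
  then have "t * q y = q ((x + t *\<^sub>R y) + - x)" using sublinear_scale[OF q, of t y] by simp
  also have "\<dots> \<le> q (x + t *\<^sub>R y) + q (- x)" by (rule sublinearD(2)[OF q])
  finally show "- q (- x) \<le> q (x + t *\<^sub>R y) - t * q y" by simp
qed (use t in simp)

lemma sublinear_shift_ge:
  assumes "\<And>t. t \<ge> 0 \<Longrightarrow> b \<le> q (x + t *\<^sub>R y) - t * q y"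
  shows "b \<le> sublinear_shift q y x"
  unfolding sublinear_shift_def by (rule cINF_greatest) (use assms in auto)

text \<open>The parameters add and scale with the arguments: \<open>t + s\<close> competes in the
  infimum for \<open>a + b\<close>, and \<open>c * t\<close> in that for
  \<open>c *\<^sub>R x\<close>.\<close>

lemma sublinear_sublinear_shift:
  assumes q: "sublinear q"
  shows "sublinear (sublinear_shift q y)"
  unfolding sublinear_def
proof (intro conjI allI impI)
  show "sublinear_shift q y 0 = 0"
    using sublinear_shift_le[OF q order_refl, of y 0] sublinear_shift_ge[of 0 q 0 y] sublinear_scale[OF q]
      sublinearD(1)[OF q] by simp
next
  fix a b
  have "sublinear_shift q y (a + b) - (q (b + s *\<^sub>R y) - s * q y) \<le> sublinear_shift q y a" if s: "s \<ge> 0" for s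
  proof (rule sublinear_shift_ge)
    fix t :: real assume t: "t \<ge> 0"
    have "sublinear_shift q y (a + b) \<le> q ((a + t *\<^sub>R y) + (b + s *\<^sub>R y)) - (t + s) * q y"
      using sublinear_shift_le[OF q, of "t + s" y "a + b"] s t by (simp add: algebra_simps)
    also have "\<dots> \<le> q (a + t *\<^sub>R y) + q (b + s *\<^sub>R y) - (t + s) * q y"
      using sublinearD(2)[OF q] by simp
    finally show "sublinear_shift q y (a + b) - (q (b + s *\<^sub>R y) - s * q y) \<le> q (a + t *\<^sub>R y) - t * q y"
      by (simp add: algebra_simps)
  qed
  then have "sublinear_shift q y (a + b) - sublinear_shift q y a \<le> sublinear_shift q y b"
    by (intro sublinear_shift_ge) (simp add: algebra_simps)
  then show "sublinear_shift q y (a + b) \<le> sublinear_shift q y a + sublinear_shift q y b" by simp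
next
  fix c :: real and x assume c: "c > 0"
  have "sublinear_shift q y (c *\<^sub>R x) / c \<le> sublinear_shift q y x"
  proof (rule sublinear_shift_ge)
    fix t :: real assume t: "t \<ge> 0"
    have "sublinear_shift q y (c *\<^sub>R x) \<le> q (c *\<^sub>R (x + t *\<^sub>R y)) - c * t * q y"
      using sublinear_shift_le[OF q, of "c * t" y "c *\<^sub>R x"] c t by (simp add: scaleR_add_right)
    also have "\<dots> = c * (q (x + t *\<^sub>R y) - t * q y)"
      using sublinear_scale[OF q, of c "x + t *\<^sub>R y"] c by (simp add: right_diff_distrib mult.assoc)
    finally show "sublinear_shift q y (c *\<^sub>R x) / c \<le> q (x + t *\<^sub>R y) - t * q y"
      using c by (simp add: field_simps)
  qed
  then show "sublinear_shift q y (c *\<^sub>R x) \<le> c * sublinear_shift q y x" using c by (simp add: field_simps)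
qed

text \<open>Zorn's lemma for the reversed order. A nonempty chain has its pointwise infimum as a
  lower bound, finite because every member is at least \<open>- p (- x)\<close> at
  \<open>x\<close>.\<close>

lemma minimal_sublinear_exists:
  assumes p: "sublinear (p :: 'a::real_vector \<Rightarrow> real)"
  shows "\<exists>m. sublinear m \<and> m \<le> p \<and> (\<forall>q. sublinear q \<longrightarrow> q \<le> m \<longrightarrow> q = m)"
proof -
  define S where "S = {q. sublinear q \<and> q \<le> p}"
  have "\<exists>m\<in>S. \<forall>a\<in>S. m \<ge> a \<longrightarrow> a = m"
  proof (rule predicate_Zorn)
    show "partial_order_on S (relation_of (\<ge>) S)"
      by (rule partial_order_on_relation_ofI) auto
    fix C assume C: "C \<in> Chains (relation_of (\<ge>) S)"
    then have CS: "C \<subseteq> S" by (auto simp: Chains_def relation_of_def)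
    have chain: "q \<le> q' \<or> q' \<le> q" if "q \<in> C" "q' \<in> C" for q q'
      using C that by (auto simp: Chains_def relation_of_def)
    show "\<exists>u\<in>S. \<forall>a\<in>C. a \<ge> u"
    proof (cases "C = {}")
      case True
      then show ?thesis using p by (intro bexI[of _ p]) (auto simp: S_def)
    next
      case False
      define u where "u x = (INF q\<in>C. q x)" for x
      have sub: "sublinear q" "q \<le> p" if "q \<in> C" for q using that CS by (auto simp: S_def)
      have le: "u x \<le> q x" if "q \<in> C" for q x
        unfolding u_def
      proof (rule cINF_lower[OF bdd_belowI2[where m = "- p (- x)"] that])
        fix q assume q: "q \<in> C"
        have "q (- x) \<le> p (- x)" using sub(2)[OF q] by (simp add: le_fun_def)
        then show "- p (- x) \<le> q x" using sublinear_lower[OF sub(1)[OF q], of x] by simp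
      qed
      have ge: "b \<le> u x" if "\<And>q. q \<in> C \<Longrightarrow> b \<le> q x" for b x
        unfolding u_def by (rule cINF_greatest[OF False that])
      have "sublinear u"
        unfolding sublinear_def
      proof (intro conjI allI impI)
        obtain q where q: "q \<in> C" using False by blast
        have "u 0 \<le> 0" using le[OF q, of 0] sublinearD(1)[OF sub(1)[OF q]] by simp
        moreover have "0 \<le> u 0" by (rule ge) (simp add: sublinearD(1)[OF sub(1)])
        ultimately show "u 0 = 0" by simp
      next
        fix x y
        have "u (x + y) - q' y \<le> u x" if q': "q' \<in> C" for q'
        proof (rule ge)
          fix q assume q: "q \<in> C"
          \<comment> \<open>Comparing infima at two different points calls for one member below both
            \<open>q\<close> and \<open>q'\<close>, which the chain provides.\<close>
          have "\<exists>r\<in>C. r \<le> q \<and> r \<le> q'" using chain[OF q q'] q q' by auto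
          then obtain r where r: "r \<in> C" "r x \<le> q x" "r y \<le> q' y" by (auto simp: le_fun_def)
          have "u (x + y) \<le> r x + r y" using le[OF r(1), of "x + y"] sublinearD(2)[OF sub(1)[OF r(1)], of x y] by simp
          then show "u (x + y) - q' y \<le> q x" using r by simp
        qed
        then have "u (x + y) - u x \<le> u y" by (intro ge) (simp add: algebra_simps)
        then show "u (x + y) \<le> u x + u y" by simp
      next
        fix c :: real and x assume c: "c > 0"
        have "u (c *\<^sub>R x) / c \<le> u x"
        proof (rule ge)
          fix q assume q: "q \<in> C"
          have "u (c *\<^sub>R x) \<le> c * q x" using le[OF q, of "c *\<^sub>R x"] sublinearD(3)[OF sub(1)[OF q] c, of x] by simp
          then show "u (c *\<^sub>R x) / c \<le> q x" using c by (simp add: field_simps)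
        qed
        then show "u (c *\<^sub>R x) \<le> c * u x" using c by (simp add: field_simps)
      qed
      moreover have "u \<le> p"
      proof -
        obtain q where q: "q \<in> C" using False by blast
        show ?thesis
          by (intro le_funI order_trans[OF le[OF q]]) (use sub(2)[OF q] in \<open>simp add: le_fun_def\<close>)
      qed
      ultimately show ?thesis using le by (intro bexI[of _ u]) (auto simp: S_def le_fun_def)
    qed
  qed
  then obtain m where m: "sublinear m" "m \<le> p" "\<And>a. sublinear a \<Longrightarrow> a \<le> p \<Longrightarrow> a \<le> m \<Longrightarrow> a = m"
    by (auto simp: S_def)
  then show ?thesis by (meson order_trans)
qed

text \<open>Minimality is taken below the shift of \<open>p\<close> along \<open>y0\<close> instead
  of \<open>p\<close> itself: that shift is at most \<open>- p y0\<close> at \<open>- y0\<close>,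
  which by linearity of \<open>m\<close> secures the lower bound at \<open>y0\<close>.\<close>

lemma sublinear_dominated_linear:
  assumes p: "sublinear p"
  shows "\<exists>\<phi>. linear \<phi> \<and> (\<forall>x. \<phi> x \<le> p x) \<and> p y0 \<le> \<phi> y0"
proof -
  obtain m where m: "sublinear m" "m \<le> sublinear_shift p y0"
    "\<And>q. sublinear q \<Longrightarrow> q \<le> m \<Longrightarrow> q = m"
    using minimal_sublinear_exists[OF sublinear_sublinear_shift[OF p, of y0]] by blast
  have shift: "m x + m y \<le> m (x + y)" for x y
  proof -
    have "sublinear_shift m y \<le> m"
      using sublinear_shift_le[OF m(1) order_refl, of y] by (auto simp: le_fun_def)
    then have "sublinear_shift m y = m" by (rule m(3)[OF sublinear_sublinear_shift[OF m(1)]])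
    then show ?thesis using sublinear_shift_le[OF m(1), of 1 y x] by simp
  qed
  have add: "m (x + y) = m x + m y" for x y
    using shift[of x y] sublinearD(2)[OF m(1), of x y] by simp
  have neg: "m (- x) = - m x" for x
    using add[of x "- x"] sublinearD(1)[OF m(1)] by simp
  have "linear m"
  proof (rule linearI[OF add])
    fix c :: real and x
    show "m (c *\<^sub>R x) = c *\<^sub>R m x"
    proof (cases "c \<ge> 0")
      case False
      then have "m ((- c) *\<^sub>R x) = - c * m x" by (intro sublinear_scale[OF m(1)]) simp
      then show ?thesis using neg[of "c *\<^sub>R x"] by simp
    qed (simp add: sublinear_scale[OF m(1)])
  qed
  moreover have "m x \<le> p x" for x
    using m(2) sublinear_shift_le[OF p order_refl, of y0 x] by (auto simp: le_fun_def intro: order_trans)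
  moreover have "p y0 \<le> m y0"
  proof -
    have "m (- y0) \<le> sublinear_shift p y0 (- y0)" using m(2) by (simp add: le_fun_def)
    also have "\<dots> \<le> p (- y0 + 1 *\<^sub>R y0) - 1 * p y0" by (rule sublinear_shift_le[OF p]) simp
    finally show ?thesis using neg[of y0] sublinearD(1)[OF p] by simp
  qed
  ultimately show ?thesis by blast
qed

section \<open>Gauges and separating functionals\<close>

text \<open>The Minkowski functional converts a convex neighbourhood into a bound for linear
  functionals. A neighbourhood of 0 absorbs every vector, so the infimum runs over a nonempty
  set.\<close>

lemma gauge_sublinear:
  fixes C :: "'a::locally_convex set"
  assumes C: "open C" "convex C" "0 \<in> C"
  defines "p \<equiv> \<lambda>x. Inf {t. t > 0 \<and> x /\<^sub>R t \<in> C}"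
  shows "sublinear p" and "x \<in> C \<Longrightarrow> p x \<le> 1" and "x \<notin> C \<Longrightarrow> 1 \<le> p x"
proof -
  let ?G = "\<lambda>x. {t. t > 0 \<and> x /\<^sub>R t \<in> C}"
  have ne: "?G x \<noteq> {}" for x
  proof -
    have "\<forall>\<^sub>F t in at (0::real). 0 + t *\<^sub>R x \<in> C"
      using C by (intro line_eventually_in[of UNIV]) auto
    then obtain d where d: "d > 0" "\<And>t. t \<noteq> 0 \<Longrightarrow> \<bar>t\<bar> < d \<Longrightarrow> t *\<^sub>R x \<in> C"
      by (auto simp: eventually_at dist_real_def)
    then have "inverse (d / 2) \<in> ?G x" using d(2)[of "d / 2"] by simp
    then show ?thesis by blast
  qed
  have le: "p x \<le> t" if "t > 0" "x /\<^sub>R t \<in> C" for x t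
    unfolding p_def by (rule cInf_lower) (use that in \<open>auto intro!: bdd_belowI[of _ 0]\<close>)
  have ge: "b \<le> p x" if "\<And>t. t > 0 \<Longrightarrow> x /\<^sub>R t \<in> C \<Longrightarrow> b \<le> t" for b x
    unfolding p_def by (rule cInf_greatest[OF ne]) (use that in auto)
  show "p x \<le> 1" if "x \<in> C" using le[of 1 x] that by simp
  show "1 \<le> p x" if "x \<notin> C"
  proof (rule ge, rule ccontr)
    fix t assume t: "t > 0" "x /\<^sub>R t \<in> C" "\<not> 1 \<le> t"
    have "t *\<^sub>R (x /\<^sub>R t) + (1 - t) *\<^sub>R 0 \<in> C" using t C by (intro convexD) auto
    then show False using that t by simp
  qed
  show "sublinear p"
    unfolding sublinear_def
  proof (intro conjI allI impI)
    have "p 0 \<le> 0" by (rule field_le_epsilon) (use le[of _ 0] C in auto)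
    moreover have "0 \<le> p 0" by (rule ge) simp
    ultimately show "p 0 = 0" by simp
  next
    fix x y
    have "p (x + y) - s \<le> p x" if s: "s > 0" "y /\<^sub>R s \<in> C" for s
    proof (rule ge)
      fix t assume t: "t > 0" "x /\<^sub>R t \<in> C"
      \<comment> \<open>The weights are chosen so that the convex combination is
        \<open>x + y\<close> scaled by t + s.\<close>
      have "(t / (t + s)) *\<^sub>R (x /\<^sub>R t) + (s / (t + s)) *\<^sub>R (y /\<^sub>R s) \<in> C"
        using s t by (intro convexD[OF C(2)]) (auto simp: add_divide_distrib[symmetric])
      also have "(t / (t + s)) *\<^sub>R (x /\<^sub>R t) + (s / (t + s)) *\<^sub>R (y /\<^sub>R s) = (x + y) /\<^sub>R (t + s)"
      proof -
        have "t / (t + s) * inverse t = inverse (t + s)" "s / (t + s) * inverse s = inverse (t + s)"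
          using s t by (simp_all add: divide_inverse)
        then show ?thesis by (simp only: scaleR_scaleR scaleR_add_right)
      qed
      finally show "p (x + y) - s \<le> t" using le[of "t + s" "x + y"] s t by simp
    qed
    then have "p (x + y) - p x \<le> p y" by (intro ge) (simp add: algebra_simps)
    then show "p (x + y) \<le> p x + p y" by simp
  next
    fix c :: real and x assume c: "c > 0"
    have "p (c *\<^sub>R x) / c \<le> p x"
    proof (rule ge)
      fix t assume t: "t > 0" "x /\<^sub>R t \<in> C"
      have "inverse (c * t) * c = inverse t" using c by (simp add: field_simps)
      then have eq: "(c *\<^sub>R x) /\<^sub>R (c * t) = x /\<^sub>R t" by (simp only: scaleR_scaleR)
      have "(c *\<^sub>R x) /\<^sub>R (c * t) \<in> C" unfolding eq by (rule t(2))
      then have "p (c *\<^sub>R x) \<le> c * t" by (rule le[OF mult_pos_pos[OF c t(1)]])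
      then show "p (c *\<^sub>R x) / c \<le> t" using c by (simp add: field_simps)
    qed
    then show "p (c *\<^sub>R x) \<le> c * p x" using c by (simp add: field_simps)
  qed
qed

text \<open>The Hausdorff property gives a convex open neighbourhood \<open>C\<close> of 0 that
  misses \<open>y\<close>. A functional below the gauge of \<open>C\<close>, and reaching it at
  \<open>y\<close>, is bounded above on \<open>C\<close> and at least 1 at \<open>y\<close>.\<close>

lemma separating_functional:
  fixes y :: "'a::locally_convex"
  assumes "y \<noteq> 0"
  shows "\<exists>\<phi>. linear \<phi> \<and> continuous_on UNIV \<phi> \<and> \<phi> y \<noteq> (0::real)"
proof -
  obtain U where U: "open U" "0 \<in> U" "y \<notin> U"
    using t1_space[of 0 y] assms by auto
  then obtain C where C: "open C" "convex C" "0 \<in> C" "C \<subseteq> U" using locally_convexD by blast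
  define p where "p x = Inf {t. t > 0 \<and> x /\<^sub>R t \<in> C}" for x
  note p = gauge_sublinear[OF C(1-3), folded p_def]
  obtain \<phi> where \<phi>: "linear \<phi>" "\<And>x. \<phi> x \<le> p x" "p y \<le> \<phi> y"
    using sublinear_dominated_linear[OF p(1)] by blast
  have bound: "\<phi> x \<le> 1" if "x \<in> C" for x using \<phi>(2)[of x] p(2)[OF that] by simp
  have "continuous_on UNIV \<phi>"
    unfolding continuous_on_def
  proof
    fix x
    show "(\<phi> \<longlongrightarrow> \<phi> x) (at x within UNIV)"
    proof (rule tendstoI)
      fix e :: real assume e: "e > 0"
      \<comment> \<open>\<open>\<phi>\<close> is at most 1 on \<open>C\<close>, which need not be
        symmetric; so both differences are scaled into \<open>C\<close>. The factor 2/e yields the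
        bound e/2 and with it strict inequality.\<close>
      have "((\<lambda>z. (2 / e) *\<^sub>R (z - x)) \<longlongrightarrow> (2 / e) *\<^sub>R (x - x)) (at x within UNIV)"
        by (intro tendsto_scaleR_locally_convex tendsto_intros)
      then have 1: "\<forall>\<^sub>F z in at x within UNIV. (2 / e) *\<^sub>R (z - x) \<in> C"
        using C by (intro topological_tendstoD) auto
      have "((\<lambda>z. (2 / e) *\<^sub>R (x - z)) \<longlongrightarrow> (2 / e) *\<^sub>R (x - x)) (at x within UNIV)"
        by (intro tendsto_scaleR_locally_convex tendsto_intros)
      then have 2: "\<forall>\<^sub>F z in at x within UNIV. (2 / e) *\<^sub>R (x - z) \<in> C"
        using C by (intro topological_tendstoD) auto
      from 1 2 show "\<forall>\<^sub>F z in at x within UNIV. dist (\<phi> z) (\<phi> x) < e"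
      proof eventually_elim
        case (elim z)
        have "\<phi> ((2 / e) *\<^sub>R (a - b)) = 2 / e * (\<phi> a - \<phi> b)" for a b
          by (simp only: linear_cmul[OF \<phi>(1)] linear_diff[OF \<phi>(1)] real_scaleR_def)
        then have "2 / e * (\<phi> z - \<phi> x) \<le> 1" "2 / e * (\<phi> x - \<phi> z) \<le> 1"
          using bound[OF elim(1)] bound[OF elim(2)] by (simp_all only:)
        then have "\<phi> z - \<phi> x \<le> e / 2" "\<phi> x - \<phi> z \<le> e / 2" using e by (simp_all add: field_simps)
        then show ?case using e by (simp add: dist_real_def abs_less_iff)
      qed
    qed
  qed
  moreover have "\<phi> y \<noteq> 0" using p(3)[of y] \<phi>(3) U C by force
  ultimately show ?thesis using \<phi>(1) by blast
qed

section \<open>Finite-dimensional subspaces\<close>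

lemma coordinate_projection:
  fixes \<phi> :: "'a::locally_convex \<Rightarrow> 'a \<Rightarrow> real"
  assumes fin: "finite B" and lin: "\<And>a. a \<in> B \<Longrightarrow> linear (\<phi> a)"
    and cont: "\<And>a. a \<in> B \<Longrightarrow> continuous_on UNIV (\<phi> a)"
    and dual: "\<And>a a'. a \<in> B \<Longrightarrow> a' \<in> B \<Longrightarrow> \<phi> a a' = (if a' = a then 1 else 0)"
  defines "P \<equiv> \<lambda>x. \<Sum>a\<in>B. \<phi> a x *\<^sub>R a"
  shows "linear P" and "continuous_on UNIV P" and "a \<in> B \<Longrightarrow> P a = a" and "P x \<in> span B"
proof -
  show "linear P"
    unfolding P_def using lin
    by (intro linear_compose_sum ballI) (auto intro!: linearI simp: linear_add linear_cmul scaleR_add_left)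
  show "continuous_on UNIV P"
    unfolding P_def continuous_on_def
    by (intro ballI tendsto_sum tendsto_scaleR_locally_convex tendsto_const)
      (use cont in \<open>auto simp: continuous_on_def\<close>)
  show "P x \<in> span B" unfolding P_def by (intro span_sum span_scale span_base)
  assume a: "a \<in> B"
  have "P a = (\<Sum>a'\<in>B. (if a' = a then a' else 0))"
    unfolding P_def by (rule sum.cong) (use dual a in auto)
  then show "P a = a" using a fin by simp
qed

text \<open>In the induction, the projection \<open>P\<close> to the span of the earlier vectors is
  already continuous and b - P b is nonzero. A functional separating it from 0, composed with x - P
  x and normalised, is 1 at \<open>b\<close> and 0 on \<open>B\<close>; multiples of it correct the
  earlier functionals at \<open>b\<close>.\<close>

lemma biorthogonal_functionals:
  fixes B :: "'a::locally_convex set"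
  assumes "finite B" "independent B"
  shows "\<exists>\<phi>. \<forall>b\<in>B. linear (\<phi> b) \<and> continuous_on UNIV (\<phi> b) \<and> (\<forall>b'\<in>B. \<phi> b b' = (if b' = b then 1 else (0::real)))"
  using assms
proof (induction B)
  case (insert b B)
  then have "independent B" and bB: "b \<notin> span B"
    by (simp_all add: independent_insert)
  then obtain \<phi> where \<phi>: "\<And>a. a \<in> B \<Longrightarrow> linear (\<phi> a)" "\<And>a. a \<in> B \<Longrightarrow> continuous_on UNIV (\<phi> a)"
    "\<And>a a'. a \<in> B \<Longrightarrow> a' \<in> B \<Longrightarrow> \<phi> a a' = (if a' = a then 1 else (0::real))"
    using insert.IH by blast
  define P where "P x = (\<Sum>a\<in>B. \<phi> a x *\<^sub>R a)" for x
  have P: "linear P" and Pc: "continuous_on UNIV P" and Psp: "P x \<in> span B" for x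
    unfolding P_def by (rule coordinate_projection[of B \<phi>]; fact insert.hyps(1) \<phi>)+
  have PB: "P a = a" if "a \<in> B" for a
    unfolding P_def by (rule coordinate_projection(3)[of B \<phi>]; fact insert.hyps(1) \<phi> that)
  have "P b \<in> span B" by (rule Psp)
  then have "b - P b \<noteq> 0" using bB by auto
  then obtain \<psi> where \<psi>: "linear \<psi>" "continuous_on UNIV \<psi>" "\<psi> (b - P b) \<noteq> (0::real)"
    using separating_functional by blast
  define \<eta> where "\<eta> x = \<psi> (x - P x) / \<psi> (b - P b)" for x
  have \<eta>: "linear \<eta>"
    using \<psi>(1) P unfolding \<eta>_def
    by (intro linearI) (simp_all add: linear_add linear_cmul linear_diff add_divide_distrib diff_divide_distrib algebra_simps)
  have \<eta>c: "continuous_on UNIV \<eta>"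
  proof -
    have "continuous_on UNIV (\<lambda>x. x - P x)"
      using Pc unfolding continuous_on_def by (auto intro!: tendsto_diff tendsto_intros)
    then have "continuous_on UNIV (\<lambda>x. \<psi> (x - P x))"
      by (rule continuous_on_compose2[OF \<psi>(2)]) auto
    then show ?thesis unfolding \<eta>_def using \<psi>(3) by (intro continuous_on_divide continuous_on_const) auto
  qed
  have \<eta>B: "\<eta> a = 0" if "a \<in> B" for a using PB[OF that] \<psi>(1) by (simp add: \<eta>_def linear_0)
  have \<eta>b: "\<eta> b = 1" using \<psi>(3) by (simp add: \<eta>_def)
  define \<phi>' where "\<phi>' a x = (if a = b then \<eta> x else \<phi> a x - \<phi> a b * \<eta> x)" for a x
  show ?case
  proof (intro exI[of _ \<phi>'] ballI)
    fix a assume a: "a \<in> insert b B"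
    show "linear (\<phi>' a) \<and> continuous_on UNIV (\<phi>' a) \<and> (\<forall>b'\<in>insert b B. \<phi>' a b' = (if b' = a then 1 else 0))"
    proof (cases "a = b")
      case True
      then have "\<phi>' a = \<eta>" by (simp add: \<phi>'_def fun_eq_iff)
      then show ?thesis using \<eta> \<eta>c \<eta>B \<eta>b True insert.hyps by auto
    next
      case False
      then have a': "a \<in> B" and eq: "\<phi>' a = (\<lambda>x. \<phi> a x - \<phi> a b * \<eta> x)"
        using a by (auto simp: \<phi>'_def fun_eq_iff)
      have "linear (\<phi>' a)" unfolding eq
        using \<phi>(1)[OF a'] \<eta> by (intro linearI) (simp_all add: linear_add linear_cmul algebra_simps)
      moreover have "continuous_on UNIV (\<phi>' a)" unfolding eq
        by (intro continuous_on_diff continuous_on_mult continuous_on_const \<phi>(2)[OF a'] \<eta>c)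
      ultimately show ?thesis
        using \<phi>(3)[OF a'] \<eta>B \<eta>b False a' by (auto simp: eq)
    qed
  qed
qed simp

lemma finite_dimensional_coordinates:
  assumes "finite_dimensional_space_on (X :: 'a::locally_convex set)"
  obtains B \<phi> where "finite B" "independent B" "span B = X"
    "\<And>b. b \<in> B \<Longrightarrow> linear (\<phi> b)" "\<And>b. b \<in> B \<Longrightarrow> continuous_on UNIV (\<phi> b)"
    "linear (\<lambda>x. \<Sum>b\<in>B. \<phi> b x *\<^sub>R b)" "continuous_on UNIV (\<lambda>x. \<Sum>b\<in>B. \<phi> b x *\<^sub>R b)"
    "\<And>x. (\<Sum>b\<in>B. \<phi> b x *\<^sub>R b) \<in> X" "\<And>x. x \<in> X \<Longrightarrow> (\<Sum>b\<in>B. (\<phi> b x :: real) *\<^sub>R b) = x"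
proof -
  obtain B0 where B0: "finite B0" "span B0 = X"
    using assms by (auto simp: finite_dimensional_space_on_def)
  obtain B where B: "B \<subseteq> B0" "independent B" "B0 \<subseteq> span B"
    using maximal_independent_subset[of B0] by blast
  have fin: "finite B" using B(1) B0(1) by (rule finite_subset)
  have sp: "span B = X" using B B0(2) span_mono[OF B(1)] span_minimal[OF B(3) subspace_span] by auto
  obtain \<phi> where \<phi>: "\<And>a. a \<in> B \<Longrightarrow> linear (\<phi> a)" "\<And>a. a \<in> B \<Longrightarrow> continuous_on UNIV (\<phi> a)"
    "\<And>a a'. a \<in> B \<Longrightarrow> a' \<in> B \<Longrightarrow> \<phi> a a' = (if a' = a then 1 else (0::real))"
    using biorthogonal_functionals[OF fin B(2)] by blast
  define P where "P x = (\<Sum>a\<in>B. \<phi> a x *\<^sub>R a)" for x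
  have P: "linear P" and Pc: "continuous_on UNIV P" and Psp: "P x \<in> span B" for x
    unfolding P_def by (rule coordinate_projection[of B \<phi>]; fact fin \<phi>)+
  have PB: "P a = a" if "a \<in> B" for a
    unfolding P_def by (rule coordinate_projection(3)[of B \<phi>]; fact fin \<phi> that)
  have Pid: "P x = x" if "x \<in> X" for x
    using linear_eq_on[OF P linear_id, of x B] PB that by (simp add: id_def sp)
  have PX: "P x \<in> X" for x unfolding sp[symmetric] by (rule Psp)
  show ?thesis
    by (rule that[of B \<phi>])
      (fact fin B(2) sp \<phi>(1) \<phi>(2) P[unfolded P_def] Pc[unfolded P_def] PX[unfolded P_def] Pid[unfolded P_def])+
qed

lemma finite_dimensional_complemented:
  fixes A :: "'a::locally_convex set"
  assumes A: "finite_dimensional_space_on A" "A \<subseteq> Y" and Y: "subspace Y"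
  shows "\<exists>B. topological_direct_sum Y A B"
proof -
  obtain B and \<phi> :: "'a \<Rightarrow> 'a \<Rightarrow> real" where "finite B" "independent B" and sp: "span B = A"
    and "\<And>b. b \<in> B \<Longrightarrow> linear (\<phi> b)" "\<And>b. b \<in> B \<Longrightarrow> continuous_on UNIV (\<phi> b)"
    and P: "linear (\<lambda>x. \<Sum>b\<in>B. \<phi> b x *\<^sub>R b)" "continuous_on UNIV (\<lambda>x. \<Sum>b\<in>B. \<phi> b x *\<^sub>R b)"
      "\<And>x. (\<Sum>b\<in>B. \<phi> b x *\<^sub>R b) \<in> A" "\<And>x. x \<in> A \<Longrightarrow> (\<Sum>b\<in>B. \<phi> b x *\<^sub>R b) = x"
    by (rule finite_dimensional_coordinates[OF A(1)]) (rule that; assumption)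
  define p where "p x = (\<Sum>b\<in>B. \<phi> b x *\<^sub>R b)" for x
  note P = P[folded p_def]
  have sA: "subspace A" using sp subspace_span by metis
  have "topological_direct_sum Y A {y \<in> Y. p y = 0}"
  proof (rule topological_direct_sumI[where p = p])
    show "subspace {y \<in> Y. p y = 0}"
      using Y P(1) by (auto simp: subspace_def linear_0 linear_add linear_cmul)
    show "continuous_on Y p" using P(2) continuous_on_subset by blast
    show "x - p x \<in> {y \<in> Y. p y = 0}" if "x \<in> Y" for x
      using that P(3)[of x] P(4)[OF P(3)[of x]] A(2) linear_diff[OF P(1)] by (auto intro: subspace_diff[OF Y])
    show "p (a + b) = a" if "a \<in> A" "b \<in> {y \<in> Y. p y = 0}" for a b
      using that P(4) linear_add[OF P(1)] by simp
  qed (use Y sA A P in auto)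
  then show ?thesis by (rule exI)
qed

text \<open>The sum of absolute values of continuous coordinates is continuous, so its balls are
  open. Conversely, small norm means small coordinates, hence a small combination of the basis in
  the given topology. Completeness is that of the coordinates.\<close>

lemma finite_dimensional_banach:
  assumes X: "finite_dimensional_space_on (X :: 'a::locally_convex set)"
  shows "banach_space_on X"
proof -
  obtain B and \<phi> :: "'a \<Rightarrow> 'a \<Rightarrow> real" where fin: "finite B" and "independent B" and sp: "span B = X"
    and \<phi>: "\<And>b. b \<in> B \<Longrightarrow> linear (\<phi> b)" "\<And>b. b \<in> B \<Longrightarrow> continuous_on UNIV (\<phi> b)"
    and P: "linear (\<lambda>x. \<Sum>b\<in>B. \<phi> b x *\<^sub>R b)" "continuous_on UNIV (\<lambda>x. \<Sum>b\<in>B. \<phi> b x *\<^sub>R b)"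
      "\<And>x. (\<Sum>b\<in>B. \<phi> b x *\<^sub>R b) \<in> X" "\<And>x. x \<in> X \<Longrightarrow> (\<Sum>b\<in>B. \<phi> b x *\<^sub>R b) = x"
    by (rule finite_dimensional_coordinates[OF X]) (rule that; assumption)
  have sX: "subspace X" using sp subspace_span by metis
  define n where "n x = (\<Sum>b\<in>B. \<bar>\<phi> b x\<bar>)" for x
  have coord: "\<bar>\<phi> b x\<bar> \<le> n x" if "b \<in> B" for b x
    unfolding n_def by (rule member_le_sum[OF that]) (use fin in auto)
  have n0: "n x \<ge> 0" for x unfolding n_def by (rule sum_nonneg) simp
  have nc: "continuous_on UNIV n"
    unfolding n_def by (intro continuous_on_sum continuous_on_rabs \<phi>(2))
  have metric: "Metric_space X (\<lambda>x y. n (x - y))"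
  proof
    show "0 \<le> n (x - y)" for x y by (rule n0)
    show "n (x - y) = n (y - x)" for x y
      unfolding n_def by (rule sum.cong) (use \<phi>(1) in \<open>auto simp: linear_diff abs_minus_commute\<close>)
    show "n (x - y) = 0 \<longleftrightarrow> x = y" if "x \<in> X" "y \<in> X" for x y
    proof
      assume "n (x - y) = 0"
      then have "\<phi> b (x - y) = 0" if "b \<in> B" for b using coord[OF that, of "x - y"] by simp
      then have "(\<Sum>b\<in>B. \<phi> b (x - y) *\<^sub>R b) = 0" by simp
      then show "x = y" using P(4)[OF subspace_diff[OF sX that]] by simp
    next
      show "n (x - y) = 0" if "x = y" using that \<phi>(1) by (simp add: n_def linear_0)
    qed
    show "n (x - z) \<le> n (x - y) + n (y - z)" for x y z
      unfolding n_def sum.distrib[symmetric]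
    proof (rule sum_mono)
      fix b assume "b \<in> B"
      then show "\<bar>\<phi> b (x - z)\<bar> \<le> \<bar>\<phi> b (x - y)\<bar> + \<bar>\<phi> b (y - z)\<bar>"
        using linear_diff[OF \<phi>(1)] by simp
    qed
  qed
  interpret M: Metric_space X "\<lambda>x y. n (x - y)" by (rule metric)
  have ball: "M.mball x r = {z \<in> X. n (x - z) < r}" if "x \<in> X" for x r
    using that by (auto simp: M.mball_def)
  have top: "M.mtopology = top_of_set X"
    unfolding topology_eq
  proof (intro allI iffI)
    fix U assume U: "openin M.mtopology U"
    show "openin (top_of_set X) U"
    proof (subst openin_subopen, intro ballI)
      fix x assume x: "x \<in> U"
      then obtain r where r: "r > 0" "M.mball x r \<subseteq> U" and xX: "x \<in> X"
        using U unfolding M.openin_mtopology by blast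
      have "continuous_on X (\<lambda>z. n (x - z))"
      proof (rule continuous_on_compose2[OF nc])
        show "continuous_on X (\<lambda>z. x - z)" unfolding continuous_on_def by (auto intro!: tendsto_diff tendsto_intros)
      qed auto
      from continuous_openin_preimage_gen[OF this open_lessThan, of r]
      have "openin (top_of_set X) (M.mball x r)"
        unfolding ball[OF xX] by (simp add: Int_def vimage_def)
      then show "\<exists>T. openin (top_of_set X) T \<and> x \<in> T \<and> T \<subseteq> U"
        using r xX M.centre_in_mball_iff by blast
    qed
  next
    fix U assume "openin (top_of_set X) U"
    then obtain S where S: "open S" "U = X \<inter> S" by (auto simp: openin_open)
    show "openin M.mtopology U"
      unfolding M.openin_mtopology
    proof (intro conjI allI impI)
      fix x assume x: "x \<in> U"
      \<comment> \<open>The filter of vectors with norm tending to 0. Along it all coordinates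
        vanish, so adding the combination with these coordinates to \<open>x\<close> tends to
        \<open>x\<close> in the given topology.\<close>
      let ?F = "filtercomap n (nhds 0)"
      have lim: "(n \<longlongrightarrow> 0) ?F" by (rule filterlim_filtercomap)
      have "((\<lambda>w. x + (\<Sum>b\<in>B. \<phi> b w *\<^sub>R b)) \<longlongrightarrow> x + (\<Sum>b\<in>B. 0 *\<^sub>R b)) ?F"
      proof (intro tendsto_add tendsto_const tendsto_sum tendsto_scaleR_locally_convex)
        fix b assume b: "b \<in> B"
        show "(\<phi> b \<longlongrightarrow> 0) ?F"
          by (rule Lim_null_comparison[OF always_eventually lim]) (use coord[OF b] in simp)
      qed
      then have "\<forall>\<^sub>F w in ?F. x + (\<Sum>b\<in>B. \<phi> b w *\<^sub>R b) \<in> S"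
        using S x by (intro topological_tendstoD) auto
      then obtain Q where Q: "eventually Q (nhds 0)" "\<And>w. Q (n w) \<Longrightarrow> x + (\<Sum>b\<in>B. \<phi> b w *\<^sub>R b) \<in> S"
        by (auto simp: eventually_filtercomap)
      then obtain e where e: "e > 0" "\<And>t. \<bar>t\<bar> < e \<Longrightarrow> Q t"
        by (auto simp: eventually_nhds_metric dist_real_def)
      have "M.mball x e \<subseteq> U"
      proof
        fix z assume "z \<in> M.mball x e"
        then have z: "x \<in> X" "z \<in> X" "n (z - x) < e" by (auto simp: M.mball_def M.commute)
        then have "x + (\<Sum>b\<in>B. \<phi> b (z - x) *\<^sub>R b) \<in> S" using Q(2) e(2) n0 by simp
        then show "z \<in> U" using P(4)[OF subspace_diff[OF sX z(2,1)]] z S by simp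
      qed
      then show "\<exists>r>0. M.mball x r \<subseteq> U" using e by blast
    qed (use S in auto)
  qed
  have "M.mcomplete"
    unfolding M.mcomplete_def
  proof (intro allI impI)
    fix \<sigma> assume \<sigma>: "M.MCauchy \<sigma>"
    then have \<sigma>X: "\<sigma> k \<in> X" for k by (auto simp: M.MCauchy_def)
    have "\<exists>l. (\<lambda>k. \<phi> b (\<sigma> k)) \<longlonglongrightarrow> l" if b: "b \<in> B" for b
    proof -
      have "Cauchy (\<lambda>k. \<phi> b (\<sigma> k))"
      proof (rule metric_CauchyI)
        fix e :: real assume "e > 0"
        then obtain N where N: "\<And>k k'. N \<le> k \<Longrightarrow> N \<le> k' \<Longrightarrow> n (\<sigma> k - \<sigma> k') < e"
          using \<sigma> unfolding M.MCauchy_def by meson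
        have "dist (\<phi> b (\<sigma> k)) (\<phi> b (\<sigma> k')) < e" if "k \<ge> N" "k' \<ge> N" for k k'
          using coord[OF b, of "\<sigma> k - \<sigma> k'"] N[OF that] linear_diff[OF \<phi>(1)[OF b]] by (simp add: dist_real_def)
        then show "\<exists>N. \<forall>k\<ge>N. \<forall>k'\<ge>N. dist (\<phi> b (\<sigma> k)) (\<phi> b (\<sigma> k')) < e" by blast
      qed
      then show ?thesis by (simp add: Cauchy_convergent_iff convergent_def)
    qed
    then obtain l where l: "\<And>b. b \<in> B \<Longrightarrow> (\<lambda>k. \<phi> b (\<sigma> k)) \<longlonglongrightarrow> l b" by metis
    have "(\<lambda>k. \<Sum>b\<in>B. \<phi> b (\<sigma> k) *\<^sub>R b) \<longlonglongrightarrow> (\<Sum>b\<in>B. l b *\<^sub>R b)"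
      by (intro tendsto_sum tendsto_scaleR_locally_convex tendsto_const l)
    then have "\<sigma> \<longlonglongrightarrow> (\<Sum>b\<in>B. l b *\<^sub>R b)" using P(4)[OF \<sigma>X] by simp
    moreover have "(\<Sum>b\<in>B. l b *\<^sub>R b) \<in> X" unfolding sp[symmetric] by (intro span_sum span_scale span_base)
    ultimately show "\<exists>x. limitin M.mtopology \<sigma> x sequentially"
      unfolding top limitin_subtopology using \<sigma>X by auto
  qed
  moreover have "n (c *\<^sub>R x) = \<bar>c\<bar> * n x" for c x
    unfolding n_def sum_distrib_left by (rule sum.cong) (use \<phi>(1) in \<open>auto simp: linear_cmul abs_mult\<close>)
  ultimately show ?thesis
    unfolding banach_space_on_def using sX metric top by blast
qed

lemma linear_on_sum:
  assumes T: "linear_on X T" and X: "subspace X" and "finite A" "\<And>a. a \<in> A \<Longrightarrow> g a \<in> X"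
  shows "T (\<Sum>a\<in>A. g a) = (\<Sum>a\<in>A. T (g a))"
  using assms(3,4)
proof (induction A)
  case empty
  then show ?case using linear_on_0[OF T subspace_0[OF X]] by simp
next
  case (insert a A)
  then show ?case using linear_on_add[OF T, of "g a" "sum g A"] subspace_sum[OF X, of A g] by simp
qed

text \<open>Kernel and image are finite-dimensional, hence complemented. The inverse
  \<open>S\<close> of \<open>T\<close> on \<open>C\<close> sends a basis of the image to chosen
  preimages, and it is continuous because the coordinates of the image are.\<close>

lemma finite_dimensional_split:
  assumes X: "finite_dimensional_space_on X" and Y: "subspace Y"
    and T: "linear_on X T" "T ` X \<subseteq> Y" "continuous_on X T"
  shows "\<exists>K C Q I. split_operator X Y (T :: 'a::locally_convex \<Rightarrow> 'b::locally_convex) K C Q I"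
proof -
  obtain B0 where B0: "finite B0" "span B0 = X" using X by (auto simp: finite_dimensional_space_on_def)
  have sX: "subspace X" using B0(2) subspace_span by metis
  define K where "K = {x \<in> X. T x = 0}"
  define I where "I = T ` X"
  have sK: "subspace K"
    using sX T(1) linear_on_0[OF T(1) subspace_0[OF sX]] by (auto simp: K_def subspace_def linear_on_def)
  have "finite_dimensional_space_on K"
  proof -
    obtain B where B: "B \<subseteq> K" "independent B" "K \<subseteq> span B" using maximal_independent_subset[of K] by blast
    have "finite B" using independent_span_bound[OF B0(1) B(2)] B(1) B0(2) by (auto simp: K_def)
    moreover have "span B = K" using B span_minimal[OF B(1) sK] by blast
    ultimately show ?thesis unfolding finite_dimensional_space_on_def by blast
  qed
  then obtain C where C: "topological_direct_sum X K C"
    using finite_dimensional_complemented[of K X] sX by (auto simp: K_def)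
  have "I = span (T ` B0)"
  proof
    have B0X: "B0 \<subseteq> X" using B0(2) span_superset by blast
    show "span (T ` B0) \<subseteq> I"
      unfolding I_def by (intro span_minimal image_mono B0X subspace_linear_image[OF T(1) sX order_refl])
    show "I \<subseteq> span (T ` B0)"
    proof
      fix y assume "y \<in> I"
      then obtain x where x: "x \<in> span B0" "y = T x" using B0(2) by (auto simp: I_def)
      obtain r where r: "x = (\<Sum>b\<in>B0. r b *\<^sub>R b)" using x(1) span_finite[OF B0(1)] by auto
      have "T x = (\<Sum>b\<in>B0. T (r b *\<^sub>R b))"
        unfolding r by (rule linear_on_sum[OF T(1) sX B0(1)]) (use B0X sX in \<open>auto intro: subspace_scale\<close>)
      also have "\<dots> = (\<Sum>b\<in>B0. r b *\<^sub>R T b)"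
        by (rule sum.cong) (use B0X linear_on_scale[OF T(1)] in auto)
      also have "\<dots> \<in> span (T ` B0)" by (intro span_sum span_scale span_base) auto
      finally show "y \<in> span (T ` B0)" using x(2) by simp
    qed
  qed
  then have fI: "finite_dimensional_space_on I"
    using B0(1) unfolding finite_dimensional_space_on_def by blast
  then obtain Q where Q: "topological_direct_sum Y I Q"
    using finite_dimensional_complemented[OF fI _ Y] T(2) by (auto simp: I_def)
  have sC: "subspace C" and CX: "C \<subseteq> X"
    using C by (auto simp: topological_direct_sum_def dest: closedin_imp_subset)
  note ker = kernel_complement[OF T(1) C[unfolded K_def], folded K_def]
  obtain B and \<phi> :: "'b \<Rightarrow> 'b \<Rightarrow> real" where fin: "finite B" and "independent B" and sp: "span B = I"
    and \<phi>: "\<And>b. b \<in> B \<Longrightarrow> linear (\<phi> b)" "\<And>b. b \<in> B \<Longrightarrow> continuous_on UNIV (\<phi> b)"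
    and P: "linear (\<lambda>x. \<Sum>b\<in>B. \<phi> b x *\<^sub>R b)" "continuous_on UNIV (\<lambda>x. \<Sum>b\<in>B. \<phi> b x *\<^sub>R b)"
      "\<And>x. (\<Sum>b\<in>B. \<phi> b x *\<^sub>R b) \<in> I" "\<And>x. x \<in> I \<Longrightarrow> (\<Sum>b\<in>B. \<phi> b x *\<^sub>R b) = x"
    by (rule finite_dimensional_coordinates[OF fI]) (rule that; assumption)
  have "\<exists>c. c \<in> C \<and> T c = b" if b: "b \<in> B" for b
  proof -
    have "b \<in> I" using b sp span_superset by blast
    then have "b \<in> T ` C" by (simp add: I_def ker(3))
    then show ?thesis by blast
  qed
  then obtain s where s: "\<And>b. b \<in> B \<Longrightarrow> s b \<in> C" "\<And>b. b \<in> B \<Longrightarrow> T (s b) = b" by metis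
  define S where "S y = (\<Sum>b\<in>B. \<phi> b y *\<^sub>R s b)" for y
  have SC: "S y \<in> C" for y unfolding S_def by (intro subspace_sum[OF sC] subspace_scale[OF sC] s)
  have TS: "T (S y) = y" if "y \<in> I" for y
  proof -
    have "T (S y) = (\<Sum>b\<in>B. T (\<phi> b y *\<^sub>R s b))"
      unfolding S_def by (rule linear_on_sum[OF T(1) sX fin]) (intro subspace_scale[OF sX] subsetD[OF CX] s)
    also have "\<dots> = (\<Sum>b\<in>B. \<phi> b y *\<^sub>R b)"
      by (rule sum.cong) (simp_all add: linear_on_scale[OF T(1) subsetD[OF CX s(1)]] s(2))
    finally show ?thesis using P(4)[OF that] by simp
  qed
  have Sc: "continuous_on I S"
    unfolding S_def continuous_on_def
  proof (intro ballI tendsto_sum tendsto_scaleR_locally_convex tendsto_const)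
    fix y b assume "b \<in> B"
    then have "continuous_on I (\<phi> b)" using \<phi>(2) continuous_on_subset by blast
    moreover assume "y \<in> I"
    ultimately show "(\<phi> b \<longlongrightarrow> \<phi> b y) (at y within I)" by (simp add: continuous_on_def)
  qed
  have TI: "T x \<in> I" if "x \<in> C" for x using that CX by (auto simp: I_def)
  have "homeomorphic_maps (top_of_set C) (top_of_set I) T S"
    unfolding homeomorphic_maps_def
  proof (intro conjI ballI)
    show "continuous_map (top_of_set C) (top_of_set I) T"
      using continuous_on_subset[OF T(3) CX] TI by (auto simp: continuous_map_subtopology_eu)
    show "continuous_map (top_of_set I) (top_of_set C) S"
      using Sc SC by (auto simp: continuous_map_subtopology_eu)
    show "S (T x) = x" if "x \<in> topspace (top_of_set C)" for x
      using that by (intro inj_onD[OF ker(2)] SC TS TI) simp_all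
    show "T (S y) = y" if "y \<in> topspace (top_of_set I)" for y using that TS by simp
  qed
  then have "homeomorphic_map (top_of_set C) (top_of_set I) T" unfolding homeomorphic_map_maps by blast
  then have "split_operator X Y T K C Q I"
    unfolding split_operator_def using C topological_direct_sum_commute[OF Q] T(1) by (simp add: K_def)
  then show ?thesis by (intro exI)
qed

lemma charts_around_exists:
  assumes "smooth_manifold N" "p \<in> points N"
  shows "\<exists>d. d \<in> charts_around N p"
proof -
  have "(\<Union>c\<in>charts N. chart_dom c) = points N" using assms(1) unfolding smooth_manifold_def by (elim conjE)
  then show ?thesis using assms(2) unfolding charts_around_def by blast
qed

theorem theorem2p2p10:
  fixes M :: "('m, 'e::locally_convex) manifold"
    and N :: "('n, 'f::locally_convex) manifold"
    and f :: "'m \<Rightarrow> 'n"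
  assumes "smooth_manifold M" and "smooth_manifold N" and "smooth_map M N f"
  shows "(banach_manifold M \<longrightarrow>
            (\<forall>m\<in>points M.
               regular_operator (tangent_space M m) (tangent_space N (f m)) (tangent_map M N f m) \<longrightarrow>
               has_normal_form_at M N f m)) \<and>
         (finite_dimensional_manifold M \<longrightarrow> (\<forall>m\<in>points M. has_normal_form_at M N f m))"
proof (intro conjI impI ballI)
  note M = assms(1) and N = assms(2) and f = assms(3)
  have chart_N: "\<exists>d. d \<in> charts_around N (f m)" if "m \<in> points M" for m
  proof (rule charts_around_exists[OF N])
    have "continuous_map (mtop M) (mtop N) f" using f unfolding smooth_map_def by (elim conjE)
    from continuous_map_image_subset_topspace[OF this] show "f m \<in> points N" using that by blast
  qed
  {
    fix m assume "banach_manifold M" and m: "m \<in> points M"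
      and reg: "regular_operator (tangent_space M m) (tangent_space N (f m)) (tangent_map M N f m)"
    then obtain c where c: "c \<in> charts_around M m" "banach_space_on (chart_model c)"
      unfolding banach_manifold_def by blast
    obtain d where d: "d \<in> charts_around N (f m)" using chart_N[OF m] by (elim exE)
    obtain K C Q I where "split_operator (chart_model c) (chart_model d)
        (directional_derivative (local_rep c d f) (chart_map c m)) K C Q I"
      using regular_tangent_map_split[OF M N f c(1) d reg] by (elim exE)
    then show "has_normal_form_at M N f m" by (rule normal_form_in_charts[OF M N f c(1) d c(2)])
  }
  fix m assume "finite_dimensional_manifold M" and m: "m \<in> points M"
  then obtain c where c: "c \<in> charts_around M m" "finite_dimensional_space_on (chart_model c)"
    unfolding finite_dimensional_manifold_def by blast
  obtain d where d: "d \<in> charts_around N (f m)" using chart_N[OF m] by (elim exE)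
  note c' = charts_aroundD[OF M c(1)] and d' = charts_aroundD[OF N d]
  note rep = smooth_map_local_rep[OF f c'(1) d'(1)]
  have x: "chart_map c m \<in> chart_map c ` (chart_dom c \<inter> f -` chart_dom d)" using c'(2) d'(2) by blast
  \<comment> \<open>In finite dimension the derivative in charts splits unconditionally, so it is
    used directly in place of the tangent map.\<close>
  obtain K C Q I where "split_operator (chart_model c) (chart_model d)
      (directional_derivative (local_rep c d f) (chart_map c m)) K C Q I"
    using finite_dimensional_split[OF c(2) d'(4) smooth_on_derivative_linear[OF c'(4) rep x] _
        smooth_on_derivative_continuous[OF c'(4) rep x]] smooth_on_derivative_range[OF c'(4) rep x] by blast
  then show "has_normal_form_at M N f m"
    by (rule normal_form_in_charts[OF M N f c(1) d finite_dimensional_banach[OF c(2)]])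
qed

end
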